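(* Let $(X,f)$ be an orientable elementary presentation of a 1-dimensional generalized solenoid such that every point $x\in X$ has a neighborhood $U_x$ for which $f(U_x)$ is an interval. Let $(\overline{X},\overline{f})$ be the associated 1-solenoid and let $d$ be the metric on $\overline{X}$ defined in the context. Then $(\overline{X},d,\overline{f})$ is a Smale space.
   Context: **Solenoids.** Let $X$ be a finite directed graph with vertex set $\mathcal{V}$ and edge set $\mathcal{E}=\{e_1,\dots,e_n\}$ and $f\colon X\to X$ a continuous map. Axioms: (0) Indecomposability: $(X,f)$ is indecomposable ($X$ is not a disjoint union of two nonempty closed $f$-invariant subsets). (1) Nonwandering: all points of $X$ are nonwandering under $f$. (2) Flattening: there is $k\ge1$ such that every $x\in X$ has an open neighborhood $U$ with $f^k(U)$ homeomorphic to $(-\epsilon,\epsilon)$. (3) Expansion: there are a metric $d'$ compatible with the topology and constants $C>0$, $\lambda'>1$ such that for all $n>0$ and all $x,y$ on a common edge, if $f^n$ maps the interval $[x,y]$ into an edge, then $d'(f^nx,f^ny)\ge C\lambda'^n d'(x,y)$. (4) Nonfolding: $f^n|_{X-\mathcal{V}}$ is locally one-to-one for every positive integer $n$. (5) Markov: $f(\mathcal{V})\subseteq\mathcal{V}$. If $(X,f)$ satisfies all six axioms, put $\overline{X}=\{(x_0,x_1,\dots)\in\prod_0^\infty X: f(x_{n+1})=x_n\}$ and let $\overline{f}\colon\overline X\to\overline X$ be the homeomorphism $\overline{f}(x_0,x_1,\dots)=(f(x_0),x_0,x_1,\dots)$. A homeomorphism topologically conjugate to $(\overline X,\overline f)$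 is called a (1-dimensional generalized) 1-solenoid, with presentation $(X,f)$. The presentation is elementary if $X$ is a wedge of circles and $f$ fixes the unique branch point; it is orientable if the edges of $X$ can be directed so that $f$ is orientation preserving (it maps positively directed paths to positively directed paths). **Metric.** There are a unique $\lambda>1$ and measure $\mu_0$ on $X$ with $\mu_0(X)=1$ and $\mu_0(f(I))=\lambda\mu_0(I)$ for every small interval $I\subset X$. Let $d_0(x_0,y_0)$ be the $\mu_0$-measure of the smallest interval from $x_0$ to $y_0$ in $X$, and for $x=(x_0,x_1,\dots)$, $y=(y_0,y_1,\dots)\in\overline X$ let $d(x,y)=\sum_{i\ge0}\lambda^{-i}d_0(x_i,y_i)$. Then $(\overline X,d)$ is a compact metric space. **Smale space.** Let $(Y,d)$ be a compact metric space and $\varphi$ a homeomorphism of $Y$. $(Y,d,\varphi)$ is a Smale space if there are constants $0<\lambda_0<1$, $\epsilon_0>0$ and a continuous map $(x,y)\mapsto[x,y]\in Y$ defined on $\{(x,y)\in Y\times Y: d(x,y)\le2\epsilon_0\}$ such that $[x,x]=x$, $[[x,y],z]=[x,z]$, $[x,[y,z]]=[x,z]$, $[\varphi(x),\varphi(y)]=\varphi([x,y])$ whenever both sides are defined, and such that, writing for $0<\epsilon\le\epsilon_0$ $$V^s(x,\epsilon)=\{y: [x,y]=y,\ d(x,y)<\epsilon\},\qquad V^u(x,\epsilon)=\{y:[y,x]=y,\ d(x,y)<\epsilon\},$$ one has $d(\varphi(y),\varphi(z))\le\lambda_0d(y,z)$ for $y,z\in V^s(x,\epsilon)$ and $d(\varphi^{-1}(y),\varphi^{-1}(z))\le\lambda_0d(y,z)$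 for $y,z\in V^u(x,\epsilon)$. *)

theory Defs
  imports "HOL-Analysis.Analysis"
begin

section \<open>Finite directed graphs as topological spaces\<close>

text \<open>
  A finite directed graph is a subspace \<^term>\<open>X\<close> of a Hausdorff space together with a finite vertex
  set \<^term>\<open>V\<close> and characteristic maps \<^term>\<open>e i\<close> on \<open>[0,1]\<close>, for \<open>i < n\<close>, of its directed edges.
  A characteristic map is injective on the open interval only, so loops are allowed. As \<^term>\<open>X\<close> is
  compact and Hausdorff, its topology is the quotient topology of the vertices and closed intervals.
\<close>

definition open_edge :: "(nat \<Rightarrow> real \<Rightarrow> 'a) \<Rightarrow> nat \<Rightarrow> 'a set" where
  "open_edge e i = e i ` {0<..<1}"

definition finite_digraph ::
  "'a::t2_space set \<Rightarrow> 'a set \<Rightarrow> nat \<Rightarrow> (nat \<Rightarrow> real \<Rightarrow> 'a) \<Rightarrow> bool" where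
  "finite_digraph X V n e \<longleftrightarrow>
     finite V \<and>
     (\<forall>i<n. path (e i) \<and> pathstart (e i) \<in> V \<and> pathfinish (e i) \<in> V \<and>
            inj_on (e i) {0<..<1} \<and> open_edge e i \<inter> V = {}) \<and>
     (\<forall>i<n. \<forall>j<n. i \<noteq> j \<longrightarrow> open_edge e i \<inter> open_edge e j = {}) \<and>
     X = V \<union> (\<Union>i<n. path_image (e i))"


section \<open>The axioms\<close>

definition indecomposable :: "'a::t2_space set \<Rightarrow> ('a \<Rightarrow> 'a) \<Rightarrow> bool" where
  "indecomposable X f \<longleftrightarrow>
     \<not> (\<exists>A B. A \<noteq> {} \<and> B \<noteq> {} \<and> A \<inter> B = {} \<and> A \<union> B = X \<and>
             closedin (top_of_set X) A \<and> closedin (top_of_set X) B \<and> f ` A \<subseteq> A \<and> f ` B \<subseteq> B)"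

definition all_nonwandering :: "'a::t2_space set \<Rightarrow> ('a \<Rightarrow> 'a) \<Rightarrow> bool" where
  "all_nonwandering X f \<longleftrightarrow>
     (\<forall>x\<in>X. \<forall>U. openin (top_of_set X) U \<and> x \<in> U \<longrightarrow> (\<exists>m\<ge>1. (f ^^ m) ` U \<inter> U \<noteq> {}))"

definition flattening :: "'a::t2_space set \<Rightarrow> ('a \<Rightarrow> 'a) \<Rightarrow> bool" where
  "flattening X f \<longleftrightarrow>
     (\<exists>k\<ge>1. \<forall>x\<in>X. \<exists>U. openin (top_of_set X) U \<and> x \<in> U \<and>
        (\<exists>\<epsilon>>0. (f ^^ k) ` U homeomorphic {- \<epsilon> <..< \<epsilon> :: real}))"

definition diam_wrt :: "('a \<Rightarrow> 'a \<Rightarrow> real) \<Rightarrow> 'a set \<Rightarrow> real" where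
  "diam_wrt d A = (SUP (u, v) \<in> A \<times> A. d u v)"

text \<open>
  In the expansion axiom the distance of the ends \<open>x\<close>, \<open>y\<close> of an interval \<open>[x,y]\<close> inside an edge
  has to be understood as the size of that interval, here its \<open>d'\<close>-diameter. This matters when
  the edge is a loop: if \<open>f\<^sup>m\<close> maps \<open>[x,y]\<close> onto all of a loop but a short piece around the vertex,
  the end points of the image are close to each other in every metric compatible with the
  topology, although \<open>[x,y]\<close> has been expanded; the inequality
  \<open>d' (f\<^sup>m x) (f\<^sup>m y) \<ge> C lam'\<^sup>m d' x y\<close> for the end points alone would exclude all graphs with a loop
  that is covered in this way. That inequality, required for all subintervals, implies the
  one for diameters. For the same reason edges are open cells here: the closed
  loop would also contain intervals that are wrapped around it several times.
\<close>

definition expansion ::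
  "'a::t2_space set \<Rightarrow> nat \<Rightarrow> (nat \<Rightarrow> real \<Rightarrow> 'a) \<Rightarrow> ('a \<Rightarrow> 'a) \<Rightarrow> bool" where
  "expansion X n e f \<longleftrightarrow>
     (\<exists>d' C lam'. Metric_space X d' \<and> Metric_space.mtopology X d' = top_of_set X \<and> C > 0 \<and> lam' > 1 \<and>
        (\<forall>m>0. \<forall>i<n. \<forall>j<n. \<forall>s t. 0 < s \<and> s \<le> t \<and> t < 1 \<and>
            (f ^^ m) ` (e i ` {s..t}) \<subseteq> open_edge e j \<longrightarrow>
            diam_wrt d' ((f ^^ m) ` (e i ` {s..t})) \<ge> C * lam' ^ m * diam_wrt d' (e i ` {s..t})))"

definition nonfolding :: "'a::t2_space set \<Rightarrow> 'a set \<Rightarrow> ('a \<Rightarrow> 'a) \<Rightarrow> bool" where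
  "nonfolding X V f \<longleftrightarrow>
     (\<forall>m\<ge>1. \<forall>x\<in>X - V. \<exists>U. openin (top_of_set (X - V)) U \<and> x \<in> U \<and> inj_on (f ^^ m) U)"

definition presentation ::
  "'a::t2_space set \<Rightarrow> 'a set \<Rightarrow> nat \<Rightarrow> (nat \<Rightarrow> real \<Rightarrow> 'a) \<Rightarrow> ('a \<Rightarrow> 'a) \<Rightarrow> bool" where
  "presentation X V n e f \<longleftrightarrow>
     finite_digraph X V n e \<and> continuous_on X f \<and> f ` X \<subseteq> X \<and>
     indecomposable X f \<and> all_nonwandering X f \<and> flattening X f \<and>
     expansion X n e f \<and> nonfolding X V f \<and> f ` V \<subseteq> V"

text \<open>
  A finite graph is a wedge of circles if it has a single vertex, so that all edges are loops at it;
  a single circle is a wedge of circles, its vertex playing the role of the branch point.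
\<close>

definition elementary_presentation ::
  "'a::t2_space set \<Rightarrow> 'a set \<Rightarrow> nat \<Rightarrow> (nat \<Rightarrow> real \<Rightarrow> 'a) \<Rightarrow> ('a \<Rightarrow> 'a) \<Rightarrow> bool" where
  "elementary_presentation X V n e f \<longleftrightarrow>
     presentation X V n e f \<and> (\<exists>p. V = {p} \<and> f p = p)"

text \<open>
  A path is positively directed if it can be cut into finitely many pieces, each of which runs
  through (part of) an edge in the direction of that edge.
\<close>

definition positively_directed :: "nat \<Rightarrow> (nat \<Rightarrow> real \<Rightarrow> 'a::t2_space) \<Rightarrow> (real \<Rightarrow> 'a) \<Rightarrow> bool" where
  "positively_directed n e \<gamma> \<longleftrightarrow> path \<gamma> \<and>
     (\<exists>(m::nat) t. t 0 = 0 \<and> t m = 1 \<and>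
        (\<forall>j<m. t j < t (Suc j) \<and>
           (\<exists>i<n. \<exists>h. continuous_on {t j..t (Suc j)} h \<and> strict_mono_on {t j..t (Suc j)} h \<and>
              h ` {t j..t (Suc j)} \<subseteq> {0..1} \<and> (\<forall>s\<in>{t j..t (Suc j)}. \<gamma> s = e i (h s)))))"

definition redirect :: "(nat \<Rightarrow> bool) \<Rightarrow> (nat \<Rightarrow> real \<Rightarrow> 'a::t2_space) \<Rightarrow> nat \<Rightarrow> real \<Rightarrow> 'a" where
  "redirect \<sigma> e i = (if \<sigma> i then e i else reversepath (e i))"

definition orientable :: "nat \<Rightarrow> (nat \<Rightarrow> real \<Rightarrow> 'a::t2_space) \<Rightarrow> ('a \<Rightarrow> 'a) \<Rightarrow> bool" where
  "orientable n e f \<longleftrightarrow>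
     (\<exists>\<sigma>. \<forall>\<gamma>. positively_directed n (redirect \<sigma> e) \<gamma> \<longrightarrow> positively_directed n (redirect \<sigma> e) (f \<circ> \<gamma>))"

definition one_step_flat :: "'a::t2_space set \<Rightarrow> ('a \<Rightarrow> 'a) \<Rightarrow> bool" where
  "one_step_flat X f \<longleftrightarrow>
     (\<forall>x\<in>X. \<exists>W U. openin (top_of_set X) W \<and> x \<in> W \<and> W \<subseteq> U \<and> U \<subseteq> X \<and>
        (\<exists>J::real set. is_interval J \<and> f ` U homeomorphic J))"


section \<open>The solenoid and its metric\<close>

definition solenoid_space :: "'a set \<Rightarrow> ('a \<Rightarrow> 'a) \<Rightarrow> (nat \<Rightarrow> 'a) set" where
  "solenoid_space X f = {x. (\<forall>i. x i \<in> X) \<and> (\<forall>i. f (x (Suc i)) = x i)}"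

definition solenoid_map :: "('a \<Rightarrow> 'a) \<Rightarrow> (nat \<Rightarrow> 'a) \<Rightarrow> (nat \<Rightarrow> 'a)" where
  "solenoid_map f x = case_nat (f (x 0)) x"

text \<open>\<^term>\<open>I\<close> is an interval in \<^term>\<open>A\<close> from \<^term>\<open>x\<close> to \<^term>\<open>y\<close>, degenerate if \<^term>\<open>x = y\<close>.\<close>

definition interval_between :: "'a::t2_space set \<Rightarrow> 'a \<Rightarrow> 'a \<Rightarrow> 'a set \<Rightarrow> bool" where
  "interval_between A x y I \<longleftrightarrow>
     (x = y \<and> x \<in> A \<and> I = {x}) \<or>
     (\<exists>g. arc g \<and> path_image g \<subseteq> A \<and> pathstart g = x \<and> pathfinish g = y \<and> I = path_image g)"

text \<open>
  The normalised measure that \<^term>\<open>f\<close> stretches by the factor \<^term>\<open>lam\<close> on small intervals.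
  An interval around a vertex, however small, may be folded by \<^term>\<open>f\<close>; the scaling
  identity fails for such an interval and is therefore required only where \<^term>\<open>f\<close> is injective.
\<close>

definition stretched_measure ::
  "'a::t2_space set \<Rightarrow> ('a \<Rightarrow> 'a) \<Rightarrow> real \<Rightarrow> 'a measure \<Rightarrow> bool" where
  "stretched_measure X f lam \<mu> \<longleftrightarrow>
     sets \<mu> = sets (restrict_space borel X) \<and> emeasure \<mu> X = 1 \<and>
     (\<forall>x\<in>X. \<exists>U. openin (top_of_set X) U \<and> x \<in> U \<and>
        (\<forall>a b I. interval_between U a b I \<and> inj_on f I \<longrightarrow> measure \<mu> (f ` I) = lam * measure \<mu> I))"

definition graph_dist :: "'a::t2_space set \<Rightarrow> 'a measure \<Rightarrow> 'a \<Rightarrow> 'a \<Rightarrow> real" where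
  "graph_dist X \<mu> x y = (INF I \<in> {I. interval_between X x y I}. measure \<mu> I)"

text \<open>
  The value \<open>0\<close> off the solenoid is immaterial; \<^locale>\<open>Metric_space\<close> asks for a function
  that is symmetric and nonnegative on the whole type.
\<close>

definition solenoid_dist ::
  "'a::t2_space set \<Rightarrow> ('a \<Rightarrow> 'a) \<Rightarrow> real \<Rightarrow> 'a measure \<Rightarrow> (nat \<Rightarrow> 'a) \<Rightarrow> (nat \<Rightarrow> 'a) \<Rightarrow> real" where
  "solenoid_dist X f lam \<mu> x y =
     (if x \<in> solenoid_space X f \<and> y \<in> solenoid_space X f
      then (\<Sum>i. graph_dist X \<mu> (x i) (y i) / lam ^ i) else 0)"


section \<open>Smale spaces\<close>

definition Vs :: "'b set \<Rightarrow> ('b \<Rightarrow> 'b \<Rightarrow> real) \<Rightarrow> ('b \<Rightarrow> 'b \<Rightarrow> 'b) \<Rightarrow> 'b \<Rightarrow> real \<Rightarrow> 'b set" where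
  "Vs Y d br x \<epsilon> = {y\<in>Y. br x y = y \<and> d x y < \<epsilon>}"

definition Vu :: "'b set \<Rightarrow> ('b \<Rightarrow> 'b \<Rightarrow> real) \<Rightarrow> ('b \<Rightarrow> 'b \<Rightarrow> 'b) \<Rightarrow> 'b \<Rightarrow> real \<Rightarrow> 'b set" where
  "Vu Y d br x \<epsilon> = {y\<in>Y. br y x = y \<and> d x y < \<epsilon>}"

definition smale_space :: "'b set \<Rightarrow> ('b \<Rightarrow> 'b \<Rightarrow> real) \<Rightarrow> ('b \<Rightarrow> 'b) \<Rightarrow> bool" where
  "smale_space Y d \<phi> \<longleftrightarrow>
     Metric_space Y d \<and> compact_space (Metric_space.mtopology Y d) \<and>
     homeomorphic_map (Metric_space.mtopology Y d) (Metric_space.mtopology Y d) \<phi> \<and>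
     (\<exists>lam\<^sub>0 \<epsilon>\<^sub>0 br. 0 < lam\<^sub>0 \<and> lam\<^sub>0 < 1 \<and> 0 < \<epsilon>\<^sub>0 \<and>
        continuous_map
          (subtopology (prod_topology (Metric_space.mtopology Y d) (Metric_space.mtopology Y d))
             {(x, y). d x y \<le> 2 * \<epsilon>\<^sub>0})
          (Metric_space.mtopology Y d) (\<lambda>(x, y). br x y) \<and>
        (\<forall>x\<in>Y. br x x = x) \<and>
        (\<forall>x\<in>Y. \<forall>y\<in>Y. \<forall>z\<in>Y. d x y \<le> 2 * \<epsilon>\<^sub>0 \<and> d (br x y) z \<le> 2 * \<epsilon>\<^sub>0 \<and> d x z \<le> 2 * \<epsilon>\<^sub>0 \<longrightarrow>
           br (br x y) z = br x z) \<and>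
        (\<forall>x\<in>Y. \<forall>y\<in>Y. \<forall>z\<in>Y. d y z \<le> 2 * \<epsilon>\<^sub>0 \<and> d x (br y z) \<le> 2 * \<epsilon>\<^sub>0 \<and> d x z \<le> 2 * \<epsilon>\<^sub>0 \<longrightarrow>
           br x (br y z) = br x z) \<and>
        (\<forall>x\<in>Y. \<forall>y\<in>Y. d x y \<le> 2 * \<epsilon>\<^sub>0 \<and> d (\<phi> x) (\<phi> y) \<le> 2 * \<epsilon>\<^sub>0 \<longrightarrow>
           br (\<phi> x) (\<phi> y) = \<phi> (br x y)) \<and>
        (\<forall>x\<in>Y. \<forall>\<epsilon>. 0 < \<epsilon> \<and> \<epsilon> \<le> \<epsilon>\<^sub>0 \<longrightarrow>
           (\<forall>y\<in>Vs Y d br x \<epsilon>. \<forall>z\<in>Vs Y d br x \<epsilon>. d (\<phi> y) (\<phi> z) \<le> lam\<^sub>0 * d y z) \<and>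
           (\<forall>y\<in>Vu Y d br x \<epsilon>. \<forall>z\<in>Vu Y d br x \<epsilon>.
              d (inv_into Y \<phi> y) (inv_into Y \<phi> z) \<le> lam\<^sub>0 * d y z)))"

end

theory Submission
  imports Defs
begin

text \<open>
  Parametrise the edges by \<open>\<mu>\<^sub>0\<close>-length. Then \<open>f\<close> moves points along the directed edges with constant
  speed \<open>lam\<close>, and flatness at the branch point \<open>p\<close> means that near \<open>p\<close> all incoming germs have one
  common image and all outgoing germs have one common image. Hence, although two nearby points of
  \<open>X\<close> only have a signed displacement \<open>\<tau>\<close>, two nearby points with the same displacement from a
  third have the same image. Moving the coordinate \<open>y\<^sub>i\<^sub>+\<^sub>1\<close> by \<open>t / lam\<^sup>i\<^sup>+\<^sup>1\<close> and applying \<open>f\<close>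
  therefore defines a local flow on the solenoid, along which the shift contracts. The bracket
  \<open>[x,y]\<close> is the point of the flow line of \<open>y\<close> at time \<open>\<tau> x\<^sub>0 y\<^sub>0\<close>; points with \<open>\<tau> x\<^sub>0 y\<^sub>0 = 0\<close>
  have \<open>f x\<^sub>0 = f y\<^sub>0\<close> and are contracted by the solenoid map.

  That \<open>\<mu>\<^sub>0\<close> has full support follows from the axioms: images of a null interval are null, by
  expansion some image of it passes through \<open>p\<close> and then another covers an edge, and by flatness
  and nonwandering the images of this edge cover all others.
\<close>

section \<open>The solenoid of a displacement system\<close>

text \<open>Near \<open>p\<close> distance and displacement really differ: points at equal height on
  two edges are apart, yet their displacement is 0. The map sees only the displacement:
  \<open>D (f x) (f y) = lam * \<bar>\<tau> x y\<bar>\<close> encodes flatness, and orientability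
  gives \<open>\<tau> (f x) (f y) = lam * \<tau> x y\<close> its sign. Together with additivity of
  \<open>\<tau>\<close> and solvability of \<open>\<tau> y x = t\<close> this is all the bracket
  needs, so the dynamical half of the proof mentions no graph. The contraction constant is
  \<open>1 / lam\<close>: the solenoid map divides the distance by \<open>lam\<close> and adds the
  head term \<open>D (f (x 0)) (f (y 0))\<close>, which vanishes on stable sets; along a flow line
  the coordinate distances form a geometric sequence of ratio \<open>1 / lam\<close>. On the graph
  side, an interval has two sides at \<open>p\<close>, so at most two germs fit into the image. A
  direction-preserving map produces an outgoing and an incoming one, hence exactly one of each kind.
  The graph distance is an infimum over arcs, whose unions need not contain their ends in an obvious
  arc; it is therefore recast as an infimum over connected sets.\<close>

lemma summable_geometric_bound:
  fixes g :: "nat \<Rightarrow> real"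
  assumes "lam > 1" "\<And>i. 0 \<le> g i" "\<And>i. g i \<le> M"
  shows "summable (\<lambda>i. g i / lam ^ i)"
proof (rule summable_comparison_test')
  show "summable (\<lambda>i. M * (1 / lam) ^ i)"
    using assms(1) by (intro summable_mult summable_geometric) auto
  show "norm (g i / lam ^ i) \<le> M * (1 / lam) ^ i" for i
    using assms by (simp add: power_one_over divide_right_mono abs_of_nonneg)
qed

text \<open>\<open>\<tau> x y\<close> is the signed displacement from \<open>y\<close> to \<open>x\<close>, meaningful only for nearby points.\<close>
locale displacement_system = Metric_space X D
  for X :: "'a set" and D +
  fixes f :: "'a \<Rightarrow> 'a" and lam :: real and \<tau> :: "'a \<Rightarrow> 'a \<Rightarrow> real" and r :: real
  assumes compact_X: "compact_space mtopology"
    and lam: "lam > 1" and r: "r > 0"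
    and f_in: "x \<in> X \<Longrightarrow> f x \<in> X"
    and tau_le: "\<lbrakk>x \<in> X; y \<in> X; D x y \<le> r\<rbrakk> \<Longrightarrow> \<bar>\<tau> x y\<bar> \<le> D x y"
    and tau_add: "\<lbrakk>x \<in> X; y \<in> X; z \<in> X; D x y \<le> r; D y z \<le> r; D x z \<le> r\<rbrakk> \<Longrightarrow> \<tau> x y + \<tau> y z = \<tau> x z"
    and tau_ex: "\<lbrakk>x \<in> X; \<bar>t\<bar> \<le> r\<rbrakk> \<Longrightarrow> \<exists>y\<in>X. D y x \<le> \<bar>t\<bar> \<and> \<tau> y x = t"
    and stretch: "\<And>x y. \<lbrakk>x \<in> X; y \<in> X; D x y \<le> r\<rbrakk> \<Longrightarrow> D (f x) (f y) = lam * \<bar>\<tau> x y\<bar>"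
    and tau_stretch: "\<And>x y. \<lbrakk>x \<in> X; y \<in> X; D x y \<le> r\<rbrakk> \<Longrightarrow> \<tau> (f x) (f y) = lam * \<tau> x y"
begin

abbreviation "Y \<equiv> solenoid_space X f"

definition sdist :: "(nat \<Rightarrow> 'a) \<Rightarrow> (nat \<Rightarrow> 'a) \<Rightarrow> real" where
  "sdist x y = (if x \<in> Y \<and> y \<in> Y then (\<Sum>i. D (x i) (y i) / lam ^ i) else 0)"

lemma lam0: "lam > 0" "lam \<noteq> 0"
  using lam by auto

lemma bounded_D: obtains M where "M > 0" "\<And>x y. x \<in> X \<Longrightarrow> y \<in> X \<Longrightarrow> D x y \<le> M"
proof -
  have "mbounded X"
    using compact_X compactin_imp_mbounded[of X] by (simp add: compact_space_def)
  then show ?thesis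
    using that mbounded_alt_pos[of X] by auto
qed

lemma Y_in: "x \<in> Y \<Longrightarrow> x i \<in> X"
  and Y_f: "x \<in> Y \<Longrightarrow> f (x (Suc i)) = x i"
  by (auto simp: solenoid_space_def)

lemma summable_D:
  assumes "\<And>i. x i \<in> X" "\<And>i. y i \<in> X"
  shows "summable (\<lambda>i. D (x i) (y i) / lam ^ i)"
proof -
  obtain M where "\<And>x y. x \<in> X \<Longrightarrow> y \<in> X \<Longrightarrow> D x y \<le> M"
    using bounded_D by metis
  then show ?thesis
    using assms by (intro summable_geometric_bound[OF lam, of _ M]) simp_all
qed

lemma D_le_dist:
  assumes "x \<in> Y" "y \<in> Y"
  shows "D (x i) (y i) \<le> lam ^ i * sdist x y"
proof -
  have "(\<Sum>j\<in>{i}. D (x j) (y j) / lam ^ j) \<le> (\<Sum>j. D (x j) (y j) / lam ^ j)"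
    using assms lam0 by (intro sum_le_suminf summable_D) (auto simp: Y_in)
  then show ?thesis
    using assms lam0 by (simp add: sdist_def field_simps)
qed

lemma D0_le_dist: "\<lbrakk>x \<in> Y; y \<in> Y\<rbrakk> \<Longrightarrow> D (x 0) (y 0) \<le> sdist x y"
  using D_le_dist[of x y 0] by simp

lemma sdist_mono:
  assumes "\<And>i. x i \<in> X" "\<And>i. y i \<in> X" "x \<in> Y" "y \<in> Y" "summable g"
    and "\<And>i. D (x i) (y i) / lam ^ i \<le> g i"
  shows "sdist x y \<le> suminf g"
  using assms by (simp add: sdist_def suminf_le summable_D)

lemma Metric_Y: "Metric_space Y sdist"
proof
  show "0 \<le> sdist x y" for x y
    using lam0 by (auto simp: sdist_def Y_in intro!: suminf_nonneg summable_D)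
  show "sdist x y = sdist y x" for x y
    by (simp add: sdist_def commute)
  show "(sdist x y = 0) = (x = y)" if "x \<in> Y" "y \<in> Y" for x y
  proof
    assume *: "sdist x y = 0"
    show "x = y"
    proof
      fix i
      show "x i = y i"
        using D_le_dist[OF that, of i] * that nonneg[of "x i" "y i"] zero[OF Y_in Y_in, of x y i i] by simp
    qed
  next
    assume "x = y"
    then show "sdist x y = 0"
      using that by (simp add: sdist_def Y_in)
  qed
  show "sdist x z \<le> sdist x y + sdist y z" if "x \<in> Y" "y \<in> Y" "z \<in> Y" for x y z
  proof -
    have "sdist x z \<le> (\<Sum>i. D (x i) (y i) / lam ^ i + D (y i) (z i) / lam ^ i)"
    proof (rule sdist_mono)
      show "summable (\<lambda>i. D (x i) (y i) / lam ^ i + D (y i) (z i) / lam ^ i)"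
        using that by (intro summable_add summable_D) (auto simp: Y_in)
      show "D (x i) (z i) / lam ^ i \<le> D (x i) (y i) / lam ^ i + D (y i) (z i) / lam ^ i" for i
        using that lam0 triangle[of "x i" "y i" "z i"]
        by (simp add: Y_in divide_right_mono flip: add_divide_distrib)
    qed (use that in \<open>auto simp: Y_in\<close>)
    also have "\<dots> = sdist x y + sdist y z"
      using that by (simp add: sdist_def suminf_add summable_D Y_in)
    finally show ?thesis .
  qed
qed

sublocale Y: Metric_space Y sdist
  by (rule Metric_Y)

abbreviation "\<phi> \<equiv> solenoid_map f"

definition shift :: "(nat \<Rightarrow> 'a) \<Rightarrow> (nat \<Rightarrow> 'a)" where
  "shift x = (\<lambda>i. x (Suc i))"

lemma phi_in: "x \<in> Y \<Longrightarrow> \<phi> x \<in> Y"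
  by (auto simp: solenoid_space_def solenoid_map_def f_in split: nat.split)

lemma shift_in: "x \<in> Y \<Longrightarrow> shift x \<in> Y"
  by (auto simp: solenoid_space_def shift_def)

lemma shift_phi: "shift (\<phi> x) = x"
  by (auto simp: solenoid_map_def shift_def)

lemma phi_shift: "x \<in> Y \<Longrightarrow> \<phi> (shift x) = x"
  by (auto simp: solenoid_map_def shift_def solenoid_space_def split: nat.split)

lemma inv_phi:
  assumes "x \<in> Y" shows "inv_into Y \<phi> x = shift x"
proof (rule inv_into_f_eq)
  show "inj_on \<phi> Y"
    by (metis inj_onI shift_phi)
qed (use assms in \<open>auto simp: shift_in phi_shift\<close>)

text \<open>The sequence \<open>\<phi> x\<close> is \<open>x\<close> moved one place with
  \<open>f (x 0)\<close> put in front, so its series is one head term plus the old series with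
  weights divided by \<open>lam\<close>. Contraction on stable sets and the Lipschitz bounds for
  \<open>\<phi>\<close> and \<open>shift\<close> are read off from this identity.\<close>

lemma dist_phi:
  assumes "x \<in> Y" "y \<in> Y"
  shows "sdist (\<phi> x) (\<phi> y) = D (f (x 0)) (f (y 0)) + sdist x y / lam"
proof -
  have s: "summable (\<lambda>i. D (\<phi> x i) (\<phi> y i) / lam ^ i)"
    using assms phi_in by (intro summable_D) (auto simp: Y_in)
  have "sdist (\<phi> x) (\<phi> y) = D (f (x 0)) (f (y 0)) + (\<Sum>i. D (x i) (y i) / lam ^ i / lam)"
    using assms suminf_split_head[OF s] phi_in[OF assms(1)] phi_in[OF assms(2)]
    by (simp add: sdist_def) (simp add: solenoid_map_def mult.commute)
  also have "(\<Sum>i. D (x i) (y i) / lam ^ i / lam) = sdist x y / lam"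
    using assms suminf_divide[OF summable_D[of x y], of lam] by (simp add: Y_in sdist_def)
  finally show ?thesis .
qed

section \<open>Local flow and bracket\<close>

text \<open>
  Every point at displacement \<open>t / lam\<close> from \<open>x\<close> has the same image. Thus \<open>flow t\<close> below moves the
  points of the solenoid along their unstable leaves although \<open>x\<close> cannot be moved in \<open>X\<close> itself.
\<close>
definition advance :: "'a \<Rightarrow> real \<Rightarrow> 'a" where
  "advance x t = f (SOME y. y \<in> X \<and> D y x \<le> \<bar>t\<bar> / lam \<and> \<tau> y x = t / lam)"

definition flow :: "real \<Rightarrow> (nat \<Rightarrow> 'a) \<Rightarrow> (nat \<Rightarrow> 'a)" where
  "flow t y = (\<lambda>i. advance (y (Suc i)) (t / lam ^ i))"

definition bracket :: "(nat \<Rightarrow> 'a) \<Rightarrow> (nat \<Rightarrow> 'a) \<Rightarrow> (nat \<Rightarrow> 'a)" where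
  "bracket x y = flow (\<tau> (x 0) (y 0)) y"

lemma tau_refl [simp]: "x \<in> X \<Longrightarrow> \<tau> x x = 0"
  using tau_add[of x x x] r by simp

lemma tau_sym: "\<lbrakk>x \<in> X; y \<in> X; D x y \<le> r\<rbrakk> \<Longrightarrow> \<tau> y x = - \<tau> x y"
  using tau_add[of x y x] r by (simp add: commute)

lemma advance_witness:
  assumes "x \<in> X" "\<bar>t\<bar> \<le> lam * r"
  obtains y where "y \<in> X" "D y x \<le> \<bar>t\<bar> / lam" "\<tau> y x = t / lam" "advance x t = f y"
proof -
  have "\<exists>y. y \<in> X \<and> D y x \<le> \<bar>t\<bar> / lam \<and> \<tau> y x = t / lam"
    using tau_ex[of x "t / lam"] assms lam0 by (auto simp: abs_divide field_simps)
  from someI_ex[OF this] show ?thesis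
    using that unfolding advance_def by blast
qed

text \<open>Independence of the choice in \<open>advance\<close>: two candidates within
  \<open>r / 2\<close> of \<open>x\<close> are within \<open>r\<close> of each other, their mutual
  displacement is 0 by additivity, and \<open>stretch\<close> then makes their images
  coincide.\<close>

lemma advance_eq:
  assumes "x \<in> X" "\<bar>t\<bar> \<le> lam * r / 2" "y \<in> X" "D y x \<le> r / 2" "\<tau> y x = t / lam"
  shows "advance x t = f y"
proof -
  have "\<bar>t\<bar> \<le> lam * r"
    using assms(2) r lam0 by (simp add: mult_pos_pos)
  then obtain z where z: "z \<in> X" "D z x \<le> \<bar>t\<bar> / lam" "\<tau> z x = t / lam" "advance x t = f z"
    using advance_witness assms(1) by metis
  have "\<bar>t\<bar> / lam \<le> r / 2"
    using assms(2) lam0 by (simp add: field_simps)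
  then have "D z x \<le> r / 2"
    using z(2) by linarith
  moreover have "D z y \<le> D z x + D y x"
    using triangle'[of z x y] z assms by simp
  ultimately have zy: "D z y \<le> r" "D z x \<le> r" "D x y \<le> r"
    using assms r by (auto simp: commute)
  then have "\<tau> z y = 0"
    using tau_add[of z x y] tau_sym[of x y] z assms by simp
  then have "D (f z) (f y) = 0"
    using stretch[of z y] zy z assms by simp
  then show ?thesis
    using z assms f_in by simp
qed

lemma advance_in: "\<lbrakk>x \<in> X; \<bar>t\<bar> \<le> lam * r\<rbrakk> \<Longrightarrow> advance x t \<in> X"
  using advance_witness f_in by metis

text \<open>The image \<open>f y\<close> of the witness lies at displacement \<open>t\<close> from
  \<open>f x\<close>, so it is itself a witness for moving \<open>f x\<close> by
  \<open>lam * t\<close>. The first equation is what puts a flowed sequence back into the inverse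
  limit.\<close>

lemma f_advance:
  assumes "x \<in> X" "\<bar>t\<bar> \<le> r / 2"
  shows "f (advance x t) = advance (f x) (lam * t)"
    and "D (advance x t) (f x) \<le> \<bar>t\<bar>" and "\<tau> (advance x t) (f x) = t"
proof -
  have "\<bar>t\<bar> \<le> lam * r"
    using assms(2) mult_strict_right_mono[OF lam r] r by linarith
  then obtain y where y: "y \<in> X" "D y x \<le> \<bar>t\<bar> / lam" "\<tau> y x = t / lam" "advance x t = f y"
    using advance_witness assms(1) by metis
  have "\<bar>t\<bar> / lam \<le> \<bar>t\<bar>"
    using lam mult_right_mono[of 1 lam "\<bar>t\<bar>"] by (simp add: field_simps)
  then have D: "D y x \<le> r"
    using y(2) assms(2) r by linarith
  then have 1: "D (f y) (f x) = \<bar>t\<bar>" "\<tau> (f y) (f x) = t"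
    using stretch[of y x] tau_stretch[of y x] y assms lam0 by (simp_all add: abs_divide)
  then show "D (advance x t) (f x) \<le> \<bar>t\<bar>" "\<tau> (advance x t) (f x) = t"
    using y by simp_all
  have "advance (f x) (lam * t) = f (f y)"
    using 1 assms y lam0 f_in by (intro advance_eq) (auto simp: abs_mult)
  then show "f (advance x t) = advance (f x) (lam * t)"
    using y by simp
qed

text \<open>The displacement from \<open>f x\<close> is exactly \<open>t\<close>, and a displacement
  never exceeds the distance; this turns the upper bound of \<open>f_advance\<close> into an
  equality.\<close>

lemma advance_stable: "\<lbrakk>x \<in> X; \<bar>t\<bar> \<le> r / 2\<rbrakk> \<Longrightarrow> D (advance x t) (f x) = \<bar>t\<bar>"
  using f_advance(2,3)[of x t] tau_le[of "advance x t" "f x"] advance_in[of x t] f_in r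
    mult_strict_right_mono[OF lam r]
  by auto

text \<open>Quarters of \<open>r\<close> keep every distance along the chain from \<open>x'\<close>
  over \<open>x\<close> and \<open>y\<close> to \<open>y'\<close> below \<open>3 * r / 4\<close>, so
  additivity applies twice.\<close>

lemma tau_close:
  assumes "x \<in> X" "x' \<in> X" "y \<in> X" "y' \<in> X"
    and "D x x' \<le> r / 4" "D y y' \<le> r / 4" "D x y \<le> r / 4"
  shows "\<tau> x' y' = \<tau> x' x + \<tau> x y + \<tau> y y'"
proof -
  have "D x' x \<le> r / 4" "D x' y \<le> r / 2" "D x' y' \<le> 3 * r / 4"
    using assms triangle[of x' x y] triangle[of x' y y'] by (auto simp: commute)
  then show ?thesis
    using assms r tau_add[of x' x y] tau_add[of x' y y'] by simp
qed

text \<open>Both sides are images of witnesses whose mutual displacement is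
  \<open>s / lam + \<tau> x y - t / lam\<close>, and \<open>stretch\<close> multiplies its absolute
  value by \<open>lam\<close>. All distance computations for the flow reduce to this
  formula.\<close>

lemma advance_diff:
  assumes "x \<in> X" "y \<in> X" "\<bar>s\<bar> \<le> lam * r / 4" "\<bar>t\<bar> \<le> lam * r / 4" "D x y \<le> r / 4"
  shows "D (advance x s) (advance y t) = \<bar>s - t + lam * \<tau> x y\<bar>"
proof -
  have b: "\<bar>s\<bar> \<le> lam * r" "\<bar>t\<bar> \<le> lam * r"
    using assms(3,4) mult_strict_right_mono[OF lam r] r by linarith+
  obtain u where u: "u \<in> X" "D u x \<le> \<bar>s\<bar> / lam" "\<tau> u x = s / lam" "advance x s = f u"
    using advance_witness assms(1) b by metis
  obtain v where v: "v \<in> X" "D v y \<le> \<bar>t\<bar> / lam" "\<tau> v y = t / lam" "advance y t = f v"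
    using advance_witness assms(2) b by metis
  have "\<bar>s\<bar> / lam \<le> r / 4" "\<bar>t\<bar> / lam \<le> r / 4"
    using assms lam0 by (simp_all add: field_simps)
  then have D: "D x u \<le> r / 4" "D y v \<le> r / 4"
    using u(2) v(2) commute[of x u] commute[of y v] by linarith+
  have "D u v \<le> r"
    using triangle[of u x v] triangle[of x y v] D u v assms r by (auto simp: commute)
  moreover have "\<tau> u v = \<tau> u x + \<tau> x y + \<tau> y v"
    using tau_close[of x u y v] D u v assms by simp
  moreover have "\<tau> y v = - (t / lam)"
    using tau_sym[of v y] D v r assms by (simp add: commute)
  ultimately have uv: "D u v \<le> r" "\<tau> u v = s / lam + \<tau> x y - t / lam"
    using u by simp_all
  show ?thesis
  proof -
    have "D (f u) (f v) = lam * \<bar>s / lam + \<tau> x y - t / lam\<bar>"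
      using stretch[of u v] u v uv by simp
    also have "\<dots> = \<bar>lam * (s / lam + \<tau> x y - t / lam)\<bar>"
      using lam0 by (simp add: abs_mult)
    also have "lam * (s / lam + \<tau> x y - t / lam) = s - t + lam * \<tau> x y"
      using lam0 by (simp add: field_simps)
    finally show ?thesis
      using u v by simp
  qed
qed

lemma flow_bound:
  assumes "\<bar>t\<bar> \<le> B" shows "\<bar>t / lam ^ i\<bar> \<le> B"
proof -
  have "\<bar>t\<bar> / lam ^ i \<le> \<bar>t\<bar> / 1"
    using lam by (intro divide_left_mono) auto
  then show ?thesis
    using assms lam0 by (simp add: abs_divide)
qed

lemma flow_in:
  assumes "y \<in> Y" "\<bar>t\<bar> \<le> r / 2" shows "flow t y \<in> Y"
proof -
  have b: "\<bar>t / lam ^ i\<bar> \<le> r / 2" for i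
    using assms flow_bound by blast
  have "\<bar>t / lam ^ i\<bar> \<le> lam * r" for i
    using b[of i] mult_strict_right_mono[OF lam r] r by linarith
  then have "flow t y i \<in> X" for i
    using assms by (simp add: flow_def advance_in Y_in)
  moreover have "f (flow t y (Suc i)) = flow t y i" for i
    using f_advance(1)[OF Y_in b[of "Suc i"], of y "Suc (Suc i)"] assms lam0
    by (simp add: flow_def Y_f)
  ultimately show ?thesis
    by (simp add: solenoid_space_def)
qed

lemma flow_0: "y \<in> Y \<Longrightarrow> flow 0 y = y"
  using advance_eq[of "y (Suc i)" 0 "y (Suc i)" for i] r lam0 by (auto simp: flow_def Y_in Y_f)

lemma flow_near:
  assumes "y \<in> Y" "\<bar>t\<bar> \<le> r / 2"
  shows "D (flow t y i) (y i) = \<bar>t\<bar> / lam ^ i" "\<tau> (flow t y i) (y i) = t / lam ^ i"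
  using advance_stable[of "y (Suc i)" "t / lam ^ i"] f_advance(3)[of "y (Suc i)" "t / lam ^ i"]
    flow_bound[OF assms(2), of i] assms lam0
  by (auto simp: flow_def Y_in Y_f abs_divide)

text \<open>In each coordinate both sides are images of points at the same displacement from
  \<open>y (Suc i)\<close>, so \<open>advance_diff\<close> gives distance 0. With times up to
  \<open>r / 8\<close> the total time stays within the range \<open>r / 4\<close> used
  there.\<close>

lemma flow_add:
  assumes "y \<in> Y" "\<bar>t\<bar> \<le> r / 8" "\<bar>s\<bar> \<le> r / 8"
  shows "flow s (flow t y) = flow (s + t) y"
proof
  fix i
  let ?a = "flow t y (Suc i)" and ?b = "y (Suc i)"
  have bd: "\<bar>t / lam ^ Suc i\<bar> \<le> r / 8" "\<bar>s / lam ^ i\<bar> \<le> r / 8" "\<bar>(s + t) / lam ^ i\<bar> \<le> r / 4"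
    using assms by (intro flow_bound; linarith)+
  have Da: "D ?a ?b = \<bar>t\<bar> / lam ^ Suc i" "\<tau> ?a ?b = t / lam ^ Suc i"
    using flow_near[OF assms(1), of t "Suc i"] assms r by auto
  have "lam * r > r"
    using mult_strict_right_mono[OF lam r] by simp
  have "D ?a ?b \<le> r / 4"
    using bd(1) Da r lam0 by (simp add: abs_divide abs_mult)
  have "?a \<in> X" "?b \<in> X"
    using assms flow_in[of y t] r by (auto simp: Y_in)
  have "D (advance ?a (s / lam ^ i)) (advance ?b ((s + t) / lam ^ i)) = \<bar>s / lam ^ i - (s + t) / lam ^ i + lam * \<tau> ?a ?b\<bar>"
  proof -
    have "\<bar>s / lam ^ i\<bar> \<le> lam * r / 4" "\<bar>(s + t) / lam ^ i\<bar> \<le> lam * r / 4"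
      using bd \<open>lam * r > r\<close> r by linarith+
    then show ?thesis
      using \<open>D ?a ?b \<le> r / 4\<close> \<open>?a \<in> X\<close> \<open>?b \<in> X\<close> advance_diff by blast
  qed
  also have "\<dots> = 0"
    using Da lam0 by (simp add: field_simps)
  finally have "advance ?a (s / lam ^ i) = advance ?b ((s + t) / lam ^ i)"
    using \<open>?a \<in> X\<close> \<open>?b \<in> X\<close> \<open>lam * r > r\<close> bd r by (simp add: advance_in)
  then show "flow s (flow t y) i = flow (s + t) y i"
    by (simp add: flow_def)
qed

text \<open>Time is multiplied by \<open>lam\<close>: coordinate 0 is \<open>f_advance\<close>, and
  in the others the index moves by one while \<open>t / lam ^ i\<close> equals
  \<open>lam * t / lam ^ Suc i\<close>.\<close>

lemma phi_flow:
  assumes "y \<in> Y" "\<bar>t\<bar> \<le> r / 2"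
  shows "\<phi> (flow t y) = flow (lam * t) (\<phi> y)"
proof
  fix i show "\<phi> (flow t y) i = flow (lam * t) (\<phi> y) i"
    using f_advance(1)[of "y 1" t] assms lam0 by (cases i) (auto simp: solenoid_map_def flow_def Y_in Y_f)
qed

text \<open>For two points on the flow line of the same \<open>y\<close> the term
  \<open>\<tau> x y\<close> in \<open>advance_diff\<close> is 0, so only the difference of the times
  remains. The exact ratio \<open>1 / lam\<close> between coordinates yields the contraction on
  unstable sets.\<close>

lemma dist_flow:
  assumes "y \<in> Y" "\<bar>s\<bar> \<le> r / 4" "\<bar>t\<bar> \<le> r / 4"
  shows "D (flow s y i) (flow t y i) = \<bar>s - t\<bar> / lam ^ i"
proof -
  have "lam * r > r"
    using mult_strict_right_mono[OF lam r] by simp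
  then have "\<bar>s / lam ^ i\<bar> \<le> lam * r / 4" "\<bar>t / lam ^ i\<bar> \<le> lam * r / 4"
    using flow_bound[OF assms(2), of i] flow_bound[OF assms(3), of i] by linarith+
  then have "D (flow s y i) (flow t y i) = \<bar>s / lam ^ i - t / lam ^ i\<bar>"
    using assms r advance_diff[of "y (Suc i)" "y (Suc i)" "s / lam ^ i" "t / lam ^ i"]
    by (simp add: flow_def Y_in)
  then show ?thesis
    using lam0 by (simp flip: diff_divide_distrib add: abs_divide)
qed

text \<open>Displacements say nothing about points more than \<open>r / 4\<close> apart. There the
  diameter bound \<open>M\<close> is at most \<open>4 * M / r\<close> times the distance, which
  explains the second summand of the constant; closer points are handled by
  \<open>advance_diff\<close>.\<close>

lemma advance_Lipschitz:
  obtains L where "L > 0"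
    "\<And>x y s t. \<lbrakk>x \<in> X; y \<in> X; \<bar>s\<bar> \<le> r / 4; \<bar>t\<bar> \<le> r / 4\<rbrakk> \<Longrightarrow> D (advance x s) (advance y t) \<le> \<bar>s - t\<bar> + L * D x y"
proof -
  obtain M where M: "M > 0" "\<And>x y. x \<in> X \<Longrightarrow> y \<in> X \<Longrightarrow> D x y \<le> M"
    using bounded_D by blast
  have lr: "lam * r > r"
    using mult_strict_right_mono[OF lam r] by simp
  have "D (advance x s) (advance y t) \<le> \<bar>s - t\<bar> + (lam + 4 * M / r) * D x y"
    if "x \<in> X" "y \<in> X" "\<bar>s\<bar> \<le> r / 4" "\<bar>t\<bar> \<le> r / 4" for x y s t
  proof (cases "D x y \<le> r / 4")
    case True
    have "D (advance x s) (advance y t) = \<bar>s - t + lam * \<tau> x y\<bar>"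
      using that True lr by (intro advance_diff) auto
    also have "\<dots> \<le> \<bar>s - t\<bar> + lam * \<bar>\<tau> x y\<bar>"
      using lam0 by (simp add: abs_mult order_trans[OF abs_triangle_ineq])
    also have "lam * \<bar>\<tau> x y\<bar> \<le> lam * D x y"
      using tau_le[of x y] that True r lam0 by simp
    also have "lam * D x y \<le> (lam + 4 * M / r) * D x y"
      using M r by (intro mult_right_mono) auto
    finally show ?thesis by simp
  next
    case False
    have "D (advance x s) (advance y t) \<le> (4 * M / r) * (r / 4)"
    proof -
      have "\<bar>s\<bar> \<le> lam * r" "\<bar>t\<bar> \<le> lam * r"
        using that lr r by linarith+
      then show ?thesis
        using M(2)[OF advance_in advance_in, of x s y t] that r by simp
    qed
    also have "\<dots> \<le> (4 * M / r) * D x y"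
      using False M r by (intro mult_left_mono) auto
    also have "\<dots> \<le> (lam + 4 * M / r) * D x y"
      using lam by (intro mult_right_mono) auto
    finally show ?thesis by linarith
  qed
  moreover have "lam + 4 * M / r > 0"
    using M r lam by (simp add: add_pos_pos)
  ultimately show ?thesis
    using that by blast
qed

section \<open>Compactness of the solenoid and continuity of the solenoid map\<close>

lemma f_Lipschitz: obtains L where "L > 0" "\<And>x y. x \<in> X \<Longrightarrow> y \<in> X \<Longrightarrow> D (f x) (f y) \<le> L * D x y"
proof -
  obtain L where L: "L > 0"
    "\<And>x y s t. \<lbrakk>x \<in> X; y \<in> X; \<bar>s\<bar> \<le> r / 4; \<bar>t\<bar> \<le> r / 4\<rbrakk> \<Longrightarrow> D (advance x s) (advance y t) \<le> \<bar>s - t\<bar> + L * D x y"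
    using advance_Lipschitz by blast
  have "advance x 0 = f x" if "x \<in> X" for x
    using advance_eq[of x 0 x] that r lam0 by simp
  then show ?thesis
    using that[of L] L(1) L(2)[of _ _ 0 0] r by simp
qed

text \<open>The solenoid is closed in a product of compact spaces, being cut out by the equations
  \<open>f (x (Suc i)) = x i\<close>. The identity from the product topology to the metric topology
  is continuous because the tails of the series are uniformly small, so compactness passes to the
  metric.\<close>

lemma compact_Y: "compact_space Y.mtopology"
proof -
  let ?P = "product_topology (\<lambda>_::nat. mtopology) UNIV"
  have fc: "continuous_map mtopology mtopology f"
  proof -
    obtain L where "L > 0" "\<And>x y. x \<in> X \<Longrightarrow> y \<in> X \<Longrightarrow> D (f x) (f y) \<le> L * D x y"
      using f_Lipschitz by blast
    then have L: "L > 0" "\<And>x y. x \<in> X \<Longrightarrow> y \<in> X \<Longrightarrow> D (f x) (f y) \<le> L * D x y" by auto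
    show ?thesis
      unfolding metric_continuous_map[OF Metric_space_axioms]
    proof (intro conjI ballI allI impI)
      show "f ` X \<subseteq> X" using f_in by auto
      fix a \<epsilon> :: real and b assume "b \<in> X" "0 < \<epsilon>"
      show "\<exists>\<delta>>0. \<forall>x. x \<in> X \<and> D b x < \<delta> \<longrightarrow> D (f b) (f x) < \<epsilon>"
      proof (intro exI[of _ "\<epsilon> / L"] conjI allI impI)
        fix x assume "x \<in> X \<and> D b x < \<epsilon> / L"
        then show "D (f b) (f x) < \<epsilon>"
          using L(2)[of b x] L(1) \<open>b \<in> X\<close> by (simp add: field_simps)
      qed (use L \<open>0 < \<epsilon>\<close> in auto)
    qed
  qed
  have "closedin ?P {x \<in> topspace ?P. f (x (Suc i)) = x i}" for i
  proof (rule closedin_continuous_maps_eq[OF Hausdorff_space_mtopology])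
    show "continuous_map ?P mtopology (\<lambda>x. f (x (Suc i)))"
      using continuous_map_compose[OF continuous_map_product_projection[of "Suc i" UNIV "\<lambda>_. mtopology"] fc]
      by (simp add: o_def)
    show "continuous_map ?P mtopology (\<lambda>x. x i)"
      by (rule continuous_map_product_projection) auto
  qed
  then have "closedin ?P (\<Inter>i. {x \<in> topspace ?P. f (x (Suc i)) = x i})"
    by (intro closedin_Inter) auto
  also have "(\<Inter>i. {x \<in> topspace ?P. f (x (Suc i)) = x i}) = Y"
    by (auto simp: solenoid_space_def PiE_def Pi_def)
  finally have clo: "closedin ?P Y" .
  moreover have "compact_space ?P"
    using compact_X by (simp add: compact_space_product_topology)
  ultimately have cY: "compactin ?P Y"
    using closedin_compact_space by blast
  have "continuous_map (subtopology ?P Y) Y.mtopology id"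
    unfolding Y.continuous_map_to_metric
  proof (intro ballI allI impI)
    fix x and \<epsilon> :: real
    assume "x \<in> topspace (subtopology ?P Y)" and \<epsilon>: "0 < \<epsilon>"
    then have x: "x \<in> Y" by auto
    obtain M where M: "M > 0" "\<And>x y. x \<in> X \<Longrightarrow> y \<in> X \<Longrightarrow> D x y \<le> M"
      using bounded_D by blast
    have geo: "summable (\<lambda>i. M * (1 / lam) ^ i)"
      using lam by (intro summable_mult summable_geometric) auto
    obtain N where N: "(\<Sum>i. M * (1 / lam) ^ (i + N)) < \<epsilon> / 2"
    proof -
      have "(\<lambda>N. \<Sum>i. M * (1 / lam) ^ (i + N)) \<longlonglongrightarrow> 0"
        using suminf_exist_split2[OF geo] by simp
      then have "\<forall>\<^sub>F N in sequentially. (\<Sum>i. M * (1 / lam) ^ (i + N)) < \<epsilon> / 2"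
        using \<epsilon> by (intro order_tendstoD) auto
      then show ?thesis
        using that eventually_happens' sequentially_bot by blast
    qed
    \<comment> \<open>The first \<open>N\<close> terms, each below \<open>\<eta>\<close>, then add
      up to at most half of \<open>\<epsilon>\<close>; the other half is for the tail. The summand 1
      keeps the denominator positive for \<open>N = 0\<close>.\<close>
    define \<eta> where "\<eta> = \<epsilon> / (2 * (N + 1))"
    have \<eta>: "\<eta> > 0" using \<epsilon> by (simp add: \<eta>_def)
    define W where "W = (\<Pi>\<^sub>E i\<in>UNIV. if i < N then mball (x i) \<eta> else X)"
    have "finite {i \<in> UNIV. (if i < N then mball (x i) \<eta> else X) \<noteq> topspace mtopology}"
      by (rule finite_subset[of _ "{..<N}"]) auto
    then have "openin ?P W"
      unfolding W_def openin_PiE_gen using openin_topspace[of mtopology] by auto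
    then have "openin (subtopology ?P Y) (Y \<inter> W)"
      by (simp add: openin_subtopology_Int2)
    moreover have "x \<in> Y \<inter> W"
      using x \<eta> Y_in[OF x] by (auto simp: W_def)
    moreover have "id y \<in> Y.mball (id x) \<epsilon>" if "y \<in> Y \<inter> W" for y
    proof -
      have "y i \<in> (if i < N then mball (x i) \<eta> else X)" for i
        using that by (simp add: W_def PiE_iff)
      then have near: "D (x i) (y i) < \<eta>" if "i < N" for i
        using that by (metis in_mball)
      have y: "y \<in> Y"
        using that by simp
      have s: "summable (\<lambda>i. D (x i) (y i) / lam ^ i)"
        using x y by (intro summable_D) (auto simp: Y_in)
      have "sdist x y = (\<Sum>i. D (x (i+N)) (y (i+N)) / lam ^ (i+N)) + (\<Sum>i<N. D (x i) (y i) / lam ^ i)"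
        using x y suminf_split_initial_segment[OF s, of N] by (simp add: sdist_def)
      also have "(\<Sum>i. D (x (i+N)) (y (i+N)) / lam ^ (i+N)) \<le> (\<Sum>i. M * (1 / lam) ^ (i + N))"
      proof (rule suminf_le)
        show "D (x (i+N)) (y (i+N)) / lam ^ (i+N) \<le> M * (1 / lam) ^ (i + N)" for i
          using M(2)[OF Y_in Y_in] x y lam0 by (simp add: power_one_over divide_right_mono)
        show "summable (\<lambda>i. D (x (i+N)) (y (i+N)) / lam ^ (i+N))"
          using s by (subst summable_iff_shift)
        show "summable (\<lambda>i. M * (1 / lam) ^ (i + N))"
          using geo by (subst summable_iff_shift)
      qed
      also have "(\<Sum>i<N. D (x i) (y i) / lam ^ i) \<le> (\<Sum>i<N. \<eta>)"
      proof (rule sum_mono)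
        fix i assume "i \<in> {..<N}"
        then have "D (x i) (y i) / lam ^ i \<le> D (x i) (y i) / 1"
          using lam by (intro divide_left_mono) auto
        then show "D (x i) (y i) / lam ^ i \<le> \<eta>"
          using near[of i] \<open>i \<in> {..<N}\<close> by auto
      qed
      also have "(\<Sum>i<N. \<eta>) \<le> \<epsilon> / 2"
        using \<epsilon> by (simp add: \<eta>_def field_simps)
      finally show ?thesis
        using N x y by auto
    qed
    ultimately show "\<exists>U. openin (subtopology ?P Y) U \<and> x \<in> U \<and> (\<forall>y\<in>U. id y \<in> Y.mball (id x) \<epsilon>)"
      by blast
  qed
  then have "compactin Y.mtopology (id ` Y)"
    using cY by (intro image_compactin) (auto simp: compactin_subspace subtopology_subtopology)
  then show ?thesis
    by (simp add: compact_space_def)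
qed

lemma homeomorphic_phi: "homeomorphic_map Y.mtopology Y.mtopology \<phi>"
  unfolding homeomorphic_map_maps
  homeomorphic_maps_def
proof (intro exI[of _ shift] conjI ballI)
  obtain L where L: "L > 0" "\<And>x y. x \<in> X \<Longrightarrow> y \<in> X \<Longrightarrow> D (f x) (f y) \<le> L * D x y"
    using f_Lipschitz by blast
  have "sdist (\<phi> x) (\<phi> y) \<le> (L + 1 / lam) * sdist x y" if "x \<in> Y" "y \<in> Y" for x y
  proof -
    have "D (f (x 0)) (f (y 0)) \<le> L * D (x 0) (y 0)"
      using L that by (simp add: Y_in)
    also have "\<dots> \<le> L * sdist x y"
      using L that D0_le_dist by (intro mult_left_mono) auto
    finally show ?thesis
      using that by (simp add: dist_phi algebra_simps)
  qed
  then have "Lipschitz_continuous_map (metric (Y, sdist)) (metric (Y, sdist)) \<phi>"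
    unfolding Lipschitz_continuous_map_def
    using phi_in by (auto simp: Y.mspace_metric Y.mdist_metric)
  then show "continuous_map Y.mtopology Y.mtopology \<phi>"
    using Lipschitz_continuous_imp_continuous_map by (metis Y.mtopology_of)
  have "sdist (shift x) (shift y) \<le> lam * sdist x y" if "x \<in> Y" "y \<in> Y" for x y
  proof -
    have "sdist x y = D (f (shift x 0)) (f (shift y 0)) + sdist (shift x) (shift y) / lam"
      using dist_phi[OF shift_in shift_in] that by (simp add: phi_shift)
    then have "sdist (shift x) (shift y) / lam \<le> sdist x y"
      by simp
    then show ?thesis
      using lam0 by (simp add: field_simps)
  qed
  then have "Lipschitz_continuous_map (metric (Y, sdist)) (metric (Y, sdist)) shift"
    unfolding Lipschitz_continuous_map_def
    using shift_in by (auto simp: Y.mspace_metric Y.mdist_metric)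
  then show "continuous_map Y.mtopology Y.mtopology shift"
    using Lipschitz_continuous_imp_continuous_map by (metis Y.mtopology_of)
qed (auto simp: shift_phi phi_shift)

text \<open>Coordinate \<open>i\<close> of the flow is computed from coordinate \<open>Suc i\<close>
  of the base point, so the base points enter through \<open>shift\<close>, at the cost of a factor
  \<open>lam\<close>. The difference of the times contributes at most a geometric series, with sum
  \<open>G\<close>.\<close>

lemma flow_Lipschitz:
  obtains L where "L > 0"
    "\<And>x y s t. \<lbrakk>x \<in> Y; y \<in> Y; \<bar>s\<bar> \<le> r / 4; \<bar>t\<bar> \<le> r / 4\<rbrakk>
      \<Longrightarrow> sdist (flow s x) (flow t y) \<le> L * (\<bar>s - t\<bar> + sdist x y)"
proof -
  obtain L where L: "L > 0"
    "\<And>x y s t. \<lbrakk>x \<in> X; y \<in> X; \<bar>s\<bar> \<le> r / 4; \<bar>t\<bar> \<le> r / 4\<rbrakk> \<Longrightarrow> D (advance x s) (advance y t) \<le> \<bar>s - t\<bar> + L * D x y"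
    using advance_Lipschitz by blast
  have geo: "summable (\<lambda>i. (1 / lam) ^ i)"
    using lam by (intro summable_geometric) auto
  define G where "G = (\<Sum>i. (1 / lam) ^ i)"
  have "G \<ge> 0"
    unfolding G_def using geo lam0 by (intro suminf_nonneg) auto
  have "sdist (flow s x) (flow t y) \<le> (G + L * lam) * (\<bar>s - t\<bar> + sdist x y)"
    if *: "x \<in> Y" "y \<in> Y" "\<bar>s\<bar> \<le> r / 4" "\<bar>t\<bar> \<le> r / 4" for x y s t
  proof -
    let ?g = "\<lambda>i. \<bar>s - t\<bar> * (1 / lam) ^ i + L * (D (shift x i) (shift y i) / lam ^ i)"
    have sh: "shift x \<in> Y" "shift y \<in> Y"
      using * shift_in by auto
    have S: "summable (\<lambda>i. D (shift x i) (shift y i) / lam ^ i)"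
      using sh by (intro summable_D) (auto simp: Y_in)
    have fl: "flow s x \<in> Y" "flow t y \<in> Y"
      using * r by (auto intro!: flow_in)
    have "sdist (flow s x) (flow t y) \<le> suminf ?g"
    proof (rule sdist_mono)
      show "summable ?g"
        using S geo by (intro summable_add summable_mult)
      fix i
      have "D (flow s x i) (flow t y i) \<le> \<bar>s / lam ^ i - t / lam ^ i\<bar> + L * D (x (Suc i)) (y (Suc i))"
        unfolding flow_def using * flow_bound[OF *(3), of i] flow_bound[OF *(4), of i]
        by (intro L) (simp_all only: Y_in)
      also have "\<bar>s / lam ^ i - t / lam ^ i\<bar> \<le> \<bar>s - t\<bar>"
        using flow_bound[of "s - t" "\<bar>s - t\<bar>" i] by (simp add: diff_divide_distrib)
      finally have "D (flow s x i) (flow t y i) / lam ^ i \<le> (\<bar>s - t\<bar> + L * D (x (Suc i)) (y (Suc i))) / lam ^ i"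
        using lam0 by (simp add: divide_right_mono)
      also have "\<dots> = ?g i"
        by (simp add: shift_def add_divide_distrib power_one_over)
      finally show "D (flow s x i) (flow t y i) / lam ^ i \<le> ?g i" .
    qed (use fl in \<open>auto simp: Y_in\<close>)
    also have "suminf ?g = \<bar>s - t\<bar> * G + L * sdist (shift x) (shift y)"
      using suminf_add[OF summable_mult[OF geo, of "\<bar>s - t\<bar>"] summable_mult[OF S, of L]]
        suminf_mult[OF geo, of "\<bar>s - t\<bar>"] suminf_mult[OF S, of L] sh
      by (simp add: G_def sdist_def)
    also have "sdist (shift x) (shift y) \<le> lam * sdist x y"
    proof -
      have "sdist (shift x) (shift y) / lam \<le> sdist x y"
        using dist_phi[OF sh] * by (simp add: phi_shift)
      then show ?thesis
        using lam0 by (simp add: field_simps)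
    qed
    also have "\<bar>s - t\<bar> * G + L * (lam * sdist x y) \<le> (G + L * lam) * (\<bar>s - t\<bar> + sdist x y)"
      using \<open>G \<ge> 0\<close> L(1) lam0 by (simp add: algebra_simps)
    finally show ?thesis
      using L(1) by simp
  qed
  moreover have "G + L * lam > 0"
    using L \<open>G \<ge> 0\<close> lam0 by (simp add: add_nonneg_pos)
  ultimately show ?thesis
    using that by blast
qed

section \<open>The axioms of the bracket\<close>

lemma bracket_in:
  assumes "x \<in> Y" "y \<in> Y" "sdist x y \<le> r / 4"
  shows "bracket x y \<in> Y" "\<bar>\<tau> (x 0) (y 0)\<bar> \<le> sdist x y"
proof -
  have "D (x 0) (y 0) \<le> sdist x y"
    using assms D0_le_dist by simp
  then show "\<bar>\<tau> (x 0) (y 0)\<bar> \<le> sdist x y"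
    using assms tau_le[of "x 0" "y 0"] r by (simp add: Y_in)
  then show "bracket x y \<in> Y"
    using assms r by (simp add: bracket_def flow_in)
qed

lemma bracket_refl: "x \<in> Y \<Longrightarrow> bracket x x = x"
  by (simp add: bracket_def flow_0 Y_in)

lemma bracket_near:
  assumes "x \<in> Y" "y \<in> Y" "sdist x y \<le> r / 4"
  shows "D (bracket x y 0) (y 0) \<le> sdist x y" "\<tau> (bracket x y 0) (y 0) = \<tau> (x 0) (y 0)"
  using assms bracket_in[OF assms] flow_near[of y "\<tau> (x 0) (y 0)" 0] r
  by (auto simp: bracket_def)

text \<open>A bracket depends on its left argument only through a displacement of coordinate 0. The
  point \<open>bracket x y\<close> has the same displacement from \<open>y\<close> as
  \<open>x\<close> has, and by additivity also the same displacement from \<open>z\<close>.\<close>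

lemma bracket_left:
  assumes "x \<in> Y" "y \<in> Y" "z \<in> Y" "sdist x y \<le> r / 8" "sdist x z \<le> r / 8"
  shows "bracket (bracket x y) z = bracket x z"
proof -
  let ?w = "bracket x y"
  have w: "?w \<in> Y" "D (?w 0) (y 0) \<le> r / 8" "\<tau> (?w 0) (y 0) = \<tau> (x 0) (y 0)"
    using bracket_in[of x y] bracket_near[of x y] assms r by auto
  have D: "D (x 0) (y 0) \<le> r / 8" "D (x 0) (z 0) \<le> r / 8"
    using assms D0_le_dist order_trans by blast+
  have "D (y 0) (z 0) \<le> r / 4"
    using D triangle[of "y 0" "x 0" "z 0"] assms by (simp add: Y_in commute)
  moreover have "D (?w 0) (z 0) \<le> D (?w 0) (y 0) + D (y 0) (z 0)"
    using assms w by (intro triangle) (auto simp: Y_in)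
  ultimately have "\<tau> (?w 0) (z 0) = \<tau> (x 0) (z 0)"
    using tau_add[of "?w 0" "y 0" "z 0"] tau_add[of "x 0" "y 0" "z 0"] w D r assms
    by (simp add: Y_in)
  then show ?thesis
    by (simp add: bracket_def)
qed

text \<open>The point \<open>bracket y z\<close> lies on the flow line of \<open>z\<close> at time
  \<open>?t\<close>, and from there \<open>x\<close> is \<open>?s - ?t\<close> away. Flowing for
  these two times in succession is flowing for \<open>?s\<close>, by
  \<open>flow_add\<close>.\<close>

lemma bracket_right:
  assumes "x \<in> Y" "y \<in> Y" "z \<in> Y" "sdist y z \<le> r / 16" "sdist x z \<le> r / 16"
  shows "bracket x (bracket y z) = bracket x z"
proof -
  let ?w = "bracket y z" and ?t = "\<tau> (y 0) (z 0)" and ?s = "\<tau> (x 0) (z 0)"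
  have w: "?w \<in> Y" "D (?w 0) (z 0) \<le> r / 16" "\<tau> (?w 0) (z 0) = ?t"
    using bracket_in[of y z] bracket_near[of y z] assms r by auto
  have b: "\<bar>?t\<bar> \<le> r / 16" "\<bar>?s\<bar> \<le> r / 16"
    using bracket_in(2)[of y z] bracket_in(2)[of x z] assms r by auto
  have D: "D (x 0) (z 0) \<le> r / 16"
    using assms D0_le_dist order_trans by blast
  have "D (x 0) (?w 0) \<le> r / 4"
    using D w triangle[of "x 0" "z 0" "?w 0"] assms r by (simp add: Y_in commute)
  then have "\<tau> (x 0) (?w 0) = ?s - ?t"
    using tau_add[of "x 0" "?w 0" "z 0"] w D r assms by (simp add: Y_in)
  then have "bracket x ?w = flow (?s - ?t) (flow ?t z)"
    by (simp add: bracket_def)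
  also have "\<dots> = flow ?s z"
  proof -
    have "\<bar>?s - ?t\<bar> \<le> r / 8" "\<bar>?t\<bar> \<le> r / 8"
      using b by linarith+
    then show ?thesis
      using flow_add[of z ?t "?s - ?t"] assms by simp
  qed
  finally show ?thesis
    by (simp add: bracket_def)
qed

lemma bracket_phi:
  assumes "x \<in> Y" "y \<in> Y" "sdist x y \<le> r / 4"
  shows "bracket (\<phi> x) (\<phi> y) = \<phi> (bracket x y)"
proof -
  have "D (x 0) (y 0) \<le> r"
    using assms D0_le_dist[of x y] r by simp
  then have "\<tau> (\<phi> x 0) (\<phi> y 0) = lam * \<tau> (x 0) (y 0)"
    using assms by (simp add: solenoid_map_def tau_stretch Y_in)
  then show ?thesis
    using phi_flow[of y "\<tau> (x 0) (y 0)"] bracket_in(2)[OF assms] assms r by (simp add: bracket_def)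
qed

lemma continuous_bracket:
  assumes "\<epsilon> \<le> r / 8"
  shows "continuous_map (subtopology (prod_topology Y.mtopology Y.mtopology) {(x, y). sdist x y \<le> \<epsilon>})
    Y.mtopology (\<lambda>(x, y). bracket x y)"
  unfolding Y.continuous_map_to_metric
proof (intro ballI allI impI, clarify)
  let ?T = "prod_topology Y.mtopology Y.mtopology" and ?S = "{(x, y). sdist x y \<le> \<epsilon>}"
  fix x y and \<eta> :: real
  assume "(x, y) \<in> topspace (subtopology ?T ?S)" and \<eta>: "0 < \<eta>"
  then have xy: "x \<in> Y" "y \<in> Y" "sdist x y \<le> \<epsilon>"
    by auto
  obtain L where L: "L > 0"
    "\<And>x y s t. \<lbrakk>x \<in> Y; y \<in> Y; \<bar>s\<bar> \<le> r / 4; \<bar>t\<bar> \<le> r / 4\<rbrakk>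
      \<Longrightarrow> sdist (flow s x) (flow t y) \<le> L * (\<bar>s - t\<bar> + sdist x y)"
    using flow_Lipschitz by blast
  \<comment> \<open>If both arguments move by less than \<open>\<rho>\<close>, the flow time changes
    by less than \<open>2 * \<rho>\<close> and the base point by less than \<open>\<rho>\<close>;
    the Lipschitz constant \<open>L\<close> then gives \<open>3 * L * \<rho>\<close>.\<close>
  define \<rho> where "\<rho> = min (r / 4) (\<eta> / (3 * L))"
  have \<rho>: "0 < \<rho>" "\<rho> \<le> r / 4" "3 * L * \<rho> \<le> \<eta>"
    using \<eta> L r by (auto simp: \<rho>_def min_def field_simps)
  let ?U = "(Y.mball x \<rho> \<times> Y.mball y \<rho>) \<inter> ?S"
  have "openin (subtopology ?T ?S) ?U"
    by (intro openin_subtopology_Int) (simp add: openin_prod_Times_iff)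
  moreover have "(x, y) \<in> ?U"
    using xy \<rho> by auto
  moreover have "bracket u v \<in> Y.mball (bracket x y) \<eta>" if "(u, v) \<in> ?U" for u v
  proof -
    have uv: "u \<in> Y" "v \<in> Y" "sdist u v \<le> \<epsilon>" "sdist x u < \<rho>" "sdist y v < \<rho>"
      using that by auto
    have D: "D (x 0) (u 0) < \<rho>" "D (y 0) (v 0) < \<rho>" "D (x 0) (y 0) \<le> \<epsilon>"
      using D0_le_dist[of x u] D0_le_dist[of y v] D0_le_dist[of x y] uv xy by auto
    then have "\<tau> (u 0) (v 0) = \<tau> (u 0) (x 0) + \<tau> (x 0) (y 0) + \<tau> (y 0) (v 0)"
      using \<rho> assms r uv xy by (intro tau_close) (auto simp: Y_in)
    moreover have "\<bar>\<tau> (u 0) (x 0)\<bar> \<le> D (u 0) (x 0)"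
      using \<rho> r uv xy D by (intro tau_le) (simp_all add: Y_in commute)
    moreover have "\<bar>\<tau> (y 0) (v 0)\<bar> \<le> D (y 0) (v 0)"
      using \<rho> r uv xy D by (intro tau_le) (simp_all add: Y_in)
    ultimately have t: "\<bar>\<tau> (x 0) (y 0) - \<tau> (u 0) (v 0)\<bar> < 2 * \<rho>"
      using D by (simp add: commute)
    have "sdist (bracket x y) (bracket u v) \<le> L * (\<bar>\<tau> (x 0) (y 0) - \<tau> (u 0) (v 0)\<bar> + sdist y v)"
      unfolding bracket_def using uv xy bracket_in(2)[of x y] bracket_in(2)[of u v] assms r
      by (intro L) auto
    also have "\<dots> < L * (3 * \<rho>)"
      using t uv L by (intro mult_strict_left_mono) auto
    also have "\<dots> \<le> \<eta>"
      using \<rho> by (simp add: algebra_simps)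
    finally show ?thesis
      using uv xy bracket_in(1)[of x y] bracket_in(1)[of u v] assms r by simp
  qed
  ultimately show "\<exists>U. openin (subtopology ?T ?S) U \<and> (x, y) \<in> U \<and>
      (\<forall>y'\<in>U. (case y' of (x, y) \<Rightarrow> bracket x y) \<in> Y.mball (bracket x y) \<eta>)"
    by (intro exI[of _ ?U]) auto
qed

text \<open>The displacement of \<open>bracket x y\<close> from \<open>y\<close> is that of
  \<open>x\<close> from \<open>y\<close>. If the bracket is \<open>y\<close> itself, this
  displacement is 0, and \<open>f\<close> identifies the zeroth coordinates.\<close>

lemma bracket_stable:
  assumes "x \<in> Y" "y \<in> Y" "sdist x y \<le> r / 4" "bracket x y = y"
  shows "f (x 0) = f (y 0)"
proof -
  have "D (x 0) (y 0) \<le> r"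
    using assms D0_le_dist[of x y] r by simp
  moreover have "\<tau> (x 0) (y 0) = 0"
    using bracket_near(2)[OF assms(1-3)] assms by (simp add: Y_in)
  ultimately show ?thesis
    using stretch[of "x 0" "y 0"] assms f_in by (simp add: Y_in)
qed

theorem smale_space: "smale_space Y sdist \<phi>"
proof -
  \<comment> \<open>The bracket must be usable up to distance \<open>2 * ?e\<close>, and the most
    restrictive of its laws, \<open>bracket_right\<close>, holds up to
    \<open>r / 16\<close>.\<close>
  let ?e = "r / 32"
  have stable: "sdist (\<phi> y) (\<phi> z) \<le> (1 / lam) * sdist y z"
    if "x \<in> Y" "0 < \<epsilon> \<and> \<epsilon> \<le> ?e" "y \<in> Vs Y sdist bracket x \<epsilon>" "z \<in> Vs Y sdist bracket x \<epsilon>"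
    for x \<epsilon> y z
  proof -
    have "y \<in> Y" "z \<in> Y" "f (x 0) = f (y 0)" "f (x 0) = f (z 0)"
      using that r by (auto simp: Vs_def intro!: bracket_stable)
    then show ?thesis
      using f_in[OF Y_in] by (simp add: dist_phi)
  qed
  have unstable: "sdist (inv_into Y \<phi> y) (inv_into Y \<phi> z) \<le> (1 / lam) * sdist y z"
    if "x \<in> Y" "0 < \<epsilon> \<and> \<epsilon> \<le> ?e" "y \<in> Vu Y sdist bracket x \<epsilon>" "z \<in> Vu Y sdist bracket x \<epsilon>"
    for x \<epsilon> y z
  proof -
    have yz: "y \<in> Y" "z \<in> Y" "bracket y x = y" "bracket z x = z" "sdist y x \<le> ?e" "sdist z x \<le> ?e"
      using that by (auto simp: Vu_def Y.commute)
    \<comment> \<open>Membership in the unstable set of \<open>x\<close> means lying on the flow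
      line of \<open>x\<close>, so \<open>y\<close> and \<open>z\<close> are two points of one flow
      line with times \<open>s\<close> and \<open>t\<close>.\<close>
    define s t where "s = \<tau> (y 0) (x 0)" and "t = \<tau> (z 0) (x 0)"
    have st: "\<bar>s\<bar> \<le> r / 4" "\<bar>t\<bar> \<le> r / 4" "flow s x = y" "flow t x = z"
      using bracket_in(2)[of y x] bracket_in(2)[of z x] yz that r by (auto simp: s_def t_def bracket_def)
    have "D (y i) (z i) = \<bar>s - t\<bar> / lam ^ i" for i
      using dist_flow[OF that(1) st(1,2), of i] st by simp
    then have eq: "D (shift y i) (shift z i) / lam ^ i = D (y i) (z i) / lam ^ i / lam" for i
      by (simp add: shift_def)
    have "sdist (shift y) (shift z) = (\<Sum>i. D (y i) (z i) / lam ^ i / lam)"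
      using yz shift_in by (simp only: eq sdist_def) simp
    also have "\<dots> = sdist y z / lam"
      using yz suminf_divide[OF summable_D[of y z], of lam] by (simp add: Y_in sdist_def)
    finally show ?thesis
      using yz by (simp add: inv_phi)
  qed
  have left: "bracket (bracket x y) z = bracket x z"
    if "x \<in> Y" "y \<in> Y" "z \<in> Y"
      "sdist x y \<le> 2 * ?e \<and> sdist (bracket x y) z \<le> 2 * ?e \<and> sdist x z \<le> 2 * ?e" for x y z
    using that r by (intro bracket_left) auto
  show ?thesis
    unfolding smale_space_def
    by (rule conjI[OF Metric_Y], rule conjI[OF compact_Y], rule conjI[OF homeomorphic_phi],
        rule exI[of _ "1 / lam"], rule exI[of _ ?e], rule exI[of _ bracket], intro conjI ballI allI impI;
        (rule left stable unstable; assumption)?)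
      (use lam r in \<open>auto intro!: continuous_bracket[of "2 * ?e", simplified] bracket_refl bracket_right bracket_phi\<close>)
qed

end

section \<open>Metric wedges of circles\<close>

text \<open>\<open>A i\<close> is an edge parametrised by arc length; the last two axioms are the flatness at \<open>p\<close>.\<close>
locale metric_wedge = Metric_space X D
  for X :: "'a set" and D +
  fixes p :: 'a and n :: nat and A :: "nat \<Rightarrow> real \<Rightarrow> 'a" and len :: "nat \<Rightarrow> real"
    and f :: "'a \<Rightarrow> 'a" and lam :: real and a b :: nat
  assumes len_pos: "i < n \<Longrightarrow> 0 < len i"
    and A_in: "\<lbrakk>i < n; 0 \<le> r; r \<le> len i\<rbrakk> \<Longrightarrow> A i r \<in> X"
    and A_ex: "x \<in> X \<Longrightarrow> \<exists>i r. i < n \<and> 0 \<le> r \<and> r \<le> len i \<and> x = A i r"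
    and A_0: "i < n \<Longrightarrow> A i 0 = p" and A_len: "i < n \<Longrightarrow> A i (len i) = p"
    and D_same: "\<lbrakk>i < n; 0 \<le> r; r \<le> len i; 0 \<le> s; s \<le> len i\<rbrakk> \<Longrightarrow>
      D (A i r) (A i s) = min \<bar>r - s\<bar> (len i - \<bar>r - s\<bar>)"
    and D_other: "\<lbrakk>i < n; 0 \<le> r; r \<le> len i; j < n; 0 \<le> s; s \<le> len j; i \<noteq> j\<rbrakk> \<Longrightarrow>
      D (A i r) (A j s) = min r (len i - r) + min s (len j - s)"
    and f_in: "x \<in> X \<Longrightarrow> f x \<in> X"
    and lam: "lam > 1" and ab: "a < n" "b < n"
    and right: "\<lbrakk>i < n; 0 < r; r < len i\<rbrakk> \<Longrightarrow> \<exists>\<epsilon> j q. \<epsilon> > 0 \<and> r + \<epsilon> \<le> len i \<and> j < n \<and> 0 \<le> q \<and>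
      q + lam * \<epsilon> \<le> len j \<and> (\<forall>t. 0 \<le> t \<and> t \<le> \<epsilon> \<longrightarrow> f (A i (r + t)) = A j (q + lam * t))"
    and left: "\<lbrakk>i < n; 0 < r; r < len i\<rbrakk> \<Longrightarrow> \<exists>\<epsilon> j q. \<epsilon> > 0 \<and> \<epsilon> \<le> r \<and> j < n \<and> q \<le> len j \<and>
      lam * \<epsilon> \<le> q \<and> (\<forall>t. 0 \<le> t \<and> t \<le> \<epsilon> \<longrightarrow> f (A i (r - t)) = A j (q - lam * t))"
    and right_p: "i < n \<Longrightarrow> \<exists>\<epsilon>>0. \<forall>t. 0 \<le> t \<and> t \<le> \<epsilon> \<longrightarrow> f (A i t) = A a (lam * t)"
    and left_p: "i < n \<Longrightarrow> \<exists>\<epsilon>>0. \<forall>t. 0 \<le> t \<and> t \<le> \<epsilon> \<longrightarrow> f (A i (len i - t)) = A b (len b - lam * t)"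
begin

lemma p_in: "p \<in> X"
  using A_in[of a 0] A_0 ab len_pos by (simp add: less_imp_le)

text \<open>Equal points have distance 0, and the two distance formulas vanish only for equal
  parameters on one edge or for parameters that both belong to \<open>p\<close>.\<close>

lemma A_eq:
  assumes "i < n" "0 \<le> r" "r \<le> len i" "j < n" "0 \<le> s" "s \<le> len j" "A i r = A j s"
  shows "i = j \<and> r = s \<or> (r = 0 \<or> r = len i) \<and> (s = 0 \<or> s = len j)"
proof -
  have 0: "D (A i r) (A j s) = 0"
    using assms A_in by simp
  show ?thesis
  proof (cases "i = j")
    case True
    then have "min \<bar>r - s\<bar> (len i - \<bar>r - s\<bar>) = 0"
      using 0 D_same[of i r s] assms by simp
    then show ?thesis
      using True assms by (auto simp: min_def abs_if split: if_splits)
  next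
    case False
    then have "min r (len i - r) + min s (len j - s) = 0"
      using 0 D_other[of i r j s] assms by simp
    then show ?thesis
      using assms by (auto simp: min_def split: if_splits)
  qed
qed

text \<open>The length of the shortest edge is the scale for all neighbourhoods: within
  \<open>ell / 4\<close> of \<open>p\<close> the two ends of any edge stay apart.\<close>

definition ell :: real where
  "ell = Min (len ` {..<n})"

lemma edges_nonempty: "{..<n} \<noteq> {}"
  using ab by auto

lemma ell_pos: "ell > 0"
  using edges_nonempty len_pos by (simp add: ell_def Min_gr_iff)

lemma ell_le: "i < n \<Longrightarrow> ell \<le> len i"
  by (simp add: ell_def)

text \<open>A coordinate common to all edges near \<open>p\<close>: outgoing ends get positive
  values, incoming ends negative ones, and both parameters of \<open>p\<close> get 0.\<close>

definition signed :: "nat \<Rightarrow> real \<Rightarrow> real" where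
  "signed i r = (if r \<le> len i / 2 then r else r - len i)"

definition height :: "'a \<Rightarrow> real" where
  "height x = (SOME c. \<exists>i r. i < n \<and> 0 \<le> r \<and> r \<le> len i \<and> x = A i r \<and> c = signed i r)"

definition pos :: "'a \<Rightarrow> real" where
  "pos x = (SOME q. \<exists>i. i < n \<and> 0 < q \<and> q < len i \<and> x = A i q)"

text \<open>Two charts are glued: heights in the star around \<open>p\<close>, positions along an
  edge elsewhere. If only one of two nearby points lies in the star, both are interior to the same
  edge, so comparing positions is meaningful.\<close>

definition disp :: "'a \<Rightarrow> 'a \<Rightarrow> real" where
  "disp x y = (if \<bar>height x\<bar> < ell / 4 \<and> \<bar>height y\<bar> < ell / 4 then height x - height y else pos x - pos y)"

text \<open>The choice is harmless: by \<open>A_eq\<close> only \<open>p\<close> has several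
  representations, and all of these have signed coordinate 0.\<close>

lemma height_A:
  assumes "i < n" "0 \<le> r" "r \<le> len i" shows "height (A i r) = signed i r"
  unfolding height_def
proof (rule some_equality)
  show "\<exists>j s. j < n \<and> 0 \<le> s \<and> s \<le> len j \<and> A i r = A j s \<and> signed i r = signed j s"
    using assms by blast
  fix c assume "\<exists>j s. j < n \<and> 0 \<le> s \<and> s \<le> len j \<and> A i r = A j s \<and> c = signed j s"
  then obtain j s where j: "j < n" "0 \<le> s" "s \<le> len j" "A i r = A j s" "c = signed j s"
    by blast
  from A_eq[OF assms j(1-4)] show "c = signed i r"
    using j assms len_pos[of i] len_pos[of j] by (auto simp: signed_def)
qed

lemma pos_A:
  assumes "i < n" "0 < r" "r < len i" shows "pos (A i r) = r"
  unfolding pos_def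
proof (rule some_equality)
  show "\<exists>j. j < n \<and> 0 < r \<and> r < len j \<and> A i r = A j r"
    using assms by blast
  fix q assume "\<exists>j. j < n \<and> 0 < q \<and> q < len j \<and> A i r = A j q"
  then obtain j where j: "j < n" "0 < q" "q < len j" "A i r = A j q"
    by blast
  then show "q = r"
    using A_eq[of i r j q] assms by auto
qed

lemma height_p: "height p = 0"
  using height_A[of a 0] ab len_pos[of a] by (simp add: A_0 signed_def)

text \<open>On one edge the distance is the difference of the heights; between different edges it is
  the sum of their absolute values, as the shortest way passes \<open>p\<close>. The two agree when
  the heights have opposite signs, which is the case of a path crossing \<open>p\<close>
  forwards.\<close>

lemma star:
  assumes "x \<in> X" "y \<in> X" "\<bar>height x\<bar> < ell / 4" "\<bar>height y\<bar> < ell / 4"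
  shows "\<bar>height x - height y\<bar> \<le> D x y"
    and "height x \<le> 0 \<Longrightarrow> 0 \<le> height y \<Longrightarrow> D x y = height y - height x"
proof -
  obtain i r where x: "i < n" "0 \<le> r" "r \<le> len i" "x = A i r"
    using A_ex[OF assms(1)] by blast
  obtain j s where y: "j < n" "0 \<le> s" "s \<le> len j" "y = A j s"
    using A_ex[OF assms(2)] by blast
  have h: "height x = signed i r" "height y = signed j s"
    using x y height_A by auto
  have b: "\<bar>signed i r\<bar> < ell / 4" "\<bar>signed j s\<bar> < ell / 4"
    using assms(3,4) h by simp_all
  have l: "ell \<le> len i" "ell \<le> len j"
    using x y ell_le by auto
  have "\<bar>height x - height y\<bar> \<le> D x y \<and> (height x \<le> 0 \<longrightarrow> 0 \<le> height y \<longrightarrow> D x y = height y - height x)"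
  proof (cases "i = j")
    case True
    have "D x y = min \<bar>r - s\<bar> (len i - \<bar>r - s\<bar>)"
      using D_same[of i r s] x y True by simp
    then have "D x y = \<bar>height x - height y\<bar>"
      unfolding h using b l x y True
      by (auto simp: signed_def min_def abs_if field_simps split: if_splits)
    then show ?thesis
      by simp
  next
    case False
    have "D x y = min r (len i - r) + min s (len j - s)"
      using D_other[of i r j s] x y False by simp
    also have "\<dots> = \<bar>height x\<bar> + \<bar>height y\<bar>"
      unfolding h using x y by (auto simp: signed_def min_def abs_if field_simps split: if_splits)
    finally show ?thesis
      by simp
  qed
  then show "\<bar>height x - height y\<bar> \<le> D x y"
    and "height x \<le> 0 \<Longrightarrow> 0 \<le> height y \<Longrightarrow> D x y = height y - height x"
    by blast+
qed

lemma disp_star: "\<lbrakk>\<bar>height x\<bar> < ell / 4; \<bar>height y\<bar> < ell / 4\<rbrakk> \<Longrightarrow> disp x y = height x - height y"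
  by (simp add: disp_def)

text \<open>For parameters at most \<open>ell / 8\<close> apart the way round the loop is the longer
  one. In the star such parameters belong to the same end of the edge, so the heights differ by the
  same amount as the parameters.\<close>

lemma edge:
  assumes "i < n" "0 \<le> r" "r \<le> len i" "0 \<le> s" "s \<le> len i" "\<bar>r - s\<bar> \<le> ell / 8"
  shows "D (A i r) (A i s) = \<bar>r - s\<bar>" and "disp (A i r) (A i s) = r - s"
proof -
  have l: "ell \<le> len i" "ell > 0"
    using assms ell_le ell_pos by auto
  show "D (A i r) (A i s) = \<bar>r - s\<bar>"
    using D_same[of i r s] assms l by simp
  have h: "height (A i r) = signed i r" "height (A i s) = signed i s"
    using assms height_A by auto
  show "disp (A i r) (A i s) = r - s"
  proof (cases "\<bar>signed i r\<bar> < ell / 4 \<and> \<bar>signed i s\<bar> < ell / 4")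
    case True
    then have "signed i r - signed i s = r - s"
      using assms l by (auto simp: signed_def abs_if field_simps split: if_splits)
    then show ?thesis
      using True h by (simp add: disp_def)
  next
    case False
    then have "0 < r" "r < len i" "0 < s" "s < len i"
      using assms l by (auto simp: signed_def abs_if field_simps split: if_splits)
    then show ?thesis
      using False h assms by (auto simp: disp_def pos_A)
  qed
qed

text \<open>Any route from \<open>A i r\<close> that leaves the edge, or goes round it, passes
  \<open>p\<close> and is at least as long as the distance from \<open>A i r\<close> to
  \<open>p\<close>.\<close>

lemma near_interior:
  assumes "i < n" "0 < r" "r < len i" "y \<in> X" "D y (A i r) < min r (len i - r)"
  obtains s where "0 \<le> s" "s \<le> len i" "y = A i s" "D y (A i r) = \<bar>s - r\<bar>"
proof -
  obtain j s where y: "j < n" "0 \<le> s" "s \<le> len j" "y = A j s"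
    using A_ex[OF assms(4)] by blast
  have "j = i"
  proof (rule ccontr)
    assume "j \<noteq> i"
    then have "D y (A i r) = min s (len j - s) + min r (len i - r)"
      using D_other[of j s i r] y assms by simp
    moreover have "0 \<le> min s (len j - s)"
      using y by simp
    ultimately show False
      using assms(5) by linarith
  qed
  moreover have "D y (A i r) = \<bar>s - r\<bar>"
    using D_same[of i s r] y assms \<open>j = i\<close> by (auto simp: min_def abs_if split: if_splits)
  ultimately show ?thesis
    using that y by blast
qed

lemma far_edge:
  assumes "x \<in> X" "y \<in> X" "\<bar>height x\<bar> \<ge> ell / 4" "D x y \<le> ell / 16" "x = A i r" "i < n" "0 \<le> r" "r \<le> len i"
  obtains s where "0 \<le> s" "s \<le> len i" "y = A i s" "\<bar>s - r\<bar> \<le> ell / 16"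
proof -
  have "ell / 4 \<le> \<bar>signed i r\<bar>"
    using assms height_A by simp
  then have "ell / 4 \<le> min r (len i - r)"
    using assms by (auto simp: signed_def abs_if min_def field_simps split: if_splits)
  moreover have "D y x \<le> ell / 16"
    using assms commute by simp
  ultimately have "0 < r" "r < len i" "D y (A i r) < min r (len i - r)"
    using ell_pos assms(5) by (auto simp: min_def split: if_splits)
  then obtain s where "0 \<le> s" "s \<le> len i" "y = A i s" "D y (A i r) = \<bar>s - r\<bar>"
    using near_interior assms by metis
  then show ?thesis
    using that \<open>D y x \<le> ell / 16\<close> assms(5) by simp
qed

text \<open>All three points lie on the edge of the far point \<open>x\<close>, where displacements
  are differences of parameters. The three rearrangements allow the far point to be in any position
  of the additivity law.\<close>

lemma disp_add_far:
  assumes "x \<in> X" "y \<in> X" "z \<in> X" "D x y \<le> ell / 16" "D x z \<le> ell / 16" "\<bar>height x\<bar> \<ge> ell / 4"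
  shows "disp x y + disp y z = disp x z \<and> disp y x + disp x z = disp y z \<and> disp y z + disp z x = disp y x"
proof -
  obtain i r where x: "i < n" "0 \<le> r" "r \<le> len i" "x = A i r"
    using A_ex[OF assms(1)] by blast
  obtain s where s: "0 \<le> s" "s \<le> len i" "y = A i s" "\<bar>s - r\<bar> \<le> ell / 16"
    using far_edge[OF assms(1,2,6,4) x(4,1-3)] by blast
  obtain t where t: "0 \<le> t" "t \<le> len i" "z = A i t" "\<bar>t - r\<bar> \<le> ell / 16"
    using far_edge[OF assms(1,3,6,5) x(4,1-3)] by blast
  have "\<bar>s - t\<bar> \<le> ell / 8" "\<bar>r - s\<bar> \<le> ell / 8" "\<bar>r - t\<bar> \<le> ell / 8" "\<bar>s - r\<bar> \<le> ell / 8" "\<bar>t - r\<bar> \<le> ell / 8"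
    using s(4) t(4) by linarith+
  then show ?thesis
    using edge(2)[of i s t] edge(2)[of i r s] edge(2)[of i r t] edge(2)[of i s r] edge(2)[of i t r] x s t
    by simp
qed

lemma disp_add:
  assumes "x \<in> X" "y \<in> X" "z \<in> X" "D x y \<le> ell / 16" "D y z \<le> ell / 16" "D x z \<le> ell / 16"
  shows "disp x y + disp y z = disp x z"
proof -
  consider "\<bar>height x\<bar> < ell / 4" "\<bar>height y\<bar> < ell / 4" "\<bar>height z\<bar> < ell / 4"
    | "\<bar>height x\<bar> \<ge> ell / 4" | "\<bar>height y\<bar> \<ge> ell / 4" | "\<bar>height z\<bar> \<ge> ell / 4"
    by linarith
  then show ?thesis
  proof cases
    case 1
    then show ?thesis
      by (simp add: disp_star)
  next
    case 2
    then show ?thesis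
      using disp_add_far[of x y z] assms by simp
  next
    case 3
    then show ?thesis
      using disp_add_far[of y x z] assms commute[of x y] by simp
  next
    case 4
    then show ?thesis
      using disp_add_far[of z x y] assms commute[of x z] commute[of y z] by simp
  qed
qed

lemma disp_far:
  assumes "x \<in> X" "y \<in> X" "D x y \<le> ell / 16" "\<bar>height x\<bar> \<ge> ell / 4"
  shows "\<bar>disp x y\<bar> = D x y \<and> \<bar>disp y x\<bar> = D x y"
proof -
  obtain i r where x: "i < n" "0 \<le> r" "r \<le> len i" "x = A i r"
    using A_ex[OF assms(1)] by blast
  obtain s where s: "0 \<le> s" "s \<le> len i" "y = A i s" "\<bar>s - r\<bar> \<le> ell / 16"
    using far_edge[OF assms(1,2,4,3) x(4,1-3)] by blast
  then have "\<bar>r - s\<bar> \<le> ell / 8" "\<bar>s - r\<bar> \<le> ell / 8"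
    by linarith+
  then show ?thesis
    using edge[of i r s] edge(2)[of i s r] x s by simp
qed

lemma disp_le:
  assumes "x \<in> X" "y \<in> X" "D x y \<le> ell / 16"
  shows "\<bar>disp x y\<bar> \<le> D x y"
proof -
  consider "\<bar>height x\<bar> < ell / 4" "\<bar>height y\<bar> < ell / 4" | "\<bar>height x\<bar> \<ge> ell / 4" | "\<bar>height y\<bar> \<ge> ell / 4"
    by linarith
  then show ?thesis
  proof cases
    case 1
    then show ?thesis
      using star(1)[OF assms(1,2) 1] by (simp add: disp_star)
  next
    case 2
    then show ?thesis
      using disp_far[OF assms 2] by simp
  next
    case 3
    then show ?thesis
      using disp_far[of y x] assms commute[of x y] by simp
  qed
qed

text \<open>Beyond the ends of the edge of \<open>x\<close>, \<open>p\<close> is crossed into the other end of the same edge.\<close>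
lemma disp_ex:
  assumes "x \<in> X" "\<bar>t\<bar> \<le> ell / 16"
  shows "\<exists>y\<in>X. D y x \<le> \<bar>t\<bar> \<and> disp y x = t"
proof -
  obtain i r where x: "i < n" "0 \<le> r" "r \<le> len i" "x = A i r"
    using A_ex[OF assms(1)] by blast
  have l: "ell \<le> len i" "ell > 0"
    using ell_le ell_pos x by auto
  consider "0 \<le> r + t" "r + t \<le> len i" | "r + t < 0" | "r + t > len i"
    by linarith
  then show ?thesis
  proof cases
    case 1
    then show ?thesis
      using edge[of i "r + t" r] A_in[of i "r + t"] x assms l by (intro bexI[of _ "A i (r + t)"]) auto
  next
    case 2
    define s where "s = len i + (r + t)"
    have s: "0 \<le> s" "s \<le> len i"
      using 2 x assms l by (auto simp: s_def)
    have h: "height (A i s) = r + t" "height x = r"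
      using 2 x assms l s by (auto simp: height_A signed_def s_def)
    have "\<bar>height (A i s)\<bar> < ell / 4" "\<bar>height x\<bar> < ell / 4"
      using h 2 x assms l by auto
    moreover have "A i s \<in> X"
      using A_in s x by simp
    ultimately show ?thesis
      using star(2)[of "A i s" x] disp_star[of "A i s" x] h 2 x assms(1)
      by (intro bexI[of _ "A i s"]) auto
  next
    case 3
    define s where "s = r + t - len i"
    have s: "0 \<le> s" "s \<le> len i"
      using 3 x assms l by (auto simp: s_def)
    have h: "height (A i s) = s" "height x = r - len i"
      using 3 x assms l s by (auto simp: height_A signed_def s_def)
    have "\<bar>height (A i s)\<bar> < ell / 4" "\<bar>height x\<bar> < ell / 4"
      using h 3 x assms l by (auto simp: s_def)
    moreover have "A i s \<in> X"
      using A_in s x by simp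
    ultimately show ?thesis
      using star(2)[of x "A i s"] disp_star[of "A i s" x] h 3 x s assms(1) commute[of x "A i s"]
      by (intro bexI[of _ "A i s"]) (auto simp: s_def)
  qed
qed

section \<open>The local form of the map\<close>

definition segment :: "(real \<Rightarrow> 'a) \<Rightarrow> real \<Rightarrow> bool" where
  "segment \<kappa> \<eta> \<longleftrightarrow> (\<forall>s t. \<bar>s\<bar> \<le> \<eta> \<longrightarrow> \<bar>t\<bar> \<le> \<eta> \<longrightarrow> D (\<kappa> s) (\<kappa> t) = \<bar>s - t\<bar> \<and> disp (\<kappa> s) (\<kappa> t) = s - t)"

lemma segment_edge:
  assumes "j < n" "0 < q" "q < len j"
  shows "\<exists>\<eta>>0. segment (\<lambda>t. A j (q + t)) \<eta>"
proof (intro exI conjI)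
  let ?\<eta> = "min (ell / 16) (min q (len j - q))"
  show "?\<eta> > 0"
    using assms ell_pos by simp
  show "segment (\<lambda>t. A j (q + t)) ?\<eta>"
    unfolding segment_def
  proof (intro allI impI)
    fix s t assume "\<bar>s\<bar> \<le> ?\<eta>" "\<bar>t\<bar> \<le> ?\<eta>"
    then have "\<bar>s\<bar> \<le> ell / 16" "\<bar>s\<bar> \<le> q" "\<bar>s\<bar> \<le> len j - q" "\<bar>t\<bar> \<le> ell / 16" "\<bar>t\<bar> \<le> q" "\<bar>t\<bar> \<le> len j - q"
      by simp_all
    then have "0 \<le> q + s" "q + s \<le> len j" "0 \<le> q + t" "q + t \<le> len j" "\<bar>(q + s) - (q + t)\<bar> \<le> ell / 8"
      by linarith+
    then show "D (A j (q + s)) (A j (q + t)) = \<bar>s - t\<bar> \<and> disp (A j (q + s)) (A j (q + t)) = s - t"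
      using edge[of j "q + s" "q + t"] assms by simp
  qed
qed

text \<open>The curve comes in along edge \<open>k\<close>, goes out along edge \<open>j\<close>,
  and its point at time \<open>t\<close> has height \<open>t\<close>. Across \<open>p\<close> the
  heights have opposite signs, so \<open>star\<close> gives equality of distance and displacement;
  on either side \<open>edge\<close> does.\<close>

lemma segment_through_p:
  assumes "j < n" "k < n"
  shows "segment (\<lambda>t. if 0 \<le> t then A j t else A k (len k + t)) (ell / 16)"
proof -
  define \<kappa> where "\<kappa> t = (if 0 \<le> t then A j t else A k (len k + t))" for t
  have l: "ell \<le> len j" "ell \<le> len k" "ell > 0"
    using ell_le ell_pos assms by auto
  have \<kappa>: "\<kappa> t \<in> X" "height (\<kappa> t) = t" "\<bar>height (\<kappa> t)\<bar> < ell / 4" if "\<bar>t\<bar> \<le> ell / 16" for t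
    using that l assms by (auto simp: \<kappa>_def height_A signed_def intro: A_in)
  have disp: "disp (\<kappa> s) (\<kappa> t) = s - t" if "\<bar>s\<bar> \<le> ell / 16" "\<bar>t\<bar> \<le> ell / 16" for s t
    using \<kappa>[OF that(1)] \<kappa>[OF that(2)] by (simp add: disp_star)
  have D: "D (\<kappa> s) (\<kappa> t) = \<bar>s - t\<bar>" if st: "\<bar>s\<bar> \<le> ell / 16" "\<bar>t\<bar> \<le> ell / 16" for s t
  proof -
    consider "s \<le> 0" "0 \<le> t" | "t \<le> 0" "0 \<le> s" | "0 \<le> s" "0 \<le> t" | "s < 0" "t < 0"
      by linarith
    then show ?thesis
    proof cases
      case 1
      then show ?thesis
        using star(2)[of "\<kappa> s" "\<kappa> t"] \<kappa>[OF st(1)] \<kappa>[OF st(2)] by simp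
    next
      case 2
      then show ?thesis
        using star(2)[of "\<kappa> t" "\<kappa> s"] \<kappa>[OF st(1)] \<kappa>[OF st(2)] commute[of "\<kappa> s"] by simp
    next
      case 3
      then have "\<bar>s - t\<bar> \<le> ell / 8" "s \<le> len j" "t \<le> len j"
        using st l by linarith+
      then show ?thesis
        using edge(1)[of j s t] assms 3 by (simp add: \<kappa>_def)
    next
      case 4
      then have "\<bar>(len k + s) - (len k + t)\<bar> \<le> ell / 8" "0 \<le> len k + s" "0 \<le> len k + t"
        using st l by linarith+
      then show ?thesis
        using edge(1)[of k "len k + s" "len k + t"] assms 4 by (simp add: \<kappa>_def)
    qed
  qed
  have "segment \<kappa> (ell / 16)"
    unfolding segment_def using D disp by blast
  then show ?thesis
    unfolding \<kappa>_def .
qed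

text \<open>Flatness in usable form: near \<open>x\<close> the image \<open>f y\<close> depends only
  on the displacement of \<open>y\<close> from \<open>x\<close>, however many edges meet at
  \<open>x\<close>.\<close>

definition maps_along_segment :: "'a \<Rightarrow> bool" where
  "maps_along_segment x \<longleftrightarrow> (\<exists>\<rho> \<kappa> \<eta>. \<rho> > 0 \<and> segment \<kappa> \<eta> \<and>
    (\<forall>y\<in>X. D y x < \<rho> \<longrightarrow> f y = \<kappa> (lam * disp y x) \<and> lam * \<bar>disp y x\<bar> \<le> \<eta>))"

lemma local_form_interior:
  assumes "i < n" "0 < r" "r < len i"
  shows "maps_along_segment (A i r)"
proof -
  obtain e1 j q where R: "e1 > 0" "r + e1 \<le> len i" "j < n" "0 \<le> q" "q + lam * e1 \<le> len j"
    "\<And>t. 0 \<le> t \<Longrightarrow> t \<le> e1 \<Longrightarrow> f (A i (r + t)) = A j (q + lam * t)"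
    using right[OF assms] by blast
  obtain e2 k q' where L: "e2 > 0" "e2 \<le> r" "k < n" "q' \<le> len k" "lam * e2 \<le> q'"
    "\<And>t. 0 \<le> t \<Longrightarrow> t \<le> e2 \<Longrightarrow> f (A i (r - t)) = A k (q' - lam * t)"
    using left[OF assms] by blast
  have "lam * e1 > 0" "lam * e2 > 0"
    using R(1) L(1) lam by simp_all
  then have q: "q < len j" "0 < q'"
    using R(5) L(5) by linarith+
  \<comment> \<open>The one-sided descriptions agree at \<open>t = 0\<close>. So either the image
    point is interior to an edge and \<open>j = k\<close>, or it is \<open>p\<close>, entered at the
    end of edge \<open>k\<close> and left at the start of edge \<open>j\<close>.\<close>
  have "A j q = A k q'"
    using R(6)[of 0] L(6)[of 0] R(1) L(1) by simp
  then have jk: "j = k \<and> q = q' \<or> (q = 0 \<or> q = len j) \<and> (q' = 0 \<or> q' = len k)"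
    using R L q by (intro A_eq) auto
  define \<kappa> where "\<kappa> t = (if 0 \<le> t then A j (q + t) else A k (q' + t))" for t
  have "\<exists>\<eta>>0. segment \<kappa> \<eta>"
  proof (cases "q = 0")
    case True
    then have "q' = len k"
      using jk q by auto
    then have "\<kappa> = (\<lambda>t. if 0 \<le> t then A j t else A k (len k + t))"
      using True by (simp add: \<kappa>_def fun_eq_iff)
    then show ?thesis
      using segment_through_p[OF R(3) L(3)] ell_pos by (intro exI[of _ "ell / 16"]) simp
  next
    case False
    then have "k = j" "q' = q"
      using jk q by auto
    then have "\<kappa> = (\<lambda>t. A j (q + t))"
      by (simp add: \<kappa>_def fun_eq_iff)
    then show ?thesis
      using segment_edge[OF R(3), of q] False R(4) q by simp
  qed
  then obtain \<eta> where \<eta>: "\<eta> > 0" "segment \<kappa> \<eta>"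
    by blast
  \<comment> \<open>In turn the bounds keep \<open>y\<close> in the range of both one-sided
    descriptions, on edge \<open>i\<close>, with its image in the segment, and within reach of
    \<open>edge\<close>.\<close>
  define \<rho> where "\<rho> = min (min e1 e2) (min (min r (len i - r)) (min (\<eta> / lam) (ell / 8)))"
  have "\<rho> > 0"
    using R(1) L(1) assms \<eta>(1) lam ell_pos by (simp add: \<rho>_def)
  moreover have "\<rho> \<le> e1" "\<rho> \<le> e2" "\<rho> \<le> min r (len i - r)" "\<rho> \<le> \<eta> / lam" "\<rho> \<le> ell / 8"
    unfolding \<rho>_def by linarith+
  ultimately have \<rho>: "\<rho> > 0" "\<rho> \<le> e1" "\<rho> \<le> e2" "\<rho> \<le> min r (len i - r)" "\<rho> \<le> \<eta> / lam" "\<rho> \<le> ell / 8"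
    by blast+
  have "f y = \<kappa> (lam * disp y (A i r)) \<and> lam * \<bar>disp y (A i r)\<bar> \<le> \<eta>"
    if y: "y \<in> X" "D y (A i r) < \<rho>" for y
  proof -
    obtain s where s: "0 \<le> s" "s \<le> len i" "y = A i s" "D y (A i r) = \<bar>s - r\<bar>"
      using near_interior[OF assms y(1)] y(2) \<rho>(4) by (metis order_less_le_trans)
    have sr: "\<bar>s - r\<bar> < \<rho>"
      using s y by simp
    have d: "disp y (A i r) = s - r"
      using edge(2)[of i s r] s sr \<rho>(6) assms by simp
    have "\<bar>s - r\<bar> \<le> \<eta> / lam"
      using sr \<rho>(5) by linarith
    then have "lam * \<bar>s - r\<bar> \<le> \<eta>"
      using lam by (simp add: field_simps)
    moreover have "f y = \<kappa> (lam * (s - r))"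
    proof (cases "r \<le> s")
      case True
      then have "f (A i (r + (s - r))) = A j (q + lam * (s - r))"
        using sr \<rho>(2) by (intro R(6)) auto
      then show ?thesis
        using True lam s by (simp add: \<kappa>_def)
    next
      case False
      then have "f (A i (r - (r - s))) = A k (q' - lam * (r - s))"
        using sr \<rho>(3) by (intro L(6)) auto
      moreover have "lam * (s - r) < 0"
        using False lam by (simp add: mult_pos_neg)
      ultimately show ?thesis
        using s by (simp add: \<kappa>_def algebra_simps)
    qed
    ultimately show ?thesis
      using d by simp
  qed
  then show ?thesis
    unfolding maps_along_segment_def using \<rho>(1) \<eta>(2) by blast
qed

lemma local_form_p: "maps_along_segment p"
proof -
  define \<kappa> where "\<kappa> t = (if 0 \<le> t then A a t else A b (len b + t))" for t
  have seg: "segment \<kappa> (ell / 16)"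
    unfolding \<kappa>_def by (rule segment_through_p[OF ab])
  have "\<forall>i\<in>{..<n}. \<exists>\<epsilon>. \<epsilon> > 0 \<and> (\<forall>t. 0 \<le> t \<and> t \<le> \<epsilon> \<longrightarrow> f (A i t) = A a (lam * t) \<and>
      f (A i (len i - t)) = A b (len b - lam * t))"
  proof
    fix i assume "i \<in> {..<n}"
    then obtain e1 e2 where e: "e1 > 0" "e2 > 0" "\<And>t. 0 \<le> t \<Longrightarrow> t \<le> e1 \<Longrightarrow> f (A i t) = A a (lam * t)"
      "\<And>t. 0 \<le> t \<Longrightarrow> t \<le> e2 \<Longrightarrow> f (A i (len i - t)) = A b (len b - lam * t)"
      using right_p[of i] left_p[of i] by auto
    then show "\<exists>\<epsilon>. \<epsilon> > 0 \<and> (\<forall>t. 0 \<le> t \<and> t \<le> \<epsilon> \<longrightarrow> f (A i t) = A a (lam * t) \<and>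
      f (A i (len i - t)) = A b (len b - lam * t))"
      by (intro exI[of _ "min e1 e2"]) auto
  qed
  then obtain \<epsilon> where \<epsilon>: "\<And>i. i < n \<Longrightarrow> \<epsilon> i > 0"
    "\<And>i t. \<lbrakk>i < n; 0 \<le> t; t \<le> \<epsilon> i\<rbrakk> \<Longrightarrow> f (A i t) = A a (lam * t) \<and> f (A i (len i - t)) = A b (len b - lam * t)"
    by (metis lessThan_iff)
  \<comment> \<open>The minimum over the finitely many edges makes all descriptions at
    \<open>p\<close> valid at once; the second bound keeps the image in a segment of half length
    \<open>ell / 16\<close>.\<close>
  define \<rho> where "\<rho> = min (Min (\<epsilon> ` {..<n})) (ell / (16 * lam))"
  have lr: "ell / (16 * lam) \<le> ell / 16"
    using lam ell_pos by (simp add: field_simps)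
  have \<rho>: "\<rho> > 0" "\<rho> \<le> ell / (16 * lam)" "\<rho> \<le> ell / 16"
    using edges_nonempty \<epsilon>(1) ell_pos lam lr by (simp_all add: \<rho>_def Min_gr_iff min_le_iff_disj)
  have \<rho>\<epsilon>: "\<rho> \<le> \<epsilon> i" if "i < n" for i
    using that by (auto simp: \<rho>_def min_le_iff_disj)
  have "f y = \<kappa> (lam * disp y p) \<and> lam * \<bar>disp y p\<bar> \<le> ell / 16"
    if y: "y \<in> X" "D y p < \<rho>" for y
  proof -
    obtain i s where s: "i < n" "0 \<le> s" "s \<le> len i" "y = A i s"
      using A_ex[OF y(1)] by blast
    have l: "ell \<le> len i" "ell > 0" "0 < len i"
      using ell_le ell_pos len_pos s by auto
    have Dp: "D y p = min s (len i - s)"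
      using D_same[of i s 0] s l by (simp add: A_0)
    have h: "height y = signed i s"
      using s height_A by simp
    have hb: "\<bar>signed i s\<bar> < \<rho>"
      using Dp y(2) s by (auto simp: signed_def min_def abs_if split: if_splits)
    have "disp y p = signed i s"
      using h hb \<rho>(3) l by (simp add: disp_star height_p)
    moreover have "lam * \<bar>signed i s\<bar> \<le> ell / 16"
    proof -
      have "\<bar>signed i s\<bar> \<le> ell / (16 * lam)"
        using hb \<rho>(2) by linarith
      then show ?thesis
        using lam by (simp add: field_simps)
    qed
    moreover have "f y = \<kappa> (lam * signed i s)"
    proof (cases "s \<le> len i / 2")
      case True
      then have "f (A i s) = A a (lam * s)"
        using \<epsilon>(2)[of i s] s hb \<rho>\<epsilon>[of i] by (simp add: signed_def)
      then show ?thesis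
        using True s lam by (simp add: signed_def \<kappa>_def)
    next
      case False
      then have "f (A i (len i - (len i - s))) = A b (len b - lam * (len i - s))"
        using \<epsilon>(2)[of i "len i - s"] s hb \<rho>\<epsilon>[of i] by (simp add: signed_def)
      then have fy: "f y = A b (len b + lam * (s - len i))"
        using s by (simp add: algebra_simps)
      \<comment> \<open>At \<open>s = len i\<close> the point is \<open>p\<close> with signed
        coordinate 0, where \<kappa> uses its outgoing branch; the incoming formula gives the end of
        edge \<open>b\<close>, which is \<open>p\<close> as well.\<close>
      show ?thesis
      proof (cases "s = len i")
        case True
        then show ?thesis
          using fy False ab by (simp add: signed_def \<kappa>_def A_0 A_len)
      next
        case ne: False
        then have "lam * (s - len i) < 0"
          using s lam by (simp add: mult_pos_neg)
        then show ?thesis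
          using fy False by (simp add: signed_def \<kappa>_def)
      qed
    qed
    ultimately show ?thesis
      by simp
  qed
  then show ?thesis
    unfolding maps_along_segment_def using \<rho>(1) seg by blast
qed

definition stretches :: "'a \<Rightarrow> 'a \<Rightarrow> bool" where
  "stretches y z \<longleftrightarrow> D (f y) (f z) = lam * \<bar>disp y z\<bar> \<and> disp (f y) (f z) = lam * disp y z"

text \<open>Both images lie on one segment, at times \<open>lam\<close> times the displacements from
  \<open>x\<close>, and the difference of these displacements is \<open>disp y z\<close>. The radius
  \<open>ell / 32\<close> keeps \<open>y\<close> and \<open>z\<close> within \<open>ell / 16\<close>
  of each other, as additivity demands.\<close>

lemma local_form:
  assumes "x \<in> X"
  shows "\<exists>\<rho>>0. \<forall>y\<in>X. \<forall>z\<in>X. D y x < \<rho> \<longrightarrow> D z x < \<rho> \<longrightarrow>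
    stretches y z"
proof -
  have "maps_along_segment x"
  proof (cases "x = p")
    case False
    obtain i r where x: "i < n" "0 \<le> r" "r \<le> len i" "x = A i r"
      using A_ex[OF assms] by blast
    moreover have "r \<noteq> 0" "r \<noteq> len i"
      using False x A_0 A_len by auto
    ultimately show ?thesis
      using local_form_interior[of i r] by simp
  qed (use local_form_p in simp)
  then obtain \<rho> \<kappa> \<eta> where \<rho>: "\<rho> > 0" and seg: "segment \<kappa> \<eta>"
    and f: "\<And>y. y \<in> X \<Longrightarrow> D y x < \<rho> \<Longrightarrow> f y = \<kappa> (lam * disp y x) \<and> lam * \<bar>disp y x\<bar> \<le> \<eta>"
    unfolding maps_along_segment_def by blast
  have "stretches y z"
    if yz: "y \<in> X" "z \<in> X" "D y x < min \<rho> (ell / 32)" "D z x < min \<rho> (ell / 32)" for y z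
  proof -
    have D: "D y x < \<rho>" "D z x < \<rho>" "D y x \<le> ell / 16" "D x z \<le> ell / 16" "D y z \<le> ell / 16" "D x y \<le> ell / 16"
      using yz triangle'[of y x z] assms ell_pos commute[of x z] commute[of x y] commute[of y z]
        triangle[of y x z] by auto
    have dd: "disp y x + disp x z = disp y z" "disp z x + disp x z = disp z z" "disp z z = 0"
      using disp_add[of y x z] disp_add[of z x z] disp_add[of z z z] D yz assms ell_pos commute[of x z] by auto
    have b: "\<bar>lam * disp y x\<bar> \<le> \<eta>" "\<bar>lam * disp z x\<bar> \<le> \<eta>"
      using f[OF yz(1) D(1)] f[OF yz(2) D(2)] lam by (auto simp: abs_mult)
    have "D (f y) (f z) = \<bar>lam * disp y x - lam * disp z x\<bar>" "disp (f y) (f z) = lam * disp y x - lam * disp z x"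
      using seg[unfolded segment_def, rule_format, OF b] f[OF yz(1) D(1)] f[OF yz(2) D(2)] by auto
    moreover have "lam * disp y x - lam * disp z x = lam * disp y z"
      using dd by (simp flip: right_diff_distrib)
    ultimately show ?thesis
      using lam by (simp add: stretches_def abs_mult)
  qed
  then show ?thesis
    using \<rho> ell_pos by (intro exI[of _ "min \<rho> (ell / 32)"]) auto
qed

lemma compact: "compact_space mtopology"
proof -
  have "compactin mtopology (A i ` {0..len i})" if i: "i < n" for i
  proof (rule image_compactin)
    show "compactin (top_of_set {0..len i}) {0..len i}"
      by (simp add: compactin_subtopology)
    show "continuous_map (top_of_set {0..len i}) mtopology (A i)"
      unfolding continuous_map_to_metric
    proof (intro ballI allI impI)
      fix r \<epsilon> :: real assume r: "r \<in> topspace (top_of_set {0..len i})" and \<epsilon>: "0 < \<epsilon>"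
      have "openin (top_of_set {0..len i}) ({0..len i} \<inter> ball r \<epsilon>)"
        by (simp add: openin_open_Int)
      moreover have "A i s \<in> mball (A i r) \<epsilon>" if "s \<in> {0..len i} \<inter> ball r \<epsilon>" for s
      proof -
        have "D (A i r) (A i s) \<le> \<bar>r - s\<bar>"
          using D_same[OF i, of r s] r that by simp
        then show ?thesis
          using that r i by (auto simp: dist_real_def A_in)
      qed
      ultimately show "\<exists>U. openin (top_of_set {0..len i}) U \<and> r \<in> U \<and> (\<forall>y\<in>U. A i y \<in> mball (A i r) \<epsilon>)"
        using r \<epsilon> by (intro exI[of _ "{0..len i} \<inter> ball r \<epsilon>"]) auto
    qed
  qed
  then have "compactin mtopology (\<Union>((\<lambda>i. A i ` {0..len i}) ` {..<n}))"
    by (intro compactin_Union) auto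
  moreover have "\<Union>((\<lambda>i. A i ` {0..len i}) ` {..<n}) = X"
  proof
    show "\<Union>((\<lambda>i. A i ` {0..len i}) ` {..<n}) \<subseteq> X"
      by (auto intro: A_in)
    show "X \<subseteq> \<Union>((\<lambda>i. A i ` {0..len i}) ` {..<n})"
    proof
      fix x assume "x \<in> X"
      then obtain i r where "i < n" "0 \<le> r" "r \<le> len i" "x = A i r"
        using A_ex by blast
      then show "x \<in> \<Union>((\<lambda>i. A i ` {0..len i}) ` {..<n})"
        by (intro UN_I[of i]) auto
    qed
  qed
  ultimately show ?thesis
    by (simp add: compact_space_def)
qed

text \<open>A Lebesgue number argument: \<open>y\<close> lies in some ball of half the local radius,
  and a \<open>z\<close> within a quarter of that radius from \<open>y\<close> still lies in the
  full ball.\<close>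

lemma uniform_form:
  obtains \<delta> where "\<delta> > 0" "\<And>y z. \<lbrakk>y \<in> X; z \<in> X; D y z \<le> \<delta>\<rbrakk> \<Longrightarrow>
    stretches y z"
proof -
  have "\<forall>x\<in>X. \<exists>\<rho>. \<rho> > 0 \<and> (\<forall>y\<in>X. \<forall>z\<in>X. D y x < \<rho> \<longrightarrow> D z x < \<rho> \<longrightarrow>
    stretches y z)"
    using local_form by blast
  from bchoice[OF this] obtain \<rho> where \<rho>: "\<And>x. x \<in> X \<Longrightarrow> \<rho> x > 0"
    "\<And>x y z. \<lbrakk>x \<in> X; y \<in> X; z \<in> X; D y x < \<rho> x; D z x < \<rho> x\<rbrakk> \<Longrightarrow>
      stretches y z"
    by blast
  let ?B = "\<lambda>x. mball x (\<rho> x / 2)"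
  have cX: "compactin mtopology X"
    using compact by (simp add: compact_space_def)
  have cover: "X \<subseteq> \<Union>(?B ` X)"
    using \<rho>(1) by auto
  have "\<exists>\<F>. finite \<F> \<and> \<F> \<subseteq> ?B ` X \<and> X \<subseteq> \<Union>\<F>"
    by (rule compactinD[OF cX _ cover]) auto
  then obtain \<F> where \<F>: "finite \<F>" "\<F> \<subseteq> ?B ` X" "X \<subseteq> \<Union>\<F>"
    by blast
  obtain S where S: "S \<subseteq> X" "finite S" "\<F> = ?B ` S"
    using finite_subset_image[OF \<F>(1,2)] by blast
  define \<delta> where "\<delta> = Min (insert 1 ((\<lambda>x. \<rho> x / 4) ` S))"
  have \<delta>: "\<delta> > 0"
    unfolding \<delta>_def using S \<rho>(1) by (subst Min_gr_iff) auto
  have \<delta>\<rho>: "\<delta> \<le> \<rho> x / 4" if "x \<in> S" for x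
    unfolding \<delta>_def using S that by (intro Min_le) auto
  show ?thesis
  proof (rule that[OF \<delta>])
    fix y z assume yz: "y \<in> X" "z \<in> X" "D y z \<le> \<delta>"
    then obtain x where x: "x \<in> S" "y \<in> ?B x"
      using \<F>(3) S(3) by blast
    then have xX: "x \<in> X" and Dy: "D y x < \<rho> x / 2"
      using S by (auto simp: commute)
    have "D z x \<le> D y z + D y x"
      using triangle[of z y x] yz xX commute[of y z] by simp
    then have "D z x < \<rho> x" "D y x < \<rho> x"
      using Dy yz(3) \<delta>\<rho>[OF x(1)] \<rho>(1)[OF xX] by linarith+
    then show "stretches y z"
      using \<rho>(2)[OF xX yz(1,2)] by blast
  qed
qed

theorem displacement: "\<exists>r. displacement_system X D f lam disp r"
proof -
  obtain \<delta> where \<delta>: "\<delta> > 0" "\<And>y z. \<lbrakk>y \<in> X; z \<in> X; D y z \<le> \<delta>\<rbrakk> \<Longrightarrow>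
    stretches y z"
    using uniform_form by blast
  define r where "r = min \<delta> (ell / 16)"
  have r: "r > 0" "r \<le> \<delta>" "r \<le> ell / 16"
    using \<delta>(1) ell_pos by (auto simp: r_def)
  have "displacement_system X D f lam disp r"
  proof
    show "\<bar>disp x y\<bar> \<le> D x y" if "x \<in> X" "y \<in> X" "D x y \<le> r" for x y
      using disp_le that r by simp
    show "disp x y + disp y z = disp x z"
      if "x \<in> X" "y \<in> X" "z \<in> X" "D x y \<le> r" "D y z \<le> r" "D x z \<le> r" for x y z
      using disp_add that r by simp
    show "\<exists>y\<in>X. D y x \<le> \<bar>t\<bar> \<and> disp y x = t" if "x \<in> X" "\<bar>t\<bar> \<le> r" for x t
      using disp_ex[of x t] that r by simp
    show "D (f x) (f y) = lam * \<bar>disp x y\<bar>" "disp (f x) (f y) = lam * disp x y"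
      if "x \<in> X" "y \<in> X" "D x y \<le> r" for x y
      using \<delta>(2)[of x y] that r by (simp_all add: stretches_def)
  qed (use compact lam r f_in in auto)
  then show ?thesis ..
qed

end

section \<open>Wedges of circles\<close>

text \<open>By the intermediate value theorem both arcs take the smaller of the two end values at a
  positive time. Injectivity of \<open>\<phi>\<close> makes them meet there, against
  disjointness.\<close>

lemma no_two_arcs_on_one_side:
  fixes \<phi> :: "'a::topological_space \<Rightarrow> real" and g1 g2 :: "real \<Rightarrow> 'a"
  assumes "\<eta> > 0" and "continuous_on S \<phi>" "inj_on \<phi> S"
    and "continuous_on {0..\<eta>} g1" "g1 ` {0..\<eta>} \<subseteq> S" "g1 0 = p"
    and "continuous_on {0..\<eta>} g2" "g2 ` {0..\<eta>} \<subseteq> S" "g2 0 = p"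
    and "g1 ` {0<..\<eta>} \<inter> g2 ` {0<..\<eta>} = {}"
    and "\<phi> p < \<phi> (g1 \<eta>)" "\<phi> p < \<phi> (g2 \<eta>)"
  shows False
proof -
  define y where "y = min (\<phi> (g1 \<eta>)) (\<phi> (g2 \<eta>))"
  have reach: "\<exists>u\<in>{0<..\<eta>}. \<phi> (g u) = y"
    if g: "continuous_on {0..\<eta>} g" "g ` {0..\<eta>} \<subseteq> S" "g 0 = p" "y \<le> \<phi> (g \<eta>)" for g
  proof -
    have "continuous_on {0..\<eta>} (\<lambda>u. \<phi> (g u))"
      using g by (intro continuous_on_compose2[OF assms(2)]) auto
    moreover have "\<phi> (g 0) \<le> y"
      using g assms(11,12) by (simp add: y_def)
    ultimately obtain u where "0 \<le> u" "u \<le> \<eta>" "\<phi> (g u) = y"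
      using IVT'[of "\<lambda>u. \<phi> (g u)" 0 y \<eta>] g \<open>\<eta> > 0\<close> by auto
    moreover have "u \<noteq> 0"
      using calculation g assms(11,12) by (auto simp: y_def min_def split: if_splits)
    ultimately show ?thesis
      by (intro bexI[of _ u]) auto
  qed
  obtain u where u: "u \<in> {0<..\<eta>}" "\<phi> (g1 u) = y"
    using reach[of g1] assms by (auto simp: y_def)
  obtain v where v: "v \<in> {0<..\<eta>}" "\<phi> (g2 v) = y"
    using reach[of g2] assms by (auto simp: y_def)
  have "g1 u \<in> S" "g2 v \<in> S"
    using u(1) v(1) assms(5,8) by (auto simp: image_subset_iff)
  then have "g1 u = g2 v"
    using u(2) v(2) assms(3) by (metis inj_onD)
  then show False
    using u(1) v(1) assms(10) by blast
qed

text \<open>Each arm leaves \<open>p\<close> to one of the two sides of a line, so two of three arms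
  leave to the same side. The lower side is reduced to the upper one by negating
  \<open>\<phi>\<close>.\<close>

lemma no_tripod_in_interval:
  fixes \<phi> :: "'a::topological_space \<Rightarrow> real" and g :: "'i \<Rightarrow> real \<Rightarrow> 'a"
  assumes "\<eta> > 0" and "continuous_on S \<phi>" "inj_on \<phi> S"
    and g: "\<And>k. k \<in> K \<Longrightarrow> continuous_on {0..\<eta>} (g k)" "\<And>k. k \<in> K \<Longrightarrow> g k ` {0..\<eta>} \<subseteq> S"
      "\<And>k. k \<in> K \<Longrightarrow> g k 0 = p" "\<And>k. k \<in> K \<Longrightarrow> g k \<eta> \<noteq> p"
    and disjoint: "\<And>k l. \<lbrakk>k \<in> K; l \<in> K; k \<noteq> l\<rbrakk> \<Longrightarrow> g k ` {0<..\<eta>} \<inter> g l ` {0<..\<eta>} = {}"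
    and K: "a \<in> K" "b \<in> K" "c \<in> K"
  shows "a = b \<or> a = c \<or> b = c"
proof -
  have above: "k = l" if "k \<in> K" "l \<in> K" "\<phi> p < \<phi> (g k \<eta>)" "\<phi> p < \<phi> (g l \<eta>)" for k l
    using no_two_arcs_on_one_side[OF assms(1-3) g(1-3)[OF that(1)] g(1-3)[OF that(2)] disjoint[OF that(1,2)]]
      that by blast
  have below: "k = l" if "k \<in> K" "l \<in> K" "\<phi> p > \<phi> (g k \<eta>)" "\<phi> p > \<phi> (g l \<eta>)" for k l
  proof (rule ccontr)
    assume "k \<noteq> l"
    have "continuous_on S (\<lambda>x. - \<phi> x)" "inj_on (\<lambda>x. - \<phi> x) S"
      using assms(2,3) by (auto intro: continuous_intros simp: inj_on_def)
    from no_two_arcs_on_one_side[OF assms(1) this g(1-3)[OF that(1)] g(1-3)[OF that(2)]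
        disjoint[OF that(1,2) \<open>k \<noteq> l\<close>]] that
    show False by simp
  qed
  have "\<phi> (g k \<eta>) \<noteq> \<phi> p" if "k \<in> K" for k
  proof
    assume "\<phi> (g k \<eta>) = \<phi> p"
    moreover have "g k \<eta> \<in> S" "g k 0 \<in> S"
      using assms(1) g(2)[OF that] by (auto simp: image_subset_iff)
    ultimately show False
      using inj_onD[OF assms(3), of "g k \<eta>" p] g(3,4)[OF that] by simp
  qed
  then consider "\<phi> p < \<phi> (g a \<eta>)" | "\<phi> p > \<phi> (g a \<eta>)"
    using K by (meson linorder_neqE)
  then show ?thesis
    using above[of a b] above[of a c] above[of b c] below[of a b] below[of a c] below[of b c] K
      \<open>\<And>k. k \<in> K \<Longrightarrow> \<phi> (g k \<eta>) \<noteq> \<phi> p\<close>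
    by (metis linorder_neqE)
qed

locale wedge_of_circles =
  fixes X :: "'a::t2_space set" and p :: 'a and n :: nat and E :: "nat \<Rightarrow> real \<Rightarrow> 'a"
  assumes E_path: "i < n \<Longrightarrow> continuous_on {0..1} (E i)"
    and E_0: "i < n \<Longrightarrow> E i 0 = p" and E_1: "i < n \<Longrightarrow> E i 1 = p"
    and E_inj: "i < n \<Longrightarrow> inj_on (E i) {0<..<1}"
    and E_p: "i < n \<Longrightarrow> p \<notin> E i ` {0<..<1}"
    and E_disjoint: "\<lbrakk>i < n; j < n; i \<noteq> j\<rbrakk> \<Longrightarrow> E i ` {0<..<1} \<inter> E j ` {0<..<1} = {}"
    and X_eq: "X = insert p (\<Union>i<n. E i ` {0..1})"
begin

lemma p_in: "p \<in> X"
  by (simp add: X_eq)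

lemma E_in: "\<lbrakk>i < n; 0 \<le> u; u \<le> 1\<rbrakk> \<Longrightarrow> E i u \<in> X"
  unfolding X_eq by (intro insertI2 UN_I[of i]) auto

lemma E_ne_p: "\<lbrakk>i < n; 0 < u; u < 1\<rbrakk> \<Longrightarrow> E i u \<noteq> p"
  using E_p[of i] by (metis greaterThanLessThan_iff imageI)

lemma E_eq_p: "\<lbrakk>i < n; 0 \<le> u; u \<le> 1\<rbrakk> \<Longrightarrow> E i u = p \<longleftrightarrow> u = 0 \<or> u = 1"
  using E_0[of i] E_1[of i] E_ne_p[of i u] by (auto simp: less_le)

lemma E_eq_interior:
  assumes "i < n" "j < n" "0 < u" "u < 1" "0 \<le> v" "v \<le> 1" "E i u = E j v"
  shows "i = j \<and> u = v"
proof -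
  have "E i u \<noteq> p"
    using assms(1,3,4) E_eq_p[of i u] by simp
  then have v: "0 < v" "v < 1"
    using assms E_0[of j] E_1[of j] by (auto simp: less_le)
  have ij: "i = j"
  proof (rule ccontr)
    assume "i \<noteq> j"
    then show False
      using E_disjoint[of i j] assms v by (force simp: image_iff)
  qed
  then show ?thesis
    using assms v E_inj[of i] by (auto dest: inj_onD)
qed

lemma E_inj_left:
  assumes "i < n" "b < 1" shows "inj_on (E i) {0..b}"
proof (rule inj_onI)
  fix u v assume uv: "u \<in> {0..b}" "v \<in> {0..b}" "E i u = E i v"
  then consider "u = 0" "v = 0" | "0 < u" "u < 1" | "0 < v" "v < 1"
    using assms by force
  then show "u = v"
    using E_eq_interior[of i i u v] E_eq_interior[of i i v u] assms uv by cases auto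
qed

lemma E_inj_right:
  assumes "i < n" "0 < a" shows "inj_on (E i) {a..1}"
proof (rule inj_onI)
  fix u v assume uv: "u \<in> {a..1}" "v \<in> {a..1}" "E i u = E i v"
  then consider "u = 1" "v = 1" | "0 < u" "u < 1" | "0 < v" "v < 1"
    using assms by force
  then show "u = v"
    using E_eq_interior[of i i u v] E_eq_interior[of i i v u] assms uv by cases auto
qed

text \<open>Only the two ends of the parameter interval are identified, and an interval shorter than
  1 contains at most one of them.\<close>

lemma E_inj_on:
  assumes "i < n" "0 \<le> a" "b \<le> 1" "b - a < 1" shows "inj_on (E i) {a..b}"
proof (cases "b < 1")
  case True
  then show ?thesis
    using assms by (intro inj_on_subset[OF E_inj_left[of i b]]) auto
next
  case False
  then show ?thesis
    using assms by (intro inj_on_subset[OF E_inj_right[of i a]]) auto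
qed

lemma E_cont: "\<lbrakk>i < n; 0 \<le> a; b \<le> 1\<rbrakk> \<Longrightarrow> continuous_on {a..b} (E i)"
  using E_path by (rule continuous_on_subset) auto

lemma compact_arc: "\<lbrakk>i < n; 0 \<le> a; b \<le> 1\<rbrakk> \<Longrightarrow> compact (E i ` {a..b})"
  using E_cont by (intro compact_continuous_image) auto

lemma compact_X: "compact X"
  unfolding X_eq using compact_arc by (intro compact_insert compact_UN) auto

lemma arc_subset: "\<lbrakk>i < n; 0 \<le> a; b \<le> 1\<rbrakk> \<Longrightarrow> E i ` {a..b} \<subseteq> X"
  by (auto simp: X_eq)

lemma point_cases:
  assumes "x \<in> X"
  obtains "x = p" | i u where "i < n" "0 < u" "u < 1" "x = E i u"
proof -
  consider "x = p" | i u where "i < n" "0 \<le> u" "u \<le> 1" "x = E i u"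
    using assms by (auto simp: X_eq)
  then show ?thesis
  proof cases
    case (2 i u)
    then show ?thesis
      using that(1) that(2)[of i u] E_0[of i] E_1[of i] by (cases "u = 0 \<or> u = 1") (auto simp: less_le)
  qed (use that in blast)
qed

text \<open>Up to \<open>p\<close> the complement is a finite union of compact arcs: the other edges
  and the two remaining pieces of edge \<open>i\<close>. This is how open arcs are shown to be open
  in \<open>X\<close>.\<close>

lemma closed_outside_arc:
  assumes "i < n" "0 \<le> a" "a < b" "b \<le> 1"
  shows "closed (X - E i ` {a<..<b})"
proof -
  let ?J = "\<lambda>j. if j = i then {0..a} \<union> {b..1} else {0..1}"
  have "x \<in> X - E i ` {a<..<b} \<longleftrightarrow> x \<in> insert p (\<Union>j<n. E j ` ?J j)" for x
  proof (cases "x \<in> X \<and> x \<noteq> p")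
    case True
    then obtain k u where x: "k < n" "0 < u" "u < 1" "x = E k u"
      using point_cases by metis
    have eq: "x \<in> E j ` S \<longleftrightarrow> j = k \<and> u \<in> S" if j: "j < n" "S \<subseteq> {0..1}" for j S
    proof
      assume "x \<in> E j ` S"
      then obtain v where v: "v \<in> S" "E k u = E j v"
        using x(4) by auto
      then have "0 \<le> v" "v \<le> 1"
        using j(2) by auto
      then show "j = k \<and> u \<in> S"
        using E_eq_interior[OF x(1) j(1) x(2,3) _ _ v(2)] v(1) by simp
    qed (use x in simp)
    have "x \<in> E i ` {a<..<b} \<longleftrightarrow> i = k \<and> u \<in> {a<..<b}"
      using assms by (intro eq) auto
    moreover have "x \<in> E j ` ?J j \<longleftrightarrow> j = k \<and> u \<in> ?J j" if "j < n" for j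
      using assms that by (intro eq) auto
    then have "x \<in> (\<Union>j<n. E j ` ?J j) \<longleftrightarrow> u \<in> ?J k"
      using x(1) by blast
    ultimately show ?thesis
      using True x by auto
  next
    case False
    have "{a<..<b} \<subseteq> {0<..<1}"
      using assms by auto
    then have "p \<notin> E i ` {a<..<b}"
      using E_p[OF assms(1)] by blast
    moreover have "(\<Union>j<n. E j ` ?J j) \<subseteq> X"
      using assms by (auto intro!: E_in split: if_splits)
    ultimately show ?thesis
      using False p_in by blast
  qed
  then have "X - E i ` {a<..<b} = insert p (\<Union>j<n. E j ` ?J j)"
    by blast
  moreover have "closed (E j ` ?J j)" if "j < n" for j
    using that assms compact_arc by (auto simp: image_Un intro!: compact_imp_closed compact_Un)
  then have "closed (insert p (\<Union>j<n. E j ` ?J j))"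
    by (intro closed_insert closed_UN) blast+
  ultimately show ?thesis
    by (simp only:)
qed

lemma openin_arc:
  assumes "i < n" "0 \<le> a" "a < b" "b \<le> 1"
  shows "openin (top_of_set X) (E i ` {a<..<b})"
proof -
  have "E i ` {a<..<b} = X \<inter> - (X - E i ` {a<..<b})"
    using assms by (auto intro!: E_in)
  then show ?thesis
    using closed_outside_arc[OF assms] by (metis open_Compl openin_open)
qed

text \<open>The closed arc and the complement of the open arc are both closed, cover
  \<open>X\<close>, and meet only in the two end points, which \<open>I\<close> avoids. A connected
  \<open>I\<close> therefore lies in one of them.\<close>

lemma connected_in_arc:
  assumes "connected I" "I \<subseteq> X" "i < n" "0 \<le> a" "a < b" "b \<le> 1"
    and "E i a \<notin> I" "E i b \<notin> I" "I \<inter> E i ` {a<..<b} \<noteq> {}"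
  shows "I \<subseteq> E i ` {a<..<b}"
proof -
  let ?A = "E i ` {a..b}" and ?B = "X - E i ` {a<..<b}"
  have "{a..b} = insert a (insert b {a<..<b})"
    using assms by auto
  then have A_eq: "?A = insert (E i a) (insert (E i b) (E i ` {a<..<b}))"
    by simp
  have A: "closed ?A" "closed ?B"
    using compact_imp_closed[OF compact_arc[OF assms(3,4,6)]] closed_outside_arc[OF assms(3-6)] by simp_all
  have "?A \<inter> ?B \<inter> I = {}"
    unfolding A_eq using assms(7,8) by blast
  moreover have "I \<subseteq> ?A \<union> ?B"
    unfolding A_eq using assms(2) by blast
  moreover have "?A \<inter> I \<noteq> {}"
    unfolding A_eq using assms(9) by blast
  ultimately have "?B \<inter> I = {}"
    using assms(1) A unfolding connected_closed by blast
  then show ?thesis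
    using assms by blast
qed

lemma connected_in_edge:
  assumes "connected I" "I \<subseteq> X" "p \<notin> I" "i < n" "I \<inter> E i ` {0<..<1} \<noteq> {}"
  shows "I \<subseteq> E i ` {0<..<1}"
  using connected_in_arc[of I i 0 1] assms E_0 E_1 by simp

section \<open>Paths that rise through the edges\<close>

definition runs :: "(real \<Rightarrow> 'a) \<Rightarrow> nat \<Rightarrow> (real \<Rightarrow> real) \<Rightarrow> real \<Rightarrow> real \<Rightarrow> bool" where
  "runs g j h a b \<longleftrightarrow> a < b \<and> j < n \<and> continuous_on {a..b} h \<and> strict_mono_on {a..b} h \<and>
     h ` {a..b} \<subseteq> {0..1} \<and> (\<forall>u\<in>{a..b}. g u = E j (h u))"

lemma runs_subinterval: "\<lbrakk>runs g j h a b; a \<le> a'; a' < b'; b' \<le> b\<rbrakk> \<Longrightarrow> runs g j h a' b'"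
  unfolding runs_def
  by (auto intro: continuous_on_subset monotone_on_subset simp: image_subset_iff)

lemma runs_less: "\<lbrakk>runs g j h a b; a \<le> u; u < v; v \<le> b\<rbrakk> \<Longrightarrow> 0 \<le> h u \<and> h u < h v \<and> h v \<le> 1"
  unfolding runs_def using strict_mono_onD[of "{a..b}" h u v] by (auto simp: image_subset_iff)

lemma runs_eq: "\<lbrakk>runs g j h a b; a \<le> u; u \<le> b\<rbrakk> \<Longrightarrow> g u = E j (h u)"
  by (simp add: runs_def)

lemma runs_bounds: "\<lbrakk>runs g j h a b; a \<le> u; u \<le> b\<rbrakk> \<Longrightarrow> 0 \<le> h u \<and> h u \<le> 1"
  unfolding runs_def by (auto simp: image_subset_iff)

lemma runs_image:
  assumes "runs g j h a b" "a \<le> u" "u \<le> v" "v \<le> b"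
  shows "h ` {u..v} = {h u..h v}" "g ` {u..v} = E j ` {h u..h v}"
proof -
  have c: "continuous_on {u..v} h"
    using assms by (auto simp: runs_def intro: continuous_on_subset)
  have "strict_mono_on {a..b} h"
    using assms by (simp add: runs_def)
  then have m: "h x \<le> h y" if "u \<le> x" "x \<le> y" "y \<le> v" for x y
    using that assms by (auto intro: strict_mono_on_leD)
  show 1: "h ` {u..v} = {h u..h v}"
  proof
    show "h ` {u..v} \<subseteq> {h u..h v}"
      using m assms by auto
    show "{h u..h v} \<subseteq> h ` {u..v}"
    proof
      fix y assume "y \<in> {h u..h v}"
      then obtain x where "u \<le> x" "x \<le> v" "h x = y"
        using IVT'[of h u y v] c assms by auto
      then show "y \<in> h ` {u..v}" by force
    qed
  qed
  have "g ` {u..v} = E j ` h ` {u..v}"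
    using assms by (auto simp: runs_def image_image)
  then show "g ` {u..v} = E j ` {h u..h v}"
    using 1 by simp
qed

text \<open>The point \<open>p\<close> has the edge parameters 0 and 1 only, and a strictly
  increasing parameter cannot begin at 1.\<close>

lemma runs_start: "\<lbrakk>runs g j h a b; g a = p\<rbrakk> \<Longrightarrow> h a = 0"
  using E_eq_p[of j "h a"] runs_less[of g j h a b a b] runs_eq[of g j h a b a] by (auto simp: runs_def)

lemma runs_end: "\<lbrakk>runs g j h a b; g b = p\<rbrakk> \<Longrightarrow> h b = 1"
  using E_eq_p[of j "h b"] runs_less[of g j h a b a b] runs_eq[of g j h a b b] by (auto simp: runs_def)

lemma runs_shrink_right:
  assumes "runs g j h a b" "c > h a"
  obtains b' where "a < b'" "b' \<le> b" "\<And>u. a \<le> u \<Longrightarrow> u \<le> b' \<Longrightarrow> h u < c"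
proof -
  have ab: "a < b" "continuous_on {a..b} h"
    using assms by (auto simp: runs_def)
  then have "(h \<longlongrightarrow> h a) (at a within {a..b})"
    by (simp add: continuous_on_def)
  then have "\<forall>\<^sub>F u in at a within {a..b}. h u < c"
    using assms by (intro order_tendstoD) auto
  then obtain d where d: "d > 0" "\<And>u. u \<in> {a..b} \<Longrightarrow> u \<noteq> a \<Longrightarrow> dist u a < d \<Longrightarrow> h u < c"
    unfolding eventually_at by blast
  show ?thesis
  proof (rule that[of "min b (a + d / 2)"])
    show "h u < c" if "a \<le> u" "u \<le> min b (a + d / 2)" for u
      using d that assms by (cases "u = a") (auto simp: dist_real_def)
  qed (use ab d in auto)
qed

text \<open>Between two visits to \<open>p\<close> the path stays in one open edge. If it missed a
  point \<open>E i w\<close>, it would be confined to the part below \<open>w\<close>, since it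
  enters at the lower end; its edge parameter would then attain a maximum at an inner time, although
  the path rises from every time.\<close>

lemma rising_path_covers_edge:
  assumes cont: "continuous_on {\<alpha>..\<beta>} \<gamma>" and im: "\<gamma> ` {\<alpha>..\<beta>} \<subseteq> X"
    and rise: "\<And>s. \<lbrakk>\<alpha> \<le> s; s < \<beta>\<rbrakk> \<Longrightarrow> \<exists>b j h. b \<le> \<beta> \<and> runs \<gamma> j h s b"
    and ends: "\<gamma> \<alpha> = p" "\<gamma> \<beta> = p" and u: "\<alpha> < u" "u < \<beta>" and i: "i < n" "\<gamma> u \<in> E i ` {0<..<1}"
  shows "E i ` {0..1} \<subseteq> \<gamma> ` {\<alpha>..\<beta>}"
proof -
  have up: "\<gamma> u \<noteq> p"
    using i E_p by metis
  define P where "P = {s \<in> {\<alpha>..\<beta>}. \<gamma> s = p}"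
  have cP: "closed P"
    unfolding P_def using continuous_closed_preimage_constant[OF cont] by simp
  \<comment> \<open>The last visit \<open>u0\<close> to \<open>p\<close> before \<open>u\<close> and
    the first visit \<open>u1\<close> after it bound the excursion around \<open>u\<close>.\<close>
  have "compact ({\<alpha>..u} \<inter> P)" "compact ({u..\<beta>} \<inter> P)"
    by (rule compact_Int_closed[OF compact_Icc cP])+
  moreover have "\<alpha> \<in> {\<alpha>..u} \<inter> P" "\<beta> \<in> {u..\<beta>} \<inter> P"
    using u ends by (simp_all add: P_def)
  ultimately obtain u0 u1 where
    u0: "u0 \<in> {\<alpha>..u} \<inter> P" "\<And>s. s \<in> {\<alpha>..u} \<inter> P \<Longrightarrow> s \<le> u0" and
    u1: "u1 \<in> {u..\<beta>} \<inter> P" "\<And>s. s \<in> {u..\<beta>} \<inter> P \<Longrightarrow> u1 \<le> s"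
    using compact_attains_sup[of "{\<alpha>..u} \<inter> P"] compact_attains_inf[of "{u..\<beta>} \<inter> P"] by blast
  have b: "\<alpha> \<le> u0" "u0 < u" "u < u1" "u1 \<le> \<beta>" "\<gamma> u0 = p" "\<gamma> u1 = p"
    using u0(1) u1(1) up unfolding P_def by (auto simp: less_le)
  have np: "\<gamma> s \<noteq> p" if "u0 < s" "s < u1" for s
  proof
    assume "\<gamma> s = p"
    then show False
      using u0(2)[of s] u1(2)[of s] that b unfolding P_def by (cases "s \<le> u") auto
  qed
  define S where "S = \<gamma> ` {u0<..<u1}"
  have "{u0<..<u1} \<subseteq> {\<alpha>..\<beta>}"
    using b by auto
  then have cS: "connected S" "S \<subseteq> X"
    unfolding S_def using im continuous_on_subset[OF cont]
    by (blast intro: connected_continuous_image connected_Ioo)+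
  have "p \<notin> S" "\<gamma> u \<in> S"
    unfolding S_def using b np by (auto dest: sym)
  note cS = cS this
  have Si: "S \<subseteq> E i ` {0<..<1}"
    using cS i by (intro connected_in_edge) auto
  have "E i w \<in> \<gamma> ` {\<alpha>..\<beta>}" if w: "0 < w" "w < 1" for w
  proof (rule ccontr)
    assume nw: "E i w \<notin> \<gamma> ` {\<alpha>..\<beta>}"
    moreover have "S \<subseteq> \<gamma> ` {\<alpha>..\<beta>}"
      unfolding S_def using b by (intro image_mono) auto
    ultimately have wS: "E i w \<notin> S" by blast
    have split: "S \<subseteq> E i ` {0<..<w} \<or> S \<subseteq> E i ` {w<..<1}"
    proof -
      have "{0<..<1} = {0<..<w} \<union> {w} \<union> {w<..<1}"
        using w by auto
      then have "\<gamma> u \<in> E i ` {0<..<w} \<or> \<gamma> u \<in> E i ` {w<..<1}"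
        using i(2) wS cS(4) by auto
      then show ?thesis
        using connected_in_arc[of S i 0 w] connected_in_arc[of S i w 1] cS wS w i E_0 E_1 by auto
    qed
    \<comment> \<open>The run that leaves \<open>p\<close> at time \<open>u0\<close> has parameter 0
      there, so shortly afterwards it is below \<open>w\<close>; this excludes the upper half of the
      edge.\<close>
    obtain b1 j h where bj: "b1 \<le> \<beta>" "runs \<gamma> j h u0 b1"
      using rise[of u0] b by auto
    have h0: "h u0 = 0"
      using bj b runs_start by blast
    then obtain b2 where b2: "u0 < b2" "b2 \<le> b1" "\<And>u. u0 \<le> u \<Longrightarrow> u \<le> b2 \<Longrightarrow> h u < w"
      using runs_shrink_right[OF bj(2), of w] w by metis
    define v where "v = min b2 ((u0 + u1) / 2)"
    have v: "u0 < v" "v \<le> b2" "v < u1"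
      using b b2 by (auto simp: v_def min_def)
    have hv: "\<gamma> v = E j (h v)" "0 < h v" "h v < w" "j < n"
      using bj b2 v runs_eq[OF bj(2), of v] runs_less[OF bj(2), of u0 v] h0 by (auto simp: runs_def)
    have "\<gamma> v \<in> S"
      using v by (auto simp: S_def)
    moreover have "\<gamma> v \<notin> E i ` {w<..<1}"
    proof
      assume "\<gamma> v \<in> E i ` {w<..<1}"
      then obtain y where "w < y" "y < 1" "E j (h v) = E i y"
        using hv(1) by auto
      then show False
        using E_eq_interior[of j i "h v" y] hv w i by simp
    qed
    ultimately have "\<not> S \<subseteq> E i ` {w<..<1}"
      by blast
    then have S1: "S \<subseteq> E i ` {0<..<w}"
      using split by blast
    define \<kappa> where "\<kappa> = the_inv_into {0..w} (E i)"
    have injw: "inj_on (E i) {0..w}"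
      using E_inj_left i w by blast
    have c\<kappa>: "continuous_on (E i ` {0..w}) \<kappa>"
      unfolding \<kappa>_def using injw E_cont[of i 0 w] w i by (intro continuous_on_inv_into) auto
    have \<kappa>E: "\<kappa> (E i x) = x" if "0 \<le> x" "x \<le> w" for x
      unfolding \<kappa>_def using injw that by (simp add: the_inv_into_f_f)
    have "{u0..u1} = insert u0 (insert u1 {u0<..<u1})"
      using b by auto
    then have "\<gamma> ` {u0..u1} = insert p S"
      using b by (auto simp: S_def)
    moreover have "p \<in> E i ` {0..w}"
      using E_0[of i] i w by force
    ultimately have im2: "\<gamma> ` {u0..u1} \<subseteq> E i ` {0..w}"
      using subset_trans[OF S1 image_mono[OF greaterThanLessThan_subseteq_atLeastAtMost_iff[THEN iffD2]], of 0 w]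
      by simp
    have "continuous_on {u0..u1} (\<lambda>s. \<kappa> (\<gamma> s))"
      using im2 b continuous_on_subset[OF cont, of "{u0..u1}"]
      by (intro continuous_on_compose2[OF c\<kappa>]) auto
    \<comment> \<open>The highest point of the excursion. It is above \<open>p\<close>, so it is
      attained strictly between \<open>u0\<close> and \<open>u1\<close>, and the run starting at
      \<open>us\<close> goes higher still.\<close>
    then obtain us where us: "us \<in> {u0..u1}" "\<And>s. s \<in> {u0..u1} \<Longrightarrow> \<kappa> (\<gamma> s) \<le> \<kappa> (\<gamma> us)"
      using continuous_attains_sup[of "{u0..u1}" "\<lambda>s. \<kappa> (\<gamma> s)"] b by auto
    have kp: "\<kappa> p = 0"
      using \<kappa>E[of 0] E_0 i w by simp
    have pos: "\<exists>x. 0 < x \<and> x < w \<and> \<gamma> s = E i x \<and> \<kappa> (\<gamma> s) = x" if "u0 < s" "s < u1" for s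
    proof -
      have "\<gamma> s \<in> S"
        using that by (auto simp: S_def)
      then have "\<gamma> s \<in> E i ` {0<..<w}"
        using S1 by blast
      then obtain x where "0 < x" "x < w" "\<gamma> s = E i x"
        by auto
      then show ?thesis
        using \<kappa>E[of x] by auto
    qed
    have "0 < \<kappa> (\<gamma> us)"
      using pos[of u] us(2)[of u] b by fastforce
    then have us2: "u0 < us" "us < u1"
      using us(1) kp b by (auto simp: less_le)
    obtain x where x: "0 < x" "x < w" "\<gamma> us = E i x" "\<kappa> (\<gamma> us) = x"
      using pos us2 by blast
    obtain b3 j' h' where b3: "b3 \<le> \<beta>" "runs \<gamma> j' h' us b3"
      using rise[of us] us2 b by auto
    define v' where "v' = min b3 ((us + u1) / 2)"
    have v': "us < v'" "v' \<le> b3" "v' < u1"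
      using us2 b3 by (auto simp: v'_def min_def runs_def)
    obtain y where y: "0 < y" "y < w" "\<gamma> v' = E i y" "\<kappa> (\<gamma> v') = y"
      using pos[of v'] v' us2 by auto
    have h': "0 \<le> h' us" "h' us < h' v'" "h' v' \<le> 1" "j' < n"
      using runs_less[OF b3(2), of us v'] v' b3 by (auto simp: runs_def)
    have "E i x = E j' (h' us)" "E i y = E j' (h' v')"
      using runs_eq[OF b3(2), of us] runs_eq[OF b3(2), of v'] x(3) y(3) v' by simp_all
    then have "h' us = x" "h' v' = y"
      using E_eq_interior[of i j' x "h' us"] E_eq_interior[of i j' y "h' v'"] x(1,2) y(1,2) h' i(1) w
      by simp_all
    then have "\<kappa> (\<gamma> us) < \<kappa> (\<gamma> v')"
      using h' x y by simp
    then show False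
      using us(2)[of v'] v' us2 by auto
  qed
  moreover have "E i 0 \<in> \<gamma> ` {\<alpha>..\<beta>}" "E i 1 \<in> \<gamma> ` {\<alpha>..\<beta>}"
    using E_0[OF i(1)] E_1[OF i(1)] ends u by (auto intro: image_eqI[of _ _ \<alpha>])
  ultimately have "E i w \<in> \<gamma> ` {\<alpha>..\<beta>}" if "0 \<le> w" "w \<le> 1" for w
    using that by (cases "w = 0 \<or> w = 1") (auto simp: less_le)
  then show ?thesis
    by auto
qed

end

section \<open>The stretched measure\<close>

text \<open>The assumption \<open>pieces\<close> is what orientability says about the edges
  themselves, taken as directed paths: the image of each edge is a finite chain of forward
  runs.\<close>

locale wedge_system = wedge_of_circles X p n E
  for X :: "'a::t2_space set" and p n E +
  fixes f :: "'a \<Rightarrow> 'a" and lam :: real and \<mu> :: "'a measure"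
  assumes cont_f: "continuous_on X f" and f_image: "f ` X \<subseteq> X" and f_p: "f p = p"
    and pieces: "i < n \<Longrightarrow> \<exists>m t. t 0 = 0 \<and> t m = 1 \<and>
      (\<forall>k<m. \<exists>j h. runs (\<lambda>u. f (E i u)) j h (t k) (t (Suc k)))"
    and lam: "lam > 1" and stretched: "stretched_measure X f lam \<mu>"
    and flat: "one_step_flat X f" and nonwandering: "all_nonwandering X f"
    and expansion: "expansion X n E f"
begin

abbreviation fE :: "nat \<Rightarrow> real \<Rightarrow> 'a" where
  "fE i \<equiv> \<lambda>u. f (E i u)"

lemma f_in: "x \<in> X \<Longrightarrow> f x \<in> X"
  using f_image by blast

lemma funpow_in: "x \<in> X \<Longrightarrow> (f ^^ m) x \<in> X"
  by (induction m) (auto intro: f_in)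

lemma funpow_p: "(f ^^ m) p = p"
  by (induction m) (auto simp: f_p)

lemma cont_funpow: "continuous_on X (f ^^ m)"
proof (induction m)
  case (Suc m)
  have "continuous_on X (\<lambda>x. f ((f ^^ m) x))"
    using Suc funpow_in by (intro continuous_on_compose2[OF cont_f]) auto
  then show ?case by (simp add: o_def)
qed simp

lemma right_run:
  assumes "i < n" "0 \<le> s" "s < 1"
  obtains b j h where "b \<le> 1" "runs (fE i) j h s b"
proof -
  obtain m t where t: "t 0 = 0" "t m = 1"
    "\<And>k. k < m \<Longrightarrow> \<exists>j h. runs (fE i) j h (t k) (t (Suc k))"
    using pieces[OF assms(1)] by blast
  define k where "k = (LEAST k. s < t k)"
  have k: "s < t k" "k \<le> m"
    using t assms LeastI[of "\<lambda>k. s < t k" m] Least_le[of "\<lambda>k. s < t k" m] by (auto simp: k_def)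
  have "k \<noteq> 0"
    using k t assms by (metis not_le)
  then obtain l where l: "k = Suc l"
    using not0_implies_Suc by blast
  have "t l \<le> s"
    using not_less_Least[of l "\<lambda>k. s < t k"] l by (simp add: k_def not_less)
  have le1: "t i \<le> 1" if "i \<le> m" for i
    using that
  proof (induction rule: inc_induct)
    case (step j)
    then show ?case
      using t(3)[of j] by (force simp: runs_def)
  qed (simp add: t)
  have "l < m"
    using l k by simp
  from t(3)[OF this] obtain j h where "runs (fE i) j h (t l) (t (Suc l))"
    by blast
  from runs_subinterval[OF this \<open>t l \<le> s\<close>, of "t (Suc l)"]
  have "runs (fE i) j h s (t (Suc l))"
    using k l by simp
  then show ?thesis
    using that le1 k l by blast
qed

lemma left_run:
  assumes "i < n" "0 < s" "s \<le> 1"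
  obtains a j h where "0 \<le> a" "runs (fE i) j h a s"
proof -
  obtain m t where t: "t 0 = 0" "t m = 1"
    "\<And>k. k < m \<Longrightarrow> \<exists>j h. runs (fE i) j h (t k) (t (Suc k))"
    using pieces[OF assms(1)] by blast
  \<comment> \<open>With \<open>\<le>\<close> in place of the strict inequality used for right runs,
    the chosen piece begins strictly before \<open>s\<close> even when \<open>s\<close> is a
    division point.\<close>
  define k where "k = (LEAST k. s \<le> t k)"
  have k: "s \<le> t k" "k \<le> m"
    using t assms LeastI[of "\<lambda>k. s \<le> t k" m] Least_le[of "\<lambda>k. s \<le> t k" m] by (auto simp: k_def)
  have "k \<noteq> 0"
    using k t assms by (metis not_le)
  then obtain l where l: "k = Suc l"
    using not0_implies_Suc by blast
  have "t l < s"
    using not_less_Least[of l "\<lambda>k. s \<le> t k"] l by (simp add: k_def not_le)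
  have ge0: "i \<le> m \<Longrightarrow> 0 \<le> t i" for i
  proof (induction i)
    case (Suc i)
    then show ?case
      using t(3)[of i] by (force simp: runs_def)
  qed (simp add: t)
  have "l < m"
    using l k by simp
  from t(3)[OF this] obtain j h where "runs (fE i) j h (t l) (t (Suc l))"
    by blast
  from runs_subinterval[OF this order_refl \<open>t l < s\<close>]
  have "runs (fE i) j h (t l) s"
    using k l by simp
  then show ?thesis
    using that ge0[of l] k l by auto
qed

lemma sets_mu: "sets \<mu> = sets (restrict_space borel X)" and emeasure_X: "emeasure \<mu> X = 1"
  using stretched by (auto simp: stretched_measure_def)

lemma space_mu: "space \<mu> = X"
  using sets_eq_imp_space_eq[OF sets_mu] by (simp add: space_restrict_space)

sublocale finite_measure \<mu>
  by standard (simp add: space_mu emeasure_X)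

lemma closed_sets: "\<lbrakk>closed C; C \<subseteq> X\<rbrakk> \<Longrightarrow> C \<in> sets \<mu>"
  unfolding sets_mu sets_restrict_space by (rule image_eqI[of _ _ C]) auto

lemma arc_sets: "\<lbrakk>i < n; 0 \<le> a; b \<le> 1\<rbrakk> \<Longrightarrow> E i ` {a..b} \<in> sets \<mu>"
  using compact_arc arc_subset by (intro closed_sets compact_imp_closed)

definition scales :: "'a set \<Rightarrow> bool" where
  "scales U \<longleftrightarrow> (\<forall>a b I. interval_between U a b I \<and> inj_on f I \<longrightarrow> measure \<mu> (f ` I) = lam * measure \<mu> I)"

lemma stretch_nhd:
  assumes "x \<in> X"
  obtains U where "openin (top_of_set X) U" "x \<in> U"
    "scales U"
  using stretched assms unfolding stretched_measure_def scales_def by blast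

text \<open>The mass of a point would grow exponentially along its orbit.\<close>
lemma measure_point: "x \<in> X \<Longrightarrow> measure \<mu> {x} = 0"
proof -
  assume x: "x \<in> X"
  have step: "measure \<mu> {f x} = lam * measure \<mu> {x}" if X: "x \<in> X" for x
  proof -
    obtain U where U: "openin (top_of_set X) U" "x \<in> U"
      "scales U"
      using stretch_nhd[OF X] by metis
    then have "interval_between U x x {x}"
      by (simp add: interval_between_def)
    then show ?thesis
      using U(3)[unfolded scales_def, rule_format, of x x "{x}"] by simp
  qed
  have iter: "measure \<mu> {(f ^^ m) x} = lam ^ m * measure \<mu> {x}" for m
    by (induction m) (auto simp: step funpow_in x)
  show ?thesis
  proof (rule ccontr)
    assume "measure \<mu> {x} \<noteq> 0"
    then have "measure \<mu> {x} > 0"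
      using measure_nonneg[of \<mu> "{x}"] by (simp add: less_le)
    then obtain m where "2 / measure \<mu> {x} < lam ^ m"
      using real_arch_pow[OF lam] by blast
    then have "2 < measure \<mu> {(f ^^ m) x}"
      using \<open>measure \<mu> {x} > 0\<close> iter by (simp add: field_simps)
    moreover have "measure \<mu> {(f ^^ m) x} \<le> measure \<mu> (space \<mu>)"
      by (rule bounded_measure)
    ultimately show False
      using emeasure_X by (simp add: space_mu measure_def)
  qed
qed

lemma measure_finite_set: "\<lbrakk>finite F; F \<subseteq> X\<rbrakk> \<Longrightarrow> measure \<mu> F = 0"
  using finite_measure_eq_sum_singleton[of F] closed_sets[of "{x}" for x]
  by (simp add: measure_point subset_iff)

lemma measure_Un_overlap:
  assumes "A \<in> sets \<mu>" "B \<in> sets \<mu>" "A \<inter> B \<subseteq> F" "finite F"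
  shows "measure \<mu> (A \<union> B) = measure \<mu> A + measure \<mu> B"
proof -
  have "A \<inter> B \<subseteq> X"
    using assms(1) sets.sets_into_space space_mu by blast
  then have "measure \<mu> (A \<inter> B) = 0"
    using assms by (intro measure_finite_set) (auto intro: finite_subset)
  moreover have "measure \<mu> (A \<union> B) = measure \<mu> A + measure \<mu> (B - A)"
    using assms by (intro finite_measure_Union')
  moreover have "measure \<mu> (B - A) = measure \<mu> B - measure \<mu> (B \<inter> A)"
    using assms by (intro finite_measure_Diff')
  ultimately show ?thesis
    by (simp add: Int_commute)
qed

text \<open>The distribution function of the measure along an edge, later the arc length.\<close>

definition mass :: "nat \<Rightarrow> real \<Rightarrow> real" where
  "mass i s = measure \<mu> (E i ` {0..s})"

text \<open>The arcs over \<open>{0..s}\<close> and \<open>{s..t}\<close> share at most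
  \<open>E i s\<close> and, on a closed loop, \<open>p\<close>; finite sets are null.\<close>

lemma measure_arc:
  assumes "i < n" "0 \<le> s" "s \<le> t" "t \<le> 1"
  shows "measure \<mu> (E i ` {s..t}) = mass i t - mass i s"
proof -
  have "E i ` {0..s} \<inter> E i ` {s..t} \<subseteq> {E i s, p}"
  proof
    fix x assume "x \<in> E i ` {0..s} \<inter> E i ` {s..t}"
    then obtain u v where uv: "0 \<le> u" "u \<le> s" "s \<le> v" "v \<le> t" "x = E i u" "x = E i v"
      by auto
    then show "x \<in> {E i s, p}"
    proof (cases "u = 0")
      case False
      show ?thesis
      proof (cases "u = 1")
        case False
        then have "u = v"
          using E_eq_interior[of i i u v] uv assms \<open>u \<noteq> 0\<close> by auto
        then show ?thesis
          using uv by auto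
      qed (use uv E_1 assms in auto)
    qed (use E_0 assms in auto)
  qed
  then have "measure \<mu> (E i ` {0..s} \<union> E i ` {s..t}) = mass i s + measure \<mu> (E i ` {s..t})"
    unfolding mass_def using assms by (intro measure_Un_overlap arc_sets) auto
  moreover have "{0..t} = {0..s} \<union> {s..t}"
    using assms by auto
  ultimately show ?thesis
    by (simp add: mass_def flip: image_Un)
qed

lemma mass_mono: "\<lbrakk>i < n; 0 \<le> s; s \<le> t; t \<le> 1\<rbrakk> \<Longrightarrow> mass i s \<le> mass i t"
  using measure_arc[of i s t] measure_nonneg[of \<mu> "E i ` {s..t}"] by linarith

lemma mass_0: "i < n \<Longrightarrow> mass i 0 = 0"
  using measure_point[OF p_in] by (simp add: mass_def E_0)

text \<open>Arcs around \<open>s\<close> of shrinking parameter width intersect in at most the point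
  \<open>E i s\<close>, which is null. By continuity of the measure from above, their masses tend to
  0 and bound the variation of \<open>mass i\<close> near \<open>s\<close>.\<close>

lemma continuous_mass:
  assumes "i < n" shows "continuous_on {0..1} (mass i)"
proof -
  have "\<exists>d>0. \<forall>u\<in>{0..1}. dist u s < d \<longrightarrow> dist (mass i u) (mass i s) < \<epsilon>"
    if s: "s \<in> {0..1}" and \<epsilon>: "\<epsilon> > 0" for s \<epsilon>
  proof -
    define J where "J k = {max 0 (s - 1 / Suc k)..min 1 (s + 1 / Suc k)}" for k :: nat
    have J: "E i ` J k \<in> sets \<mu>" for k
      unfolding J_def using assms by (intro arc_sets) auto
    have "decseq (\<lambda>k. E i ` J k)"
    proof (rule decseq_SucI, rule image_mono)
      fix k
      have "1 / real (Suc (Suc k)) \<le> 1 / real (Suc k)"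
        by (simp add: frac_le)
      then show "J (Suc k) \<subseteq> J k"
        unfolding J_def by auto
    qed
    then have "(\<lambda>k. measure \<mu> (E i ` J k)) \<longlonglongrightarrow> measure \<mu> (\<Inter>k. E i ` J k)"
      using J by (intro finite_Lim_measure_decseq) auto
    moreover have "(\<Inter>k. E i ` J k) \<subseteq> {E i s}"
    proof
      fix x assume "x \<in> (\<Inter>k. E i ` J k)"
      then have "\<forall>k. \<exists>u. u \<in> J k \<and> x = E i u"
        by blast
      then obtain u where u: "\<And>k. u k \<in> J k" "\<And>k. x = E i (u k)"
        by metis
      have ub: "\<bar>u k - s\<bar> \<le> 1 / Suc k" "u k \<in> {0..1}" for k
        using u(1)[of k] by (auto simp: J_def abs_le_iff)
      have "(\<lambda>k. u k - s) \<longlonglongrightarrow> 0"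
        using ub by (intro Lim_null_comparison[OF _ LIMSEQ_Suc[OF lim_1_over_n]]) auto
      then have "u \<longlonglongrightarrow> s"
        by (simp add: LIM_zero_iff)
      then have "(\<lambda>k. E i (u k)) \<longlonglongrightarrow> E i s"
        by (rule continuous_on_tendsto_compose[OF E_path[OF assms]])
          (use s ub in \<open>auto intro: always_eventually\<close>)
      then have "(\<lambda>k. x) \<longlonglongrightarrow> E i s"
        using u(2) by simp
      then show "x \<in> {E i s}"
        by (simp add: LIMSEQ_const_iff)
    qed
    moreover have "measure \<mu> (\<Inter>k. E i ` J k) = 0"

    proof (rule measure_finite_set)
      show "finite (\<Inter>k. E i ` J k)"
        by (rule finite_subset[OF calculation(2)]) simp
      have "E i s \<in> X"
        using s assms by (auto intro: E_in)
      then show "(\<Inter>k. E i ` J k) \<subseteq> X"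
        using calculation(2) by blast
    qed
    ultimately have "(\<lambda>k. measure \<mu> (E i ` J k)) \<longlonglongrightarrow> 0"
      by simp
    then have "\<forall>\<^sub>F k in sequentially. measure \<mu> (E i ` J k) < \<epsilon>"
      using \<epsilon> by (rule order_tendstoD)
    then obtain k where k: "measure \<mu> (E i ` J k) < \<epsilon>"
      using eventually_happens' sequentially_bot by blast
    have key: "mass i v - mass i u < \<epsilon>" if "0 \<le> u" "u \<le> v" "v \<le> 1" "{u..v} \<subseteq> J k" for u v
    proof -
      have "mass i v - mass i u = measure \<mu> (E i ` {u..v})"
        using that assms by (simp add: measure_arc)
      also have "\<dots> \<le> measure \<mu> (E i ` J k)"
        using that J by (intro finite_measure_mono image_mono)
      finally show ?thesis
        using k by simp
    qed
    show ?thesis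
    proof (intro exI[of _ "1 / Suc k"] conjI ballI impI)
      fix u assume u: "u \<in> {0..1}" "dist u s < 1 / Suc k"
      have "{min u s..max u s} \<subseteq> J k"
        using u s by (auto simp: J_def dist_real_def)
      then show "dist (mass i u) (mass i s) < \<epsilon>"
        using key[of u s] key[of s u] u s mass_mono[OF assms, of u s] mass_mono[OF assms, of s u]
        by (cases "u \<le> s") (auto simp: dist_real_def)
    qed simp
  qed
  then show ?thesis
    unfolding continuous_on_iff by blast
qed

text \<open>An affine reparametrisation by \<open>{0..1}\<close>. The bound \<open>t - s < 1\<close>
  excludes the whole loop, whose ends coincide.\<close>

lemma arc_interval_between:
  assumes "i < n" "0 \<le> s" "s < t" "t \<le> 1" "t - s < 1" "E i ` {s..t} \<subseteq> U"
  shows "interval_between U (E i s) (E i t) (E i ` {s..t})"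
proof -
  define g where "g u = E i (s + u * (t - s))" for u
  have im: "(\<lambda>u. s + u * (t - s)) ` {0..1} = {s..t}"
  proof
    show "(\<lambda>u. s + u * (t - s)) ` {0..1} \<subseteq> {s..t}"
    proof
      fix v assume "v \<in> (\<lambda>u. s + u * (t - s)) ` {0..1}"
      then obtain u where "0 \<le> u" "u \<le> 1" "v = s + u * (t - s)" by auto
      moreover have "u * (t - s) \<le> 1 * (t - s)" "0 \<le> u * (t - s)"
        using calculation assms by (auto intro!: mult_right_mono)
      ultimately show "v \<in> {s..t}"
        by simp
    qed
    show "{s..t} \<subseteq> (\<lambda>u. s + u * (t - s)) ` {0..1}"
    proof
      fix v assume "v \<in> {s..t}"
      then show "v \<in> (\<lambda>u. s + u * (t - s)) ` {0..1}"
        using assms by (intro image_eqI[of _ _ "(v - s) / (t - s)"]) (auto simp: field_simps)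
    qed
  qed
  have "arc g"
    unfolding arc_def path_def
  proof
    show "continuous_on {0..1} g"
      unfolding g_def using im assms
      by (intro continuous_on_compose2[OF E_cont[of i s t]] continuous_intros) auto
    show "inj_on g {0..1}"
    proof (rule inj_onI)
      fix u v :: real assume uv: "u \<in> {0..1}" "v \<in> {0..1}" "g u = g v"
      then have "s + u * (t - s) = s + v * (t - s)"
        using im assms by (intro inj_onD[OF E_inj_on[of i s t]]) (auto simp: g_def)
      then show "u = v"
        using assms by simp
    qed
  qed
  moreover have "path_image g = E i ` {s..t}"
    unfolding path_image_def g_def im[symmetric] by (simp add: image_image)
  moreover have "pathstart g = E i s" "pathfinish g = E i t"
    by (simp_all add: pathstart_def pathfinish_def g_def)
  ultimately show ?thesis
    using assms unfolding interval_between_def by blast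
qed

text \<open>Both the arc and its image are proper pieces of loops: the first is then an interval in
  the sense of \<open>interval_between\<close>, and the second is traversed without self-overlap, so
  \<open>f\<close> is injective on the arc as the scaling law requires.\<close>

lemma small_scaling:
  assumes "i < n" "0 \<le> a" "b \<le> 1" "runs (fE i) j h a b"
    and U: "scales U"
    and "a \<le> u" "u < v" "v \<le> b" "v - u < 1" "h v - h u < 1" "E i ` {u..v} \<subseteq> U"
  shows "mass j (h v) - mass j (h u) = lam * (mass i v - mass i u)"
proof -
  let ?I = "E i ` {u..v}"
  have j: "j < n"
    using assms(4) by (simp add: runs_def)
  have hb: "0 \<le> h u" "h u < h v" "h v \<le> 1"
    using runs_less[OF assms(4), of u v] assms by auto
  have inj: "inj_on f ?I"
  proof (rule inj_onI, clarify)
    fix x y assume xy: "x \<in> {u..v}" "y \<in> {u..v}" "f (E i x) = f (E i y)"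
    then have "E j (h x) = E j (h y)"
      using assms by (auto simp: runs_def)
    moreover have "h x \<in> {h u..h v}" "h y \<in> {h u..h v}"
      using runs_image(1)[OF assms(4), of u v] assms xy by auto
    ultimately have "h x = h y"
      using inj_onD[OF E_inj_on[of j "h u" "h v"]] hb j assms by auto
    then show "E i x = E i y"
      using runs_less[OF assms(4), of x y] runs_less[OF assms(4), of y x] xy assms
      by (cases x y rule: linorder_cases) auto
  qed
  have "f ` ?I = E j ` {h u..h v}"
    using runs_image(2)[OF assms(4), of u v] assms by (simp add: image_image)
  moreover have "measure \<mu> (f ` ?I) = lam * measure \<mu> ?I"
    using U arc_interval_between[of i u v U] inj assms unfolding scales_def by simp
  ultimately show ?thesis
    using assms j hb by (simp add: measure_arc)
qed

text \<open>The scaling law is local, but the defect \<open>D\<close> in it is then locally constant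
  on a connected parameter interval, hence constant.\<close>

lemma scaling:
  assumes "i < n" "0 \<le> a" "b \<le> 1" "runs (fE i) j h a b" "a \<le> u" "u \<le> v" "v \<le> b"
  shows "mass j (h v) - mass j (h u) = lam * (mass i v - mass i u)"
proof -
  define D where "D u = mass j (h u) - lam * mass i u" for u
  have "D u = D v"
  proof (rule connected_local_const[of "{a..b}" u v D])
    show "\<forall>s\<in>{a..b}. \<forall>\<^sub>F u in at s within {a..b}. D s = D u"
    proof
      fix s assume s: "s \<in> {a..b}"
      then have "E i s \<in> X"
        using assms by (intro E_in) auto
      from stretch_nhd[OF this] obtain U where U: "openin (top_of_set X) U" "E i s \<in> U"
        "scales U"
        by metis
      obtain G where G: "open G" "U = X \<inter> G"
        using U(1) by (auto simp: openin_open)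
      have cE: "continuous_on {a..b} (E i)" and ch: "continuous_on {a..b} h"
        using assms E_cont by (auto simp: runs_def)
      have "\<forall>\<^sub>F u in at s within {a..b}. E i u \<in> G"
        using cE s G U(2) by (intro topological_tendstoD) (auto simp: continuous_on_def)
      then obtain d1 where d1: "d1 > 0" "\<And>u. u \<in> {a..b} \<Longrightarrow> dist u s < d1 \<Longrightarrow> E i u \<in> G"
        unfolding eventually_at using U(2) G by (metis IntD2 dist_self zero_less_dist_iff)
      obtain d2 where d2: "d2 > 0" "\<And>u. u \<in> {a..b} \<Longrightarrow> dist u s < d2 \<Longrightarrow> dist (h u) (h s) < 1"
        using ch s unfolding continuous_on_iff by (metis zero_less_one)
      \<comment> \<open>The bound \<open>d1\<close> keeps the arc in the scaling neighbourhood of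
        \<open>E i s\<close>, \<open>d2\<close> keeps the image shorter than a loop, and 1 does so
        for the arc itself.\<close>
      define d where "d = min (min d1 d2) 1"
      have small: "D x = D y" if "x \<in> {a..b}" "y \<in> {a..b}" "x < y" "x = s \<or> y = s" "dist x y < d" for x y
      proof -
        have ds: "dist w s < d" if "w \<in> {x..y}" for w
          using that \<open>x = s \<or> y = s\<close> \<open>dist x y < d\<close> by (auto simp: dist_real_def)
        have "E i ` {x..y} \<subseteq> U"
          using d1(2) ds that assms(1-3) G by (auto simp: d_def intro!: E_in)
        moreover have "h y - h x < 1"
          using that d2(2)[of x] d2(2)[of y] ds[of x] ds[of y] by (auto simp: d_def dist_real_def abs_less_iff)
        ultimately have "mass j (h y) - mass j (h x) = lam * (mass i y - mass i x)"
          using that assms(1-4) U(3)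
          by (intro small_scaling[of i a b j h U]) (auto simp: d_def dist_real_def)
        then show ?thesis
          by (simp add: D_def algebra_simps)
      qed
      have "D s = D u" if "u \<in> {a..b}" "dist u s < d" for u
        using small[of s u] small[of u s] s that by (cases s u rule: linorder_cases) (auto simp: dist_commute)
      moreover have "d > 0"
        using d1 d2 by (simp add: d_def)
      ultimately show "\<forall>\<^sub>F u in at s within {a..b}. D s = D u"
        unfolding eventually_at by blast
    qed
  qed (use assms in auto)
  then show ?thesis
    by (simp add: D_def algebra_simps)
qed

text \<open>In the induction the run of \<open>f ^^ m\<close> is shortened until it stays inside the
  next run of \<open>f\<close>; the factors \<open>lam\<close> multiply.\<close>

lemma right_run_funpow:
  assumes "i < n" "0 \<le> s" "s < 1"
  shows "\<exists>b j h. b \<le> 1 \<and> runs (\<lambda>u. (f ^^ m) (E i u)) j h s b \<and>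
    (\<forall>u\<in>{s..b}. mass j (h u) - mass j (h s) = lam ^ m * (mass i u - mass i s))"
proof (induction m)
  case 0
  have "runs (\<lambda>u. (f ^^ 0) (E i u)) i (\<lambda>u. u) s 1"
    using assms by (auto simp: runs_def strict_mono_on_def)
  then show ?case
    by (rule_tac exI[of _ 1], rule_tac exI[of _ i], rule_tac exI[of _ "\<lambda>u. u"]) auto
next
  case (Suc m)
  then obtain b j h where b: "b \<le> 1" and h: "runs (\<lambda>u. (f ^^ m) (E i u)) j h s b"
    and M: "\<And>u. u \<in> {s..b} \<Longrightarrow> mass j (h u) - mass j (h s) = lam ^ m * (mass i u - mass i s)"
    by blast
  have sb: "s < b" "j < n"
    using h by (auto simp: runs_def)
  have hs: "0 \<le> h s" "h s < 1"
    using runs_less[OF h, of s b] sb by auto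
  obtain b' j' h' where b': "b' \<le> 1" and h': "runs (fE j) j' h' (h s) b'"
    using right_run[OF sb(2) hs] by metis
  have "h s < b'"
    using h' by (simp add: runs_def)
  then obtain c where c: "s < c" "c \<le> b" "\<And>u. s \<le> u \<Longrightarrow> u \<le> c \<Longrightarrow> h u < b'"
    using runs_shrink_right[OF h] by metis
  have hc: "runs (\<lambda>u. (f ^^ m) (E i u)) j h s c"
    using runs_subinterval[OF h, of s c] c by simp
  have hin: "h u \<in> {h s..b'}" if "u \<in> {s..c}" for u
    using runs_less[OF hc, of s u] c(3)[of u] that by (cases "u = s") auto
  have "runs (\<lambda>u. (f ^^ Suc m) (E i u)) j' (h' \<circ> h) s c"
    unfolding runs_def
  proof (intro conjI ballI)
    show "continuous_on {s..c} (h' \<circ> h)"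
      using hc h' hin by (intro continuous_on_compose) (auto simp: runs_def intro: continuous_on_subset)
    show "strict_mono_on {s..c} (h' \<circ> h)"
    proof (rule strict_mono_onI)
      fix x y assume "x \<in> {s..c}" "y \<in> {s..c}" "x < y"
      then show "(h' \<circ> h) x < (h' \<circ> h) y"
        using runs_less[OF hc, of x y] runs_less[OF h', of "h x" "h y"] hin[of x] hin[of y] by auto
    qed
    show "(h' \<circ> h) ` {s..c} \<subseteq> {0..1}"
      using hin runs_bounds[OF h'] by auto
    show "(f ^^ Suc m) (E i u) = E j' ((h' \<circ> h) u)" if "u \<in> {s..c}" for u
      using runs_eq[OF hc, of u] runs_eq[OF h', of "h u"] hin[OF that] that by simp
  qed (use c h' in \<open>auto simp: runs_def\<close>)
  moreover have "mass j' ((h' \<circ> h) u) - mass j' ((h' \<circ> h) s) = lam ^ Suc m * (mass i u - mass i s)"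
    if "u \<in> {s..c}" for u
    using scaling[OF sb(2) hs(1) b' h', of "h s" "h u"] hin[OF that] M[of u] that c by simp
  ultimately show ?case
    using order_trans[OF c(2) b] by blast
qed

section \<open>Flatness at the branch point and full support\<close>

lemma n_pos: "n > 0"
proof (rule ccontr)
  assume "\<not> n > 0"
  then have "X = {p}"
    using X_eq by simp
  then have "measure \<mu> X = 0"
    using measure_point[OF p_in] by simp
  then show False
    using emeasure_X by (simp add: measure_def)
qed

text \<open>The image of the outgoing germ of edge \<open>i\<close> begins with the outgoing germ of
  edge \<open>j\<close>. As \<open>f p = p\<close>, the run automatically starts at parameter
  0.\<close>

definition out :: "nat \<Rightarrow> nat \<Rightarrow> bool" where
  "out i j \<longleftrightarrow> i < n \<and> (\<exists>b h. b \<le> 1 \<and> runs (fE i) j h 0 b)"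

definition inn :: "nat \<Rightarrow> nat \<Rightarrow> bool" where
  "inn i j \<longleftrightarrow> i < n \<and> (\<exists>a h. 0 \<le> a \<and> runs (fE i) j h a 1)"

lemma out_ex:
  assumes "i < n" shows "\<exists>j. out i j"
proof -
  obtain b j h where "b \<le> 1" "runs (fE i) j h 0 b"
    using right_run[OF assms order_refl zero_less_one] .
  then show ?thesis
    unfolding out_def using assms by blast
qed

lemma inn_ex:
  assumes "i < n" shows "\<exists>j. inn i j"
proof -
  obtain a j h where "0 \<le> a" "runs (fE i) j h a 1"
    using left_run[OF assms zero_less_one order_refl] .
  then show ?thesis
    unfolding inn_def using assms by blast
qed

lemma edge_near_end:
  assumes "openin (top_of_set X) W" "p \<in> W" "i < n"
  obtains d where "0 < d" "d \<le> 1" "E i ` {0..d} \<subseteq> W" "E i ` {1-d..1} \<subseteq> W"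
proof -
  obtain G where G: "open G" "W = X \<inter> G"
    using assms(1) by (auto simp: openin_open)
  have *: "\<exists>d>0. \<forall>u\<in>{0..1}. dist u s < d \<longrightarrow> E i u \<in> G" if "s \<in> {0..1}" "E i s = p" for s
  proof -
    have "\<forall>\<^sub>F u in at s within {0..1}. E i u \<in> G"
      using E_path[OF assms(3)] that G assms(2) by (intro topological_tendstoD) (auto simp: continuous_on_def)
    then show ?thesis
      unfolding eventually_at using that G assms(2) by (metis IntD2 dist_self zero_less_dist_iff)
  qed
  obtain d0 where d0: "d0 > 0" "\<And>u. u \<in> {0..1} \<Longrightarrow> dist u 0 < d0 \<Longrightarrow> E i u \<in> G"
    using *[of 0] E_0 assms by auto
  obtain d1 where d1: "d1 > 0" "\<And>u. u \<in> {0..1} \<Longrightarrow> dist u 1 < d1 \<Longrightarrow> E i u \<in> G"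
    using *[of 1] E_1 assms by auto
  define d where "d = min 1 (min (d0 / 2) (d1 / 2))"
  show ?thesis
  proof (rule that[of d])
    have "{0..d} \<subseteq> {u \<in> {0..1}. dist u 0 < d0}" "{1-d..1} \<subseteq> {u \<in> {0..1}. dist u 1 < d1}"
      using d0(1) d1(1) by (auto simp: d_def dist_real_def)
    moreover have "E i u \<in> W" if "u \<in> {0..1}" "dist u 0 < d0 \<or> dist u 1 < d1" for u
      using d0(2)[OF that(1)] d1(2)[OF that(1)] E_in[OF assms(3), of u] that by (auto simp: G)
    ultimately show "E i ` {0..d} \<subseteq> W" "E i ` {1-d..1} \<subseteq> W"
      by (blast intro!: image_subsetI)+
  qed (use d0 d1 in \<open>auto simp: d_def\<close>)
qed

text \<open>The beginning (\<open>\<sigma> = True\<close>) or the end (\<open>\<sigma> = False\<close>) of an edge, as a path starting at \<open>p\<close>.\<close>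
definition germ :: "bool \<Rightarrow> nat \<Rightarrow> real \<Rightarrow> 'a" where
  "germ \<sigma> j u = E j (if \<sigma> then u else 1 - u)"

lemma germ_path:
  assumes "j < n" "0 < \<eta>" "\<eta> \<le> 1 / 4"
  shows "continuous_on {0..\<eta>} (germ \<sigma> j)" "germ \<sigma> j 0 = p" "germ \<sigma> j \<eta> \<noteq> p"
proof -
  show "continuous_on {0..\<eta>} (germ \<sigma> j)"
    unfolding germ_def using assms
    by (intro continuous_on_compose2[OF E_path[of j]]; cases \<sigma>) (auto intro!: continuous_intros)
  show "germ \<sigma> j 0 = p" "germ \<sigma> j \<eta> \<noteq> p"
    using E_ne_p[of j "1 - \<eta>"] E_ne_p[of j \<eta>] assms by (auto simp: germ_def E_0 E_1)
qed

lemma germs_disjoint: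
  assumes "j < n" "l < n" "\<eta> \<le> 1 / 4" "(\<sigma>, j) \<noteq> (\<rho>, l)"
  shows "germ \<sigma> j ` {0<..\<eta>} \<inter> germ \<rho> l ` {0<..\<eta>} = {}"
proof -
  have False if "germ \<sigma> j u = germ \<rho> l v" "u \<in> {0<..\<eta>}" "v \<in> {0<..\<eta>}" for u v
    using E_eq_interior[of j l "if \<sigma> then u else 1 - u" "if \<rho> then v else 1 - v"] that assms
    by (auto simp: germ_def split: if_splits)
  then show ?thesis
    by blast
qed

lemma out_image:
  assumes "out i j" "openin (top_of_set X) W" "p \<in> W"
  shows "\<exists>d>0. germ True j ` {0..d} \<subseteq> f ` W"
proof -
  obtain b h where b: "b \<le> 1" "runs (fE i) j h 0 b" and i: "i < n"
    using assms(1) by (auto simp: out_def)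
  obtain d where d: "0 < d" "d \<le> 1" "E i ` {0..d} \<subseteq> W"
    using edge_near_end[OF assms(2,3) i] by metis
  define c where "c = min b d"
  have c: "0 < c" "c \<le> b" "c \<le> d"
    using b d by (auto simp: c_def runs_def)
  have "h 0 = 0"
    using runs_start[OF b(2)] i by (simp add: E_0 f_p)
  then have "E j ` {0..h c} = f ` E i ` {0..c}"
    using runs_image(2)[OF b(2), of 0 c] c by (simp add: image_image)
  also have "\<dots> \<subseteq> f ` W"
    using d c by (intro image_mono) (auto simp: subset_eq)
  finally show ?thesis
    using runs_less[OF b(2), of 0 c] c \<open>h 0 = 0\<close> by (intro exI[of _ "h c"]) (simp add: germ_def)
qed

lemma inn_image:
  assumes "inn i j" "openin (top_of_set X) W" "p \<in> W"
  shows "\<exists>d>0. germ False j ` {0..d} \<subseteq> f ` W"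
proof -
  obtain a h where a: "0 \<le> a" "runs (fE i) j h a 1" and i: "i < n"
    using assms(1) by (auto simp: inn_def)
  obtain d where d: "0 < d" "d \<le> 1" "E i ` {1-d..1} \<subseteq> W"
    using edge_near_end[OF assms(2,3) i] by metis
  define c where "c = max a (1 - d)"
  have c: "a \<le> c" "c < 1" "1 - d \<le> c"
    using a d by (auto simp: c_def runs_def)
  have "h 1 = 1"
    using runs_end[OF a(2)] i by (simp add: E_1 f_p)
  then have "E j ` {h c..1} = f ` E i ` {c..1}"
    using runs_image(2)[OF a(2), of c 1] c by (simp add: image_image)
  also have "\<dots> \<subseteq> f ` W"
    using d c by (intro image_mono) (auto simp: subset_eq)
  finally have "E j ` {h c..1} \<subseteq> f ` W" .
  then have "germ False j ` {0..1 - h c} \<subseteq> f ` W"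
    by (auto simp: germ_def image_subset_iff)
  then show ?thesis
    using runs_less[OF a(2), of c 1] c \<open>h 1 = 1\<close> by (intro exI[of _ "1 - h c"]) simp
qed

text \<open>Of the homeomorphism onto an interval only a continuous injection into the reals is
  kept, restricted to the image of an open neighbourhood of \<open>p\<close>.\<close>

lemma flat_chart:
  obtains W \<phi> where "openin (top_of_set X) W" "p \<in> W"
    "continuous_on (f ` W) \<phi>" "inj_on (\<phi> :: 'a \<Rightarrow> real) (f ` W)"
proof -
  from flat[unfolded one_step_flat_def, THEN bspec, OF p_in]
  obtain W U and J :: "real set" where W: "openin (top_of_set X) W" "p \<in> W" "W \<subseteq> U" "f ` U homeomorphic J"
    by (elim exE conjE) blast
  from W(4) obtain \<phi> \<psi> where h: "homeomorphism (f ` U) J \<phi> \<psi>"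
    unfolding homeomorphic_def by (elim exE)
  have sub: "f ` W \<subseteq> f ` U"
    using W(3) by (rule image_mono)
  have "continuous_on (f ` U) \<phi>"
    using h by (simp add: homeomorphism_def)
  moreover have "inj_on \<phi> (f ` U)"
    using homeomorphism_apply1[OF h] by (rule inj_on_inverseI)
  ultimately show ?thesis
    by (rule that[OF W(1,2) continuous_on_subset[OF _ sub] inj_on_subset[OF _ sub]])
qed

definition germ_in_image :: "bool \<times> nat \<Rightarrow> bool" where
  "germ_in_image g \<longleftrightarrow> snd g < n \<and>
    (\<forall>W. openin (top_of_set X) W \<longrightarrow> p \<in> W \<longrightarrow> (\<exists>d>0. germ (fst g) (snd g) ` {0..d} \<subseteq> f ` W))"

text \<open>Near \<open>p\<close> the image of \<open>f\<close> is an interval, in which only two germs fit.\<close>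
lemma three_germs:
  assumes "germ_in_image g\<^sub>0" "germ_in_image g\<^sub>1" "germ_in_image g\<^sub>2"
  shows "g\<^sub>0 = g\<^sub>1 \<or> g\<^sub>0 = g\<^sub>2 \<or> g\<^sub>1 = g\<^sub>2"
proof -
  define g where "g k = germ (fst k) (snd k)" for k
  let ?K = "{g\<^sub>0, g\<^sub>1, g\<^sub>2}"
  obtain W and \<phi> :: "'a \<Rightarrow> real" where W: "openin (top_of_set X) W" "p \<in> W"
    and \<phi>: "continuous_on (f ` W) \<phi>" "inj_on \<phi> (f ` W)"
    using flat_chart by metis
  have "snd k < n \<and> (\<exists>d>0. g k ` {0..d} \<subseteq> f ` W)" if "germ_in_image k" for k
    using that W unfolding germ_in_image_def g_def by blast
  from assms[THEN this] obtain d0 d1 d2 where sn: "snd g\<^sub>0 < n" "snd g\<^sub>1 < n" "snd g\<^sub>2 < n"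
    and d: "0 < d0" "0 < d1" "0 < d2"
    "g g\<^sub>0 ` {0..d0} \<subseteq> f ` W" "g g\<^sub>1 ` {0..d1} \<subseteq> f ` W" "g g\<^sub>2 ` {0..d2} \<subseteq> f ` W"
    by (elim conjE exE)
  have sn: "snd k < n" if "k \<in> ?K" for k
    using sn that by blast
  define \<eta> where "\<eta> = min (1 / 4) (min d0 (min d1 d2))"
  have \<eta>: "0 < \<eta>" "\<eta> \<le> 1 / 4"
    using d by (auto simp: \<eta>_def)
  have mono: "g k ` {0..\<eta>} \<subseteq> f ` W" if "g k ` {0..d} \<subseteq> f ` W" "\<eta> \<le> d" for k d
    using that by (auto simp: image_subset_iff)
  have "\<eta> \<le> d0" "\<eta> \<le> d1" "\<eta> \<le> d2"
    by (auto simp: \<eta>_def)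
  note sub = mono[OF d(4) this(1)] mono[OF d(5) this(2)] mono[OF d(6) this(3)]
  show ?thesis
  proof (rule no_tripod_in_interval[OF \<eta>(1) \<phi>, of ?K g p])
    show "g k ` {0..\<eta>} \<subseteq> f ` W" if "k \<in> ?K" for k
      using sub that by blast
    show "continuous_on {0..\<eta>} (g k)" "g k 0 = p" "g k \<eta> \<noteq> p" if "k \<in> ?K" for k
      unfolding g_def by (rule germ_path[OF sn[OF that] \<eta>])+
    show "g k ` {0<..\<eta>} \<inter> g l ` {0<..\<eta>} = {}" if "k \<in> ?K" "l \<in> ?K" "k \<noteq> l" for k l
      unfolding g_def using that(3) sn[OF that(1)] sn[OF that(2)] \<eta>(2)
      by (intro germs_disjoint) (simp_all add: prod_eq_iff)
  qed simp_all
qed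

lemma out_germ: "out i j \<Longrightarrow> germ_in_image (True, j)"
  using out_image by (auto simp: germ_in_image_def out_def runs_def)

lemma inn_germ: "inn i j \<Longrightarrow> germ_in_image (False, j)"
  using inn_image by (auto simp: germ_in_image_def inn_def runs_def)

text \<open>Some incoming germ is also in the image and differs from both outgoing ones, so among
  the three germs only the two outgoing ones can coincide.\<close>

lemma out_unique: "\<lbrakk>out i j; out i' j'\<rbrakk> \<Longrightarrow> j = j'"
  using inn_ex[OF n_pos] three_germs[OF out_germ out_germ inn_germ] by blast

lemma inn_unique: "\<lbrakk>inn i j; inn i' j'\<rbrakk> \<Longrightarrow> j = j'"
  using out_ex[OF n_pos] three_germs[OF inn_germ inn_germ out_germ] by blast

text \<open>If no image of the arc met \<open>p\<close>, every image would be a connected subset of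
  a single open edge. Expansion would then make the diameters grow without bound, although
  \<open>d'\<close> is bounded on the compact space \<open>X\<close>.\<close>

lemma hits_p:
  assumes "i < n" "0 < s" "s < t" "t < 1"
  obtains m u where "m > 0" "u \<in> {s..t}" "(f ^^ m) (E i u) = p"
proof (rule ccontr)
  assume "\<not> thesis"
  then have np: "(f ^^ m) (E i u) \<noteq> p" if "m > 0" "u \<in> {s..t}" for m u
    using \<open>\<And>m u. \<lbrakk>m > 0; u \<in> {s..t}; (f ^^ m) (E i u) = p\<rbrakk> \<Longrightarrow> thesis\<close> that by blast
  let ?A = "E i ` {s..t}"
  have AX: "?A \<subseteq> X" and cA: "connected ?A"
    using assms arc_subset E_cont by (auto intro!: connected_continuous_image)
  from expansion[unfolded expansion_def]
  obtain d' C lam' where d': "Metric_space X d'" "Metric_space.mtopology X d' = top_of_set X"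
    and C: "C > 0" "lam' > 1"
    and ex0: "\<forall>m>0. \<forall>i<n. \<forall>j<n. \<forall>s t. 0 < s \<and> s \<le> t \<and> t < 1 \<and>
      (f ^^ m) ` (E i ` {s..t}) \<subseteq> open_edge E j \<longrightarrow>
      diam_wrt d' ((f ^^ m) ` (E i ` {s..t})) \<ge> C * lam' ^ m * diam_wrt d' (E i ` {s..t})"
    by (elim exE conjE) (rule that)
  have ex: "C * lam' ^ m * diam_wrt d' ?A \<le> diam_wrt d' ((f ^^ m) ` ?A)"
    if "m > 0" "j < n" "(f ^^ m) ` ?A \<subseteq> open_edge E j" for m j
    using ex0[rule_format, OF that(1) assms(1) that(2), of s t] that(3) assms by simp
  interpret d': Metric_space X d' by (rule d')
  have "compactin d'.mtopology X"
    using compact_X d'(2) by (simp add: compactin_subtopology)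
  then have "d'.mbounded X"
    by (rule d'.compactin_imp_mbounded)
  then obtain B where B: "\<And>x y. x \<in> X \<Longrightarrow> y \<in> X \<Longrightarrow> d' x y \<le> B"
    unfolding d'.mbounded_alt by (elim conjE exE) (rule that, blast)
  have bdd: "bdd_above ((\<lambda>(u, v). d' u v) ` (S \<times> S))" if "S \<subseteq> X" for S
    using B that by (intro bdd_aboveI2[of _ _ B]) (auto simp: subset_eq)
  have diam_le: "diam_wrt d' S \<le> B" if "S \<subseteq> X" "S \<noteq> {}" for S
    unfolding diam_wrt_def using B that by (intro cSUP_least) (auto simp: subset_eq)
  have "E i s \<noteq> E i t"
    using E_eq_interior[of i i s t] assms by auto
  moreover have st: "E i s \<in> ?A" "E i t \<in> ?A"
    using assms by auto
  ultimately have "0 < d' (E i s) (E i t)"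
    using d'.mdist_pos_eq[OF subsetD[OF AX] subsetD[OF AX]] by blast
  also have "\<dots> \<le> diam_wrt d' ?A"
  proof -
    have "(case (E i s, E i t) of (u, v) \<Rightarrow> d' u v) \<le> diam_wrt d' ?A"
      unfolding diam_wrt_def by (rule cSUP_upper[OF _ bdd[OF AX]]) (use st in blast)
    then show ?thesis by simp
  qed
  finally have pos: "diam_wrt d' ?A > 0" .
  have le: "C * lam' ^ m * diam_wrt d' ?A \<le> B" if "m > 0" for m
  proof -
    let ?S = "(f ^^ m) ` ?A"
    have SX: "?S \<subseteq> X"
      using AX funpow_in by auto
    have cS: "connected ?S"
      by (rule connected_continuous_image[OF continuous_on_subset[OF cont_funpow AX] cA])
    have pS: "p \<notin> ?S"
    proof
      assume "p \<in> ?S"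
      then obtain u where "u \<in> {s..t}" "(f ^^ m) (E i u) = p"
        by (metis imageE)
      then show False
        using np[OF that] by blast
    qed
    obtain x where x: "x \<in> ?S"
      using st by blast
    have "x \<in> X" "x \<noteq> p"
      using SX x pS by blast+
    then obtain j u where j: "j < n" "0 < u" "u < 1" "x = E j u"
      using point_cases by metis
    then have "x \<in> E j ` {0<..<1}"
      by simp
    then have "?S \<subseteq> open_edge E j"
      unfolding open_edge_def using connected_in_edge[OF cS SX pS j(1)] x by blast
    then have "C * lam' ^ m * diam_wrt d' ?A \<le> diam_wrt d' ?S"
      using ex[OF that j(1)] by simp
    also have "\<dots> \<le> B"
      using SX x by (intro diam_le) auto
    finally show ?thesis .
  qed
  obtain m where m: "B / (C * diam_wrt d' ?A) < lam' ^ m"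
    using real_arch_pow[OF C(2)] by blast
  \<comment> \<open>The estimate \<open>le\<close> needs a positive exponent, whereas the
    \<open>m\<close> just obtained may be 0.\<close>
  have "lam' ^ m \<le> lam' ^ Suc m"
    using C by (intro power_increasing) auto
  with m have "B / (C * diam_wrt d' ?A) < lam' ^ Suc m"
    by linarith
  then have "B < C * lam' ^ Suc m * diam_wrt d' ?A"
    using C pos by (simp add: field_simps)
  then show False
    using le[of "Suc m"] by simp
qed

lemma cont_funpow_E: "\<lbrakk>i < n; 0 \<le> a; b \<le> 1\<rbrakk> \<Longrightarrow> continuous_on {a..b} (\<lambda>u. (f ^^ m) (E i u))"
  using arc_subset E_cont by (intro continuous_on_compose2[OF cont_funpow])

text \<open>Runs of \<open>f ^^ m\<close> are available only locally, to the right of a given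
  parameter, so the null set is extended by a supremum argument. A run starting at the supremum maps
  a null arc onto a null arc and pushes the supremum further.\<close>

lemma null_forward:
  assumes "i < n" "0 \<le> s" "s \<le> t" "t \<le> 1" "mass i t = mass i s"
  shows "(f ^^ m) ` E i ` {s..t} \<in> null_sets \<mu>"
proof -
  define Q where "Q v = (\<lambda>u. (f ^^ m) (E i u)) ` {s..v}" for v
  have Qs: "Q v \<in> sets \<mu>" if "v \<le> t" for v
  proof (rule closed_sets)
    show "closed (Q v)"
      unfolding Q_def using that assms cont_funpow_E by (intro compact_imp_closed compact_continuous_image) auto
    show "Q v \<subseteq> X"
      unfolding Q_def using that assms by (auto intro!: funpow_in E_in)
  qed
  have pt: "{(f ^^ m) (E i v)} \<in> null_sets \<mu>" if "s \<le> v" "v \<le> t" for v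
  proof -
    have "(f ^^ m) (E i v) \<in> X"
      using that assms by (intro funpow_in E_in) auto
    then show ?thesis
      using measure_point closed_sets[of "{(f ^^ m) (E i v)}"]
      by (auto simp: null_sets_def emeasure_eq_measure)
  qed
  define S where "S = {v \<in> {s..t}. Q v \<in> null_sets \<mu>}"
  have "s \<in> S"
    using pt[of s] assms by (simp add: S_def Q_def)
  have bdd: "bdd_above S"
    by (rule bdd_aboveI[of _ t]) (simp add: S_def)
  define z where "z = Sup S"
  have z: "s \<le> z" "z \<le> t"
    unfolding z_def using \<open>s \<in> S\<close> bdd by (auto intro!: cSup_upper cSup_least simp: S_def)
  have below: "Q v \<in> null_sets \<mu>" if "s \<le> v" "v < z" for v
  proof -
    obtain w where w: "w \<in> S" "v < w"
      using less_cSupD[of S v] \<open>s \<in> S\<close> \<open>v < z\<close> by (auto simp: z_def)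
    have "Q v \<subseteq> Q w"
      unfolding Q_def using w by (intro image_mono) auto
    moreover have "Q v \<in> sets \<mu>"
      using w by (intro Qs) (auto simp: S_def)
    ultimately show ?thesis
      using w null_sets_subset[of "Q w" \<mu> "Q v"] by (auto simp: S_def)
  qed
  have "Q z \<in> null_sets \<mu>"
  proof -
    \<comment> \<open>A sequence approaching \<open>z\<close> from the left, cut off at
      \<open>s\<close>: the image over \<open>{s..z}\<close> is a countable union of null sets and
      one further point.\<close>
    define w where "w k = max s (z - 1 / Suc k)" for k :: nat
    have wk: "s \<le> w k" "w k < z \<or> w k = s" for k
      by (auto simp: w_def max_def)
    have "Q (w k) \<in> null_sets \<mu>" for k
      using wk[of k] below[of "w k"] \<open>s \<in> S\<close> by (auto simp: S_def)
    then have "(\<Union>k. Q (w k)) \<union> {(f ^^ m) (E i z)} \<in> null_sets \<mu>"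
      using pt[of z] z by (intro null_sets.Un null_sets_UN) auto
    moreover have "Q z \<subseteq> (\<Union>k. Q (w k)) \<union> {(f ^^ m) (E i z)}"
    proof
      fix x assume "x \<in> Q z"
      then obtain u where u: "s \<le> u" "u \<le> z" "x = (f ^^ m) (E i u)"
        by (auto simp: Q_def)
      show "x \<in> (\<Union>k. Q (w k)) \<union> {(f ^^ m) (E i z)}"
      proof (cases "u = z")
        case False
        then obtain k where "1 / Suc k < z - u"
          using u nat_approx_posE[of "z - u"] by auto
        then have "u \<le> w k"
          by (simp add: w_def)
        then have "x \<in> Q (w k)"
          using u by (auto simp: Q_def)
        then show ?thesis by blast
      qed (use u in simp)
    qed
    ultimately show ?thesis
      using null_sets_subset Qs[OF z(2)] by blast
  qed
  have "z = t"
  proof (rule ccontr)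
    assume "z \<noteq> t"
    then have "z < t" using z by simp
    then obtain b j h where b: "b \<le> 1" "runs (\<lambda>u. (f ^^ m) (E i u)) j h z b"
      and M: "\<And>u. u \<in> {z..b} \<Longrightarrow> mass j (h u) - mass j (h z) = lam ^ m * (mass i u - mass i z)"
      using right_run_funpow[of i z m] assms z by auto
    define c where "c = min b t"
    have c: "z < c" "c \<le> b" "c \<le> t" "j < n"
      using b \<open>z < t\<close> by (auto simp: c_def runs_def)
    have "mass i s \<le> mass i z" "mass i z \<le> mass i c" "mass i c \<le> mass i t"
      using assms z c mass_mono[of i s z] mass_mono[of i z c] mass_mono[of i c t] by simp_all
    then have "mass j (h c) - mass j (h z) = 0"
      using M[of c] c assms by simp
    moreover have hb: "0 \<le> h z" "h z \<le> h c" "h c \<le> 1"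
      using runs_less[OF b(2), of z c] c by auto
    ultimately have "measure \<mu> (E j ` {h z..h c}) = 0"
      using c by (simp add: measure_arc)
    then have "E j ` {h z..h c} \<in> null_sets \<mu>"
      using arc_sets[of j "h z" "h c"] hb c by (simp add: null_sets_def emeasure_eq_measure)
    then have "Q z \<union> E j ` {h z..h c} \<in> null_sets \<mu>"
      using \<open>Q z \<in> null_sets \<mu>\<close> by (intro null_sets.Un)
    also have "Q z \<union> E j ` {h z..h c} = Q c"
    proof -
      have "{s..c} = {s..z} \<union> {z..c}"
        using z c by auto
      then show ?thesis
        using runs_image(2)[OF b(2), of z c] c by (simp add: Q_def image_Un)
    qed
    finally have "c \<in> S"
      using c z by (simp add: S_def)
    then show False
      using cSup_upper[OF _ bdd, of c] c by (simp add: z_def)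
  qed
  then show ?thesis
    using \<open>Q z \<in> null_sets \<mu>\<close> by (simp add: Q_def image_image)
qed

text \<open>The image of the arc over \<open>{0..u}\<close> is a path from \<open>p\<close> to
  \<open>p\<close> that rises at every time, so it covers each edge that it enters. This image is
  null, and so is the covered edge.\<close>

lemma null_edge_forward:
  assumes "i < n" "0 < u" "u \<le> 1" "mass i u = 0" "(f ^^ m) (E i u) = p"
    and "0 < w" "w < u" "k < n" "(f ^^ m) (E i w) \<in> E k ` {0<..<1}"
  shows "mass k 1 = 0"
proof -
  let ?\<gamma> = "\<lambda>u. (f ^^ m) (E i u)"
  have "E k ` {0..1} \<subseteq> ?\<gamma> ` {0..u}"
  proof (rule rising_path_covers_edge)
    show "\<exists>b j h. b \<le> u \<and> runs ?\<gamma> j h s b" if s: "0 \<le> s" "s < u" for s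
    proof -
      obtain b j h where b: "runs ?\<gamma> j h s b"
        using right_run_funpow[of i s m] assms s by auto
      then have "runs ?\<gamma> j h s (min b u)"
        using s by (intro runs_subinterval[OF b]) (auto simp: runs_def)
      then show ?thesis
        by (intro exI[of _ "min b u"]) auto
    qed
  qed (use assms in \<open>auto simp: E_0 funpow_p intro!: cont_funpow_E funpow_in E_in\<close>)
  moreover have "?\<gamma> ` {0..u} \<in> null_sets \<mu>"
    using null_forward[of i 0 u m] assms by (simp add: mass_0 image_image)
  ultimately have "E k ` {0..1} \<in> null_sets \<mu>"
    using null_sets_subset arc_sets[of k 0 1] assms by auto
  then show ?thesis
    by (simp add: mass_def measure_def null_sets_def)
qed

lemma full_support:
  assumes "i < n" "0 \<le> s" "s < t" "t \<le> 1"
  shows "mass i s < mass i t"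
proof (rule ccontr)
  assume "\<not> mass i s < mass i t"
  then have eq: "mass i s = mass i t"
    using mass_mono[of i s t] assms by simp
  \<comment> \<open>The middle third lies strictly inside the edge, as \<open>hits_p\<close>
    requires, and leaves a piece of the null arc to the right of the hitting parameter.\<close>
  define s' t' where "s' = s + (t - s) / 3" and "t' = s + 2 * (t - s) / 3"
  have st: "s < s'" "s' < t'" "t' < t"
    using assms by (auto simp: s'_def t'_def field_simps)
  obtain m u where mu: "m > 0" "u \<in> {s'..t'}" "(f ^^ m) (E i u) = p"
    using hits_p[of i s' t'] assms st by auto
  obtain b j h where b: "b \<le> 1" "runs (\<lambda>u. (f ^^ m) (E i u)) j h u b"
    and M: "\<And>v. v \<in> {u..b} \<Longrightarrow> mass j (h v) - mass j (h u) = lam ^ m * (mass i v - mass i u)"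
    using right_run_funpow[of i u m] assms mu st by auto
  have j: "j < n" and "h u = 0"
    using b mu runs_start by (auto simp: runs_def)
  define c where "c = min b t"
  have c: "u < c" "c \<le> b" "c \<le> t"
    using b mu st by (auto simp: c_def runs_def)
  have "mass i s \<le> mass i u" "mass i u \<le> mass i c" "mass i c \<le> mass i t"
    using assms mu st c mass_mono[of i s u] mass_mono[of i u c] mass_mono[of i c t] by simp_all
  then have null: "mass j (h c) = 0"
    using M[of c] c eq \<open>h u = 0\<close> j by (simp add: mass_0)
  have hc: "0 < h c" "h c \<le> 1"
    using runs_less[OF b(2), of u c] c \<open>h u = 0\<close> by auto
  have null': "mass j v = 0" if "0 \<le> v" "v \<le> h c" for v
    using mass_mono[of j 0 v] mass_mono[of j v "h c"] null that j hc by (simp add: mass_0)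
  \<comment> \<open>The null arc has been moved to the start of edge \<open>j\<close>. A second hit
    of \<open>p\<close> makes the image over \<open>{0..u'}\<close> a closed path through
    \<open>p\<close>, to which \<open>null_edge_forward\<close> applies.\<close>
  obtain m' u' where mu': "m' > 0" "u' \<in> {h c / 3..h c / 2}" "(f ^^ m') (E j u') = p"
    using hits_p[of j "h c / 3" "h c / 2"] hc j by auto
  have u': "0 < u'" "u' < h c"
    using mu' hc by auto
  obtain b1 k h1 where b1: "b1 \<le> 1" "runs (\<lambda>u. (f ^^ m') (E j u)) k h1 0 b1"
    using right_run_funpow[of j 0 m'] j by auto
  have k: "k < n" "h1 0 = 0" "0 < b1"
    using b1 runs_start[OF b1(2)] j by (auto simp: runs_def E_0 funpow_p)
  define w where "w = min b1 u' / 2"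
  have w: "0 < w" "w < u'" "w < b1"
    using k u' by (auto simp: w_def min_def)
  have "0 < h1 w" "h1 w < 1"
    using runs_less[OF b1(2), of 0 w] runs_less[OF b1(2), of w b1] k w by auto
  then have "mass k 1 = 0"
    using null_edge_forward[of j u' m' w k] j u' hc mu' null' w k runs_eq[OF b1(2), of w] by auto
  \<comment> \<open>The image of the null edge \<open>k\<close> under \<open>f\<close> starts along
    \<open>a\<close>, so \<open>a\<close> is null. By flatness \<open>a\<close> is the common first
    edge of the images of all edges.\<close>
  obtain a where a: "out k a"
    using out_ex k by blast
  then obtain b2 h2 where b2: "b2 \<le> 1" "runs (fE k) a h2 0 b2"
    by (auto simp: out_def)
  have a2: "a < n" "h2 0 = 0" "0 < b2"
    using b2 runs_start[OF b2(2)] k by (auto simp: runs_def E_0 f_p)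
  have "0 < h2 (b2 / 2)" "h2 (b2 / 2) < 1"
    using runs_less[OF b2(2), of 0 "b2 / 2"] runs_less[OF b2(2), of "b2 / 2" b2] a2 by auto
  then have null_a: "mass a 1 = 0"
    using null_edge_forward[of k 1 1 "b2 / 2" a] k a2 b2 \<open>mass k 1 = 0\<close> runs_eq[OF b2(2), of "b2 / 2"]
    by (auto simp: E_1 f_p)
  have "mass l 1 = 0" if l: "l < n" for l
  proof -
    have "out l a"
      using out_ex[OF l] out_unique[OF _ a] by blast
    then obtain b3 h3 where b3: "b3 \<le> 1" "runs (fE l) a h3 0 b3"
      by (auto simp: out_def)
    \<comment> \<open>The start of edge \<open>l\<close> is mapped into \<open>a\<close> and returns
      by nonwandering. Hence an iterate of \<open>f\<close> maps a point of the null edge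
      \<open>a\<close> into the interior of \<open>l\<close>, and the images of \<open>a\<close>
      cover \<open>l\<close>.\<close>
    let ?U = "E l ` {0<..<b3}"
    have "0 < b3"
      using b3 by (simp add: runs_def)
    then have oU: "openin (top_of_set X) ?U" "E l (b3 / 2) \<in> ?U" "E l (b3 / 2) \<in> X"
      using b3 l by (auto intro!: openin_arc E_in)
    then obtain q where q: "q \<ge> 1" "(f ^^ q) ` ?U \<inter> ?U \<noteq> {}"
      using nonwandering unfolding all_nonwandering_def by blast
    then obtain x y where x: "0 < x" "x < b3" "0 < y" "y < b3" "(f ^^ q) (E l x) = E l y"
      by auto
    obtain q' where q': "q = Suc q'"
      using q by (cases q) auto
    have "f (E l x) = E a (h3 x)" "0 \<le> h3 x" "h3 x \<le> 1"
      using runs_eq[OF b3(2), of x] runs_bounds[OF b3(2), of x] x by auto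
    then have y: "(f ^^ q') (E a (h3 x)) = E l y"
      using x q' by (simp add: funpow_swap1)
    \<comment> \<open>Otherwise the orbit would be at \<open>p\<close> and stay there, whereas it
      returns to an interior point of edge \<open>l\<close>.\<close>
    have "h3 x \<noteq> 0" "h3 x \<noteq> 1"
      using y funpow_p E_ne_p[of l y] x b3 l a2 by (auto simp: E_0 E_1)
    then show ?thesis
      using null_edge_forward[of a 1 q' "h3 x" l] null_a y x a2 l \<open>0 \<le> h3 x\<close> \<open>h3 x \<le> 1\<close> b3
      by (auto simp: E_1 funpow_p)
  qed
  then have "(\<Union>l<n. E l ` {0..1}) \<in> null_sets \<mu>"
    using arc_sets[of _ 0 1]
    by (intro null_sets.finite_UN) (auto simp: mass_def null_sets_def emeasure_eq_measure)
  moreover have "{p} \<in> null_sets \<mu>"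
    using measure_point[OF p_in] closed_sets[of "{p}"] p_in by (simp add: null_sets_def emeasure_eq_measure)
  ultimately have "{p} \<union> (\<Union>l<n. E l ` {0..1}) \<in> null_sets \<mu>"
    by (rule null_sets.Un[rotated])
  then have "emeasure \<mu> X = 0"
    unfolding X_eq by (simp add: null_sets_def)
  then show False
    using emeasure_X by simp
qed

section \<open>Arc length and the graph metric\<close>

abbreviation "len i \<equiv> mass i 1"

lemma len_pos: "i < n \<Longrightarrow> 0 < len i"
  using full_support[of i 0 1] by (simp add: mass_0)

lemma mass_bounds: "\<lbrakk>i < n; 0 \<le> u; u \<le> 1\<rbrakk> \<Longrightarrow> 0 \<le> mass i u \<and> mass i u \<le> len i"
  using mass_mono[of i 0 u] mass_mono[of i u 1] by (simp add: mass_0)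

lemma interval_sym: "interval_between S x y I \<Longrightarrow> interval_between S y x I"
  unfolding interval_between_def
  by (metis arc_reversepath path_image_reversepath pathfinish_reversepath pathstart_reversepath)

lemma interval_ends: "interval_between S x y I \<Longrightarrow> x \<in> I \<and> y \<in> I \<and> I \<subseteq> S \<and> connected I \<and> closed I"
  unfolding interval_between_def
  by (auto simp: connected_path_image arc_imp_path compact_imp_closed compact_path_image)

lemma interval_join:
  assumes "interval_between S x q I" "interval_between S q y J" "I \<inter> J \<subseteq> {q}"
  shows "interval_between S x y (I \<union> J)"
proof -
  have q: "q \<in> I" "q \<in> J"
    using assms interval_ends by blast+
  consider "x = q" "I = {q}" | "y = q" "J = {q}"
    | g h where "arc g" "path_image g \<subseteq> S" "pathstart g = x" "pathfinish g = q" "I = path_image g"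
      "arc h" "path_image h \<subseteq> S" "pathstart h = q" "pathfinish h = y" "J = path_image h"
    using assms(1,2) unfolding interval_between_def by blast
  then show ?thesis
  proof cases
    case 1
    then have "I \<union> J = J"
      using q by blast
    then show ?thesis
      using assms 1 by simp
  next
    case 2
    then have "I \<union> J = I"
      using q by blast
    then show ?thesis
      using assms 2 by simp
  next
    case (3 g h)
    then have "arc (g +++ h)"
      using assms(3) by (intro arc_join) auto
    moreover have "path_image (g +++ h) = I \<union> J"
      using 3 by (simp add: path_image_join)
    ultimately show ?thesis
      unfolding interval_between_def using 3 by (intro disjI2 exI[of _ "g +++ h"]) auto
  qed
qed

lemma connected_trapped:
  assumes "connected I" "I \<subseteq> X" "i < n" "0 \<le> a" "a < u" "u < b" "b \<le> 1"
    and "E i a \<notin> I" "E i b \<notin> I" "E i u \<in> I"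
  shows "I \<subseteq> E i ` {a<..<b}" and "\<lbrakk>0 \<le> v; v \<le> 1; E i v \<in> I\<rbrakk> \<Longrightarrow> a < v \<and> v < b"
proof -
  have "I \<inter> E i ` {a<..<b} \<noteq> {}"
    using assms by auto
  then show I: "I \<subseteq> E i ` {a<..<b}"
    using connected_in_arc[OF assms(1-3), of a b] assms by simp
  assume v: "0 \<le> v" "v \<le> 1" "E i v \<in> I"
  then have "E i v \<in> E i ` {a<..<b}"
    using I by blast
  then obtain x where "a < x" "x < b" "E i x = E i v"
    by auto
  then show "a < v \<and> v < b"
    using E_eq_interior[of i i x v] assms v by simp
qed

text \<open>A point missed on each side of \<open>u\<close> would trap the connected set
  \<open>I\<close> strictly between the two, so it could not contain the point \<open>y\<close>
  outside the open edge.\<close>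

lemma connected_escapes:
  assumes "connected I" "I \<subseteq> X" "i < n" "0 \<le> u" "u \<le> 1" "E i u \<in> I" "y \<in> I" "y \<notin> E i ` {0<..<1}"
  shows "E i ` {0..u} \<subseteq> I \<or> E i ` {u..1} \<subseteq> I"
proof (rule ccontr)
  assume "\<not> ?thesis"
  then have "\<exists>a\<in>{0..u}. E i a \<notin> I" "\<exists>b\<in>{u..1}. E i b \<notin> I"
    by blast+
  then obtain a b where ab: "a \<in> {0..u}" "E i a \<notin> I" "b \<in> {u..1}" "E i b \<notin> I"
    by blast
  then have "a \<noteq> u" "b \<noteq> u"
    using assms by metis+
  then have lt: "0 \<le> a" "a < u" "u < b" "b \<le> 1"
    using ab by auto
  have "I \<subseteq> E i ` {a<..<b}"
    by (rule connected_trapped(1)[OF assms(1-3) lt ab(2,4) assms(6)])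
  also have "\<dots> \<subseteq> E i ` {0<..<1}"
    using lt by (intro image_mono) auto
  finally show False
    using assms by blast
qed

text \<open>On a loop there are two ways from \<open>E i u\<close> to \<open>E i v\<close>. A point
  missed on each of them would separate the two points within \<open>I\<close>.\<close>

lemma connected_between:
  assumes "connected I" "I \<subseteq> X" "i < n" "0 \<le> u" "u < v" "v \<le> 1" "E i u \<in> I" "E i v \<in> I"
  shows "E i ` {u..v} \<subseteq> I \<or> E i ` {0..u} \<subseteq> I \<and> E i ` {v..1} \<subseteq> I"
proof (rule ccontr)
  assume neg: "\<not> ?thesis"
  then have "\<exists>w\<in>{u..v}. E i w \<notin> I"
    by blast
  then obtain w where w: "w \<in> {u..v}" "E i w \<notin> I"
    by blast
  then have "w \<noteq> u" "w \<noteq> v"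
    using assms by metis+
  then have uwv: "u < w" "w < v"
    using w by auto
  have "\<not> E i ` {0..u} \<subseteq> I \<or> \<not> E i ` {v..1} \<subseteq> I"
    using neg by blast
  then obtain a where a: "a \<in> {0..u} \<or> a \<in> {v..1}" "E i a \<notin> I"
    by blast
  then have "a \<noteq> u" "a \<noteq> v"
    using assms by metis+
  then consider "0 \<le> a" "a < u" | "v < a" "a \<le> 1"
    using a by auto
  then show False
  proof cases
    case 1
    then show False
      using connected_trapped(2)[OF assms(1-3) 1 uwv(1) _ a(2) w(2) assms(7), of v] uwv assms by simp
  next
    case 2
    then show False
      using connected_trapped(2)[OF assms(1-3) _ uwv(2) 2 w(2) a(2) assms(8), of u] uwv assms by simp
  qed
qed

lemma interval_to_p:
  assumes "i < n" "0 < u" "u < 1"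
  shows "interval_between X (E i u) p (E i ` {0..u})" "interval_between X (E i u) p (E i ` {u..1})"
proof -
  have "interval_between X (E i 0) (E i u) (E i ` {0..u})"
    using assms arc_subset[of i 0 u] by (intro arc_interval_between) auto
  then show "interval_between X (E i u) p (E i ` {0..u})"
    using interval_sym assms(1) by (simp add: E_0)
  have "interval_between X (E i u) (E i 1) (E i ` {u..1})"
    using assms arc_subset[of i u 1] by (intro arc_interval_between) auto
  then show "interval_between X (E i u) p (E i ` {u..1})"
    using assms(1) by (simp add: E_1)
qed

lemma edges_meet: "\<lbrakk>i < n; j < n; i \<noteq> j\<rbrakk> \<Longrightarrow> E i ` {0..1} \<inter> E j ` {0..1} \<subseteq> {p}"
proof
  fix x assume "i < n" "j < n" "i \<noteq> j" "x \<in> E i ` {0..1} \<inter> E j ` {0..1}"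
  then obtain u v where "0 \<le> u" "u \<le> 1" "x = E i u" "0 \<le> v" "v \<le> 1" "E i u = E j v"
    by auto
  then show "x \<in> {p}"
    using E_eq_interior[of i j u v] E_eq_p[of i u] \<open>i < n\<close> \<open>j < n\<close> \<open>i \<noteq> j\<close> by (auto simp: less_le)
qed

lemma arcs_meet:
  assumes "i < n" "0 \<le> u" "u \<le> v" "v \<le> 1" "u < v \<or> 0 < u \<and> u < 1"
  shows "E i ` {0..u} \<inter> E i ` {v..1} \<subseteq> {p, E i u}"
proof
  fix x assume "x \<in> E i ` {0..u} \<inter> E i ` {v..1}"
  then obtain a b where ab: "0 \<le> a" "a \<le> u" "v \<le> b" "b \<le> 1" "x = E i a" "E i a = E i b"
    by auto
  show "x \<in> {p, E i u}"
  proof (cases "0 < a \<and> a < 1")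
    case True
    then have "a = b"
      using E_eq_interior[of i i a b] ab assms by simp
    then have "a = u"
      using ab assms(3) by linarith
    then show ?thesis
      using ab by simp
  next
    case False
    then show ?thesis
      using ab assms E_eq_p[of i a] by auto
  qed
qed

text \<open>This reduces intervals to connected sets: the infimum defining the graph distance may be
  tested on connected measurable sets, which, unlike arcs, can be united freely at a common
  point.\<close>

lemma connected_contains_interval:
  assumes "connected I" "I \<subseteq> X" "x \<in> I" "y \<in> I"
  shows "\<exists>J\<subseteq>I. interval_between X x y J"
proof -
  have to_p: "\<exists>J\<subseteq>I. J \<subseteq> E i ` {0..1} \<and> interval_between X (E i u) p J"
    if "i < n" "0 < u" "u < 1" "E i u \<in> I" "z \<in> I" "z \<notin> E i ` {0<..<1}" for i u z
  proof -
    have "E i ` {0..u} \<subseteq> I \<or> E i ` {u..1} \<subseteq> I"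
      using connected_escapes[OF assms(1,2) that(1) _ _ that(4-6)] that by simp
    moreover have "E i ` {0..u} \<subseteq> E i ` {0..1}" "E i ` {u..1} \<subseteq> E i ` {0..1}"
      using that by auto
    ultimately show ?thesis
      using interval_to_p[OF that(1-3)] by blast
  qed
  have ordered: "\<exists>J\<subseteq>I. interval_between X (E i u) (E i v) J"
    if h: "i < n" "0 < u" "u < v" "v < 1" "E i u \<in> I" "E i v \<in> I" for i u v
  proof -
    have "E i ` {u..v} \<subseteq> I \<or> E i ` {0..u} \<subseteq> I \<and> E i ` {v..1} \<subseteq> I"
      using connected_between[OF assms(1,2) h(1) _ h(3) _ h(5,6)] h by simp
    then show ?thesis
    proof (elim disjE conjE)
      assume "E i ` {u..v} \<subseteq> I"
      moreover have "interval_between X (E i u) (E i v) (E i ` {u..v})"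
        using h arc_subset[of i u v] by (intro arc_interval_between) auto
      ultimately show ?thesis by blast
    next
      assume *: "E i ` {0..u} \<subseteq> I" "E i ` {v..1} \<subseteq> I"
      have "E i u \<notin> E i ` {v..1}"
      proof
        assume "E i u \<in> E i ` {v..1}"
        then obtain w where "v \<le> w" "w \<le> 1" "E i u = E i w" by auto
        then show False
          using E_eq_interior[of i i u w] h by simp
      qed
      then have "E i ` {0..u} \<inter> E i ` {v..1} \<subseteq> {p}"
        using arcs_meet[of i u v] h by auto
      then have "interval_between X (E i u) (E i v) (E i ` {0..u} \<union> E i ` {v..1})"
        using h interval_to_p(1)[of i u] interval_sym[OF interval_to_p(2)[of i v]]
        by (intro interval_join) auto
      then show ?thesis
        using * by (intro exI[of _ "E i ` {0..u} \<union> E i ` {v..1}"]) simp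
    qed
  qed
  have "x \<in> X" "y \<in> X"
    using assms by auto
  show ?thesis
  proof (rule point_cases[OF \<open>x \<in> X\<close>])
    assume x: "x = p"
    show ?thesis
    proof (rule point_cases[OF \<open>y \<in> X\<close>])
      assume "y = p"
      then show ?thesis
        using x assms \<open>x \<in> X\<close> by (intro exI[of _ "{p}"]) (auto simp: interval_between_def)
    next
      fix j v assume y: "j < n" "0 < v" "v < 1" "y = E j v"
      have "E j v \<in> I" "p \<in> I"
        using assms x y by simp_all
      from to_p[OF y(1-3) this E_p[OF y(1)]]
      obtain J where J: "J \<subseteq> I" "interval_between X (E j v) p J"
        by blast
      show ?thesis
        using J(1) interval_sym[OF J(2)] x y by auto
    qed
  next
    fix i u assume x: "i < n" "0 < u" "u < 1" "x = E i u"
    show ?thesis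
    proof (rule point_cases[OF \<open>y \<in> X\<close>])
      assume "y = p"
      then have "E i u \<in> I" "p \<in> I"
        using assms x by simp_all
      from to_p[OF x(1-3) this E_p[OF x(1)]] show ?thesis
        using x \<open>y = p\<close> by auto
    next
      fix j v assume y: "j < n" "0 < v" "v < 1" "y = E j v"
      show ?thesis
      proof (cases "i = j")
        case False
        have "x \<in> E i ` {0<..<1}" "y \<in> E j ` {0<..<1}"
          using x y by simp_all
        then have ni: "y \<notin> E i ` {0<..<1}" "x \<notin> E j ` {0<..<1}"
          using E_disjoint[OF x(1) y(1) False] by blast+
        have I: "E i u \<in> I" "E j v \<in> I"
          using assms x y by simp_all
        obtain J where J: "J \<subseteq> I" "J \<subseteq> E i ` {0..1}" "interval_between X x p J"
          using to_p[OF x(1-3) I(1) assms(4) ni(1)] x(4) by blast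
        obtain K where K: "K \<subseteq> I" "K \<subseteq> E j ` {0..1}" "interval_between X y p K"
          using to_p[OF y(1-3) I(2) assms(3) ni(2)] y(4) by blast
        have "J \<inter> K \<subseteq> {p}"
          using J K edges_meet[OF x(1) y(1) False] by blast
        then have "interval_between X x y (J \<union> K)"
          using J(3) interval_sym[OF K(3)] by (intro interval_join)
        then show ?thesis
          using J(1) K(1) by (intro exI[of _ "J \<union> K"]) simp
      next
        case True
        then consider "u < v" | "v < u" | "x = y"
          using x y by fastforce
        then show ?thesis
        proof cases
          case 1
          then show ?thesis
            using ordered[of i u v] x y True assms by auto
        next
          case 2
          then obtain J where J: "J \<subseteq> I" "interval_between X y x J"
            using ordered[of i v u] x y True assms by auto
          show ?thesis
            using J(1) interval_sym[OF J(2)] by blast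
        next
          case 3
          then show ?thesis
            using assms \<open>x \<in> X\<close> by (intro exI[of _ "{x}"]) (auto simp: interval_between_def)
        qed
      qed
    qed
  qed
qed

lemma connected_X: "connected X"
proof -
  have p: "p \<in> E i ` {0..1}" if "i < n" for i
    using E_0[OF that] by (metis atLeastAtMost_iff image_eqI order_refl zero_le_one)
  then have "p \<in> (\<Union>i<n. E i ` {0..1})"
    using n_pos by blast
  then have "X = (\<Union>i<n. E i ` {0..1})"
    using X_eq by (simp add: insert_absorb)
  moreover have "connected (\<Union>i<n. E i ` {0..1})"
  proof (rule connected_Union)
    show "connected S" if "S \<in> (\<lambda>i. E i ` {0..1}) ` {..<n}" for S
      using that connected_continuous_image[OF E_path connected_Icc] by blast
    show "\<Inter>((\<lambda>i. E i ` {0..1}) ` {..<n}) \<noteq> {}"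
      using p by blast
  qed
  ultimately show ?thesis by simp
qed

section \<open>The graph distance as least mass of a connected set\<close>

abbreviation "gd \<equiv> graph_dist X \<mu>"

lemma gd_le:
  assumes "connected I" "I \<subseteq> X" "I \<in> sets \<mu>" "x \<in> I" "y \<in> I"
  shows "gd x y \<le> measure \<mu> I"
proof -
  obtain J where J: "J \<subseteq> I" "interval_between X x y J"
    using connected_contains_interval assms by blast
  have "gd x y \<le> measure \<mu> J"
    unfolding graph_dist_def using J by (intro cINF_lower bdd_belowI2[of _ 0]) auto
  also have "\<dots> \<le> measure \<mu> I"
    using J assms by (intro finite_measure_mono)
  finally show ?thesis .
qed

lemma gd_ge:
  assumes "x \<in> X" "y \<in> X"
    and "\<And>I. \<lbrakk>connected I; I \<subseteq> X; I \<in> sets \<mu>; x \<in> I; y \<in> I\<rbrakk> \<Longrightarrow> c \<le> measure \<mu> I"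
  shows "c \<le> gd x y"
  unfolding graph_dist_def
proof (rule cINF_greatest)
  show "{I. interval_between X x y I} \<noteq> {}"
    using connected_contains_interval[OF connected_X order_refl assms(1,2)] by blast
  show "c \<le> measure \<mu> I" if "I \<in> {I. interval_between X x y I}" for I
    using interval_ends[of X x y I] that closed_sets by (intro assms(3)) auto
qed

lemma gd_nonneg: "\<lbrakk>x \<in> X; y \<in> X\<rbrakk> \<Longrightarrow> 0 \<le> gd x y"
  by (rule gd_ge) auto

lemma gd_sym: "gd x y = gd y x"
proof -
  have "{I. interval_between X x y I} = {I. interval_between X y x I}"
    using interval_sym by blast
  then show ?thesis
    by (simp add: graph_dist_def)
qed

text \<open>Two connected sets that share \<open>y\<close> have a connected union, of at most the
  sum of the measures; no arc from \<open>x\<close> to \<open>z\<close> has to be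
  constructed.\<close>

lemma gd_triangle:
  assumes "x \<in> X" "y \<in> X" "z \<in> X"
  shows "gd x z \<le> gd x y + gd y z"
proof -
  have "gd x z - gd y z \<le> gd x y"
  proof (rule gd_ge)
    fix I assume I: "connected I" "I \<subseteq> X" "I \<in> sets \<mu>" "x \<in> I" "y \<in> I"
    have "gd x z - measure \<mu> I \<le> gd y z"
    proof (rule gd_ge)
      fix J assume J: "connected J" "J \<subseteq> X" "J \<in> sets \<mu>" "y \<in> J" "z \<in> J"
      have "gd x z \<le> measure \<mu> (I \<union> J)"
        using I J by (intro gd_le connected_Un) auto
      also have "\<dots> \<le> measure \<mu> I + measure \<mu> J"
        using I J by (intro measure_Un_le)
      finally show "gd x z - measure \<mu> I \<le> measure \<mu> J"
        by simp
    qed (use assms in auto)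
    then show "gd x z - gd y z \<le> measure \<mu> I"
      by simp
  qed (use assms in auto)
  then show ?thesis
    by simp
qed

text \<open>The direct arc and the complementary way through \<open>p\<close> are the two
  competitors. By \<open>connected_between\<close> every connected set containing both points
  includes one of them.\<close>

lemma gd_same_edge:
  assumes i: "i < n" and uv: "0 \<le> u" "u \<le> v" "v \<le> 1"
  shows "gd (E i u) (E i v) = min (mass i v - mass i u) (len i - (mass i v - mass i u))"
proof (cases "u = v")
  case True
  have "gd (E i u) (E i u) \<le> measure \<mu> {E i u}"
    using assms by (intro gd_le closed_sets) (auto intro: E_in)
  then have "gd (E i u) (E i u) = 0"
    using gd_nonneg[of "E i u" "E i u"] measure_point[of "E i u"] E_in[of i u] assms by simp
  then show ?thesis
    using True len_pos[OF i] by simp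
next
  case False
  let ?R = "E i ` {0..u} \<union> E i ` {v..1}"
  have mR: "measure \<mu> ?R = len i - (mass i v - mass i u)"
  proof -
    have "measure \<mu> ?R = measure \<mu> (E i ` {0..u}) + measure \<mu> (E i ` {v..1})"
      using arcs_meet[of i u v] assms False by (intro measure_Un_overlap arc_sets) auto
    then show ?thesis
      using measure_arc[of i 0 u] measure_arc[of i v 1] assms by (simp add: mass_0)
  qed
  have sR: "?R \<in> sets \<mu>"
    using assms by (intro sets.Un arc_sets) auto
  have "gd (E i u) (E i v) \<le> measure \<mu> (E i ` {u..v})"
    using assms arc_subset[of i u v] E_cont[of i u v]
    by (intro gd_le arc_sets connected_continuous_image) auto
  moreover have "gd (E i u) (E i v) \<le> measure \<mu> ?R"
  proof (rule gd_le)
    have "p \<in> E i ` {0..u}" "p \<in> E i ` {v..1}"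
      using assms E_0[OF i] E_1[OF i] by (auto intro: image_eqI[of _ _ 0] image_eqI[of _ _ 1])
    then show "connected ?R"
      using assms E_cont[of i 0 u] E_cont[of i v 1]
      by (intro connected_Un connected_continuous_image) auto
    show "?R \<subseteq> X"
      using assms arc_subset[of i 0 u] arc_subset[of i v 1] by simp
  qed (use assms sR in auto)
  moreover have "min (mass i v - mass i u) (len i - (mass i v - mass i u)) \<le> gd (E i u) (E i v)"
  proof (rule gd_ge)
    fix I assume I: "connected I" "I \<subseteq> X" "I \<in> sets \<mu>" "E i u \<in> I" "E i v \<in> I"
    then have "E i ` {u..v} \<subseteq> I \<or> ?R \<subseteq> I"
      using connected_between[of I i u v] assms False by auto
    then have "measure \<mu> (E i ` {u..v}) \<le> measure \<mu> I \<or> measure \<mu> ?R \<le> measure \<mu> I"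
      using I finite_measure_mono by blast
    then show "min (mass i v - mass i u) (len i - (mass i v - mass i u)) \<le> measure \<mu> I"
      using mR measure_arc[OF i uv] by auto
  qed (use assms in \<open>auto intro: E_in\<close>)
  ultimately show ?thesis
    using mR measure_arc[OF i uv] by simp
qed

lemma gd_to_p:
  assumes "i < n" "0 \<le> u" "u \<le> 1"
  shows "gd (E i u) p = min (mass i u) (len i - mass i u)"
  using gd_same_edge[of i 0 u] assms gd_sym by (simp add: mass_0 E_0)

text \<open>A connected set containing both points must include, in each of the two edges, an arc
  from the point to \<open>p\<close>. These arcs meet at most in \<open>p\<close>, so their measures
  add up; the upper bound is the triangle inequality through \<open>p\<close>.\<close>

lemma gd_other_edge:
  assumes i: "i < n" "0 \<le> u" "u \<le> 1" and j: "j < n" "0 \<le> v" "v \<le> 1" and ne: "i \<noteq> j"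
  shows "gd (E i u) (E j v) = min (mass i u) (len i - mass i u) + min (mass j v) (len j - mass j v)"
proof (rule antisym)
  show "gd (E i u) (E j v) \<le> min (mass i u) (len i - mass i u) + min (mass j v) (len j - mass j v)"
    using gd_triangle[of "E i u" p "E j v"] gd_to_p[OF i] gd_to_p[OF j] gd_sym[of p] E_in p_in assms by simp
  show "min (mass i u) (len i - mass i u) + min (mass j v) (len j - mass j v) \<le> gd (E i u) (E j v)"
  proof (rule gd_ge)
    fix I assume I: "connected I" "I \<subseteq> X" "I \<in> sets \<mu>" "E i u \<in> I" "E j v \<in> I"
    have ni: "E j v \<notin> E i ` {0<..<1}" "E i u \<notin> E j ` {0<..<1}"
      using E_eq_interior[of i j _ v] E_eq_interior[of j i _ u] i j ne by force+
    have *: "\<exists>R\<subseteq>I. R \<in> sets \<mu> \<and> R \<subseteq> E k ` {0..1} \<and> min (mass k w) (len k - mass k w) \<le> measure \<mu> R"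
      if k: "k < n" "0 \<le> w" "w \<le> 1" "E k w \<in> I" "z \<in> I" "z \<notin> E k ` {0<..<1}" for k w z
    proof -
      have "E k ` {0..w} \<subseteq> I \<or> E k ` {w..1} \<subseteq> I"
        using connected_escapes[OF I(1,2) k] .
      moreover have "E k ` {0..w} \<in> sets \<mu>" "E k ` {w..1} \<in> sets \<mu>"
        using k by (auto intro: arc_sets)
      moreover have "E k ` {0..w} \<subseteq> E k ` {0..1}" "E k ` {w..1} \<subseteq> E k ` {0..1}"
        using k by auto
      moreover have "measure \<mu> (E k ` {0..w}) = mass k w" "measure \<mu> (E k ` {w..1}) = len k - mass k w"
        using measure_arc[of k 0 w] measure_arc[of k w 1] k by (simp_all add: mass_0)
      ultimately show ?thesis
        by (metis min.cobounded1 min.cobounded2)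
    qed
    obtain R S where R: "R \<subseteq> I" "R \<in> sets \<mu>" "R \<subseteq> E i ` {0..1}" "min (mass i u) (len i - mass i u) \<le> measure \<mu> R"
      and S: "S \<subseteq> I" "S \<in> sets \<mu>" "S \<subseteq> E j ` {0..1}" "min (mass j v) (len j - mass j v) \<le> measure \<mu> S"
      using *[OF i I(4,5) ni(1)] *[OF j I(5,4) ni(2)] by blast
    have "measure \<mu> R + measure \<mu> S = measure \<mu> (R \<union> S)"
      using R S edges_meet[OF i(1) j(1) ne] by (intro measure_Un_overlap[symmetric, of _ _ "{p}"]) auto
    also have "\<dots> \<le> measure \<mu> I"
      using R S I by (intro finite_measure_mono) auto
    finally show "min (mass i u) (len i - mass i u) + min (mass j v) (len j - mass j v) \<le> measure \<mu> I"
      using R S by linarith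
  qed (use assms in \<open>auto intro: E_in\<close>)
qed

text \<open>Full support is the point: the distance formulas are positive for distinct points only
  because \<open>mass\<close> is strictly increasing.\<close>

lemma gd_eq_0:
  assumes "x \<in> X" "y \<in> X"
  shows "gd x y = 0 \<longleftrightarrow> x = y"
proof
  assume "x = y"
  then show "gd x y = 0"
    using gd_le[of "{x}" x x] gd_nonneg[of x x] measure_point[of x] closed_sets[of "{x}"] assms by simp
next
  have pos: "0 < mass i u" "mass i u < len i" if "i < n" "0 < u" "u < 1" for i u
    using full_support[of i 0 u] full_support[of i u 1] that by (auto simp: mass_0)
  have ordered: "u = v" if "i < n" "0 < u" "u \<le> v" "v < 1" "gd (E i u) (E i v) = 0" for i u v
    using gd_same_edge[of i u v] full_support[of i u v] pos[of i u] pos[of i v] that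
    by (cases "u = v") (auto simp: min_def split: if_splits)
  assume 0: "gd x y = 0"
  show "x = y"
  proof (rule point_cases[OF assms(1)]; rule point_cases[OF assms(2)])
    fix i u assume x: "x = p" and y: "i < n" "0 < u" "u < 1" "y = E i u"
    then show ?thesis
      using gd_to_p[of i u] pos[of i u] 0 gd_sym[of x y] by (auto simp: min_def split: if_splits)
  next
    fix i u assume y: "y = p" and x: "i < n" "0 < u" "u < 1" "x = E i u"
    then show ?thesis
      using gd_to_p[of i u] pos[of i u] 0 by (auto simp: min_def split: if_splits)
  next
    fix i u j v assume x: "i < n" "0 < u" "u < 1" "x = E i u" and y: "j < n" "0 < v" "v < 1" "y = E j v"
    show ?thesis
    proof (cases "i = j")
      case True
      then show ?thesis
        using ordered[of i u v] ordered[of i v u] x y 0 gd_sym[of x y] by (cases "u \<le> v") auto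
    next
      case False
      then show ?thesis
        using gd_other_edge[of i u j v] pos[of i u] pos[of j v] x y 0 by (auto simp: min_def split: if_splits)
    qed
  qed simp
qed

section \<open>Parametrisation of the edges by arc length\<close>

definition A :: "nat \<Rightarrow> real \<Rightarrow> 'a" where
  "A i r = E i (the_inv_into {0..1} (mass i) r)"

lemma mass_inj: "i < n \<Longrightarrow> inj_on (mass i) {0..1}"
  by (rule linorder_inj_onI) (use full_support in force)+

lemma A_mass: "\<lbrakk>i < n; 0 \<le> u; u \<le> 1\<rbrakk> \<Longrightarrow> A i (mass i u) = E i u"
  unfolding A_def using mass_inj by (simp add: the_inv_into_f_f)

lemma mass_surj:
  assumes "i < n" "0 \<le> r" "r \<le> len i"
  obtains u where "0 \<le> u" "u \<le> 1" "mass i u = r"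
  using IVT'[of "mass i" 0 r 1] continuous_mass assms by (auto simp: mass_0)

lemma A_interior:
  assumes "i < n" "0 < r" "r < len i"
  obtains u where "0 < u" "u < 1" "mass i u = r" "A i r = E i u"
proof -
  obtain u where u: "0 \<le> u" "u \<le> 1" "mass i u = r"
    using mass_surj[of i r] assms by auto
  moreover have "u \<noteq> 0" "u \<noteq> 1"
    using u assms by (auto simp: mass_0)
  ultimately show ?thesis
    using that[of u] A_mass[of i u] assms by (auto simp: less_le)
qed

lemma A_same:
  assumes "i < n" "0 \<le> r" "r \<le> len i" "0 \<le> s" "s \<le> len i"
  shows "gd (A i r) (A i s) = min \<bar>r - s\<bar> (len i - \<bar>r - s\<bar>)"
proof -
  obtain u where u: "0 \<le> u" "u \<le> 1" "mass i u = r"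
    using mass_surj assms by metis
  obtain v where v: "0 \<le> v" "v \<le> 1" "mass i v = s"
    using mass_surj assms by metis
  show ?thesis
  proof (cases "u \<le> v")
    case True
    then show ?thesis
      using u v gd_same_edge[of i u v] mass_mono[of i u v] A_mass[of i] assms(1) by auto
  next
    case False
    then show ?thesis
      using u v gd_same_edge[of i v u] mass_mono[of i v u] A_mass[of i] assms(1) gd_sym[of "E i u"] by auto
  qed
qed

lemma A_other:
  assumes "i < n" "0 \<le> r" "r \<le> len i" "j < n" "0 \<le> s" "s \<le> len j" "i \<noteq> j"
  shows "gd (A i r) (A j s) = min r (len i - r) + min s (len j - s)"
proof -
  obtain u where u: "0 \<le> u" "u \<le> 1" "mass i u = r"
    using mass_surj assms by metis
  obtain v where v: "0 \<le> v" "v \<le> 1" "mass j v = s"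
    using mass_surj assms by metis
  show ?thesis
    using u v gd_other_edge[of i u j v] A_mass[of i u] A_mass[of j v] assms by auto
qed

text \<open>In arc length a run becomes affine with slope \<open>lam\<close>, which is the content
  of \<open>scaling\<close>; \<epsilon> is the mass of the arc traversed by the run.\<close>

lemma A_right:
  assumes "i < n" "0 \<le> s" "s < 1" "b \<le> 1" "runs (fE i) j h s b"
  shows "\<exists>\<epsilon>>0. mass i s + \<epsilon> \<le> len i \<and> j < n \<and> 0 \<le> mass j (h s) \<and> mass j (h s) + lam * \<epsilon> \<le> len j \<and>
    (\<forall>t. 0 \<le> t \<and> t \<le> \<epsilon> \<longrightarrow> f (A i (mass i s + t)) = A j (mass j (h s) + lam * t))"
proof -
  have j: "j < n" "s < b"
    using assms(5) by (auto simp: runs_def)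
  define \<epsilon> where "\<epsilon> = mass i b - mass i s"
  have sc: "mass j (h u) = mass j (h s) + lam * (mass i u - mass i s)" if "s \<le> u" "u \<le> b" for u
    using scaling[OF assms(1,2,4,5), of s u] that j by simp
  have hb: "0 \<le> h u \<and> h u \<le> 1" if "s \<le> u" "u \<le> b" for u
    using runs_bounds[OF assms(5)] that by blast
  show ?thesis
  proof (intro exI[of _ \<epsilon>] conjI allI impI)
    show "0 < \<epsilon>"
      unfolding \<epsilon>_def using full_support[of i s b] assms j by simp
    show "mass i s + \<epsilon> \<le> len i"
      unfolding \<epsilon>_def using mass_bounds[of i b] assms j by simp
    show "0 \<le> mass j (h s)"
      using mass_bounds[of j "h s"] hb[of s] j by simp
    show "mass j (h s) + lam * \<epsilon> \<le> len j"
      using sc[of b] mass_bounds[of j "h b"] hb[of b] j by (simp add: \<epsilon>_def)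
    fix t assume t: "0 \<le> t \<and> t \<le> \<epsilon>"
    obtain u where u: "s \<le> u" "u \<le> b" "mass i u = mass i s + t"
      using IVT'[of "mass i" s "mass i s + t" b] t j assms continuous_on_subset[OF continuous_mass[OF assms(1)], of "{s..b}"]
      by (auto simp: \<epsilon>_def)
    have "A i (mass i s + t) = E i u"
      using A_mass[of i u] u assms by simp
    moreover have "A j (mass j (h s) + lam * t) = E j (h u)"
      using A_mass[of j "h u"] sc[of u] hb[of u] u j by simp
    ultimately show "f (A i (mass i s + t)) = A j (mass j (h s) + lam * t)"
      using runs_eq[OF assms(5), of u] u by simp
  qed (use j in simp)
qed

lemma A_left:
  assumes "i < n" "0 \<le> a" "s \<le> 1" "runs (fE i) j h a s"
  shows "\<exists>\<epsilon>>0. \<epsilon> \<le> mass i s \<and> j < n \<and> mass j (h s) \<le> len j \<and> lam * \<epsilon> \<le> mass j (h s) \<and>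
    (\<forall>t. 0 \<le> t \<and> t \<le> \<epsilon> \<longrightarrow> f (A i (mass i s - t)) = A j (mass j (h s) - lam * t))"
proof -
  have j: "j < n" "a < s"
    using assms(4) by (auto simp: runs_def)
  define \<epsilon> where "\<epsilon> = mass i s - mass i a"
  have sc: "mass j (h u) = mass j (h s) - lam * (mass i s - mass i u)" if "a \<le> u" "u \<le> s" for u
    using scaling[OF assms, of u s] that j by simp
  have hb: "0 \<le> h u \<and> h u \<le> 1" if "a \<le> u" "u \<le> s" for u
    using runs_bounds[OF assms(4)] that by blast
  show ?thesis
  proof (intro exI[of _ \<epsilon>] conjI allI impI)
    show "0 < \<epsilon>"
      unfolding \<epsilon>_def using full_support[of i a s] assms j by simp
    show "\<epsilon> \<le> mass i s"
      unfolding \<epsilon>_def using mass_bounds[of i a] assms j by simp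
    show "mass j (h s) \<le> len j"
      using mass_bounds[of j "h s"] hb[of s] j by simp
    show "lam * \<epsilon> \<le> mass j (h s)"
      using sc[of a] mass_bounds[of j "h a"] hb[of a] j by (simp add: \<epsilon>_def)
    fix t assume t: "0 \<le> t \<and> t \<le> \<epsilon>"
    obtain u where u: "a \<le> u" "u \<le> s" "mass i u = mass i s - t"
      using IVT'[of "mass i" a "mass i s - t" s] t j assms continuous_on_subset[OF continuous_mass[OF assms(1)], of "{a..s}"]
      by (auto simp: \<epsilon>_def)
    have "A i (mass i s - t) = E i u"
      using A_mass[of i u] u assms by simp
    moreover have "A j (mass j (h s) - lam * t) = E j (h u)"
      using A_mass[of j "h u"] sc[of u] hb[of u] u j by simp
    ultimately show "f (A i (mass i s - t)) = A j (mass j (h s) - lam * t)"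
      using runs_eq[OF assms(4), of u] u by simp
  qed (use j in simp)
qed

section \<open>The Smale space\<close>

text \<open>Outside \<open>X\<close> the graph distance is an infimum over no intervals; the value 0
  there supplies the symmetry and nonnegativity that \<open>Metric_space\<close> demands on the
  whole type.\<close>

definition gdist :: "'a \<Rightarrow> 'a \<Rightarrow> real" where
  "gdist x y = (if x \<in> X \<and> y \<in> X then graph_dist X \<mu> x y else 0)"

lemma gdist_eq: "\<lbrakk>x \<in> X; y \<in> X\<rbrakk> \<Longrightarrow> gdist x y = graph_dist X \<mu> x y"
  by (simp add: gdist_def)

lemma Metric_gdist: "Metric_space X gdist"
  by standard (auto simp: gdist_def gd_nonneg gd_sym gd_eq_0 gd_triangle)

lemma A_in_X: "\<lbrakk>i < n; 0 \<le> r; r \<le> len i\<rbrakk> \<Longrightarrow> A i r \<in> X"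
  using mass_surj[of i r] A_mass[of i] E_in[of i] by metis

lemma A_start: "i < n \<Longrightarrow> A i 0 = p"
  using A_mass[of i 0] by (simp add: mass_0 E_0)

lemma A_end: "i < n \<Longrightarrow> A i (len i) = p"
  using A_mass[of i 1] by (simp add: E_1)

lemma A_covers:
  assumes "x \<in> X"
  shows "\<exists>i r. i < n \<and> 0 \<le> r \<and> r \<le> len i \<and> x = A i r"
proof (rule point_cases[OF assms])
  assume "x = p"
  then show ?thesis
    using n_pos A_start[of 0] len_pos[of 0] by (intro exI[of _ 0]) auto
next
  fix i u assume *: "i < n" "0 < u" "u < 1" "x = E i u"
  then show ?thesis
    using A_mass[of i u] mass_bounds[of i u] by (intro exI[of _ i] exI[of _ "mass i u"]) auto
qed

lemma right_A:
  assumes "i < n" "0 < r" "r < len i"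
  shows "\<exists>\<epsilon> j q. \<epsilon> > 0 \<and> r + \<epsilon> \<le> len i \<and> j < n \<and> 0 \<le> q \<and>
    q + lam * \<epsilon> \<le> len j \<and> (\<forall>t. 0 \<le> t \<and> t \<le> \<epsilon> \<longrightarrow> f (A i (r + t)) = A j (q + lam * t))"
proof -
  obtain s where s: "0 < s" "s < 1" "mass i s = r"
    using A_interior[OF assms] by metis
  obtain b j h where b: "b \<le> 1" "runs (fE i) j h s b"
    using right_run[of i s] assms(1) s by auto
  show ?thesis
    using A_right[OF assms(1) less_imp_le[OF s(1)] s(2) b] unfolding s(3) by blast
qed

lemma left_A:
  assumes "i < n" "0 < r" "r < len i"
  shows "\<exists>\<epsilon> j q. \<epsilon> > 0 \<and> \<epsilon> \<le> r \<and> j < n \<and> q \<le> len j \<and>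
    lam * \<epsilon> \<le> q \<and> (\<forall>t. 0 \<le> t \<and> t \<le> \<epsilon> \<longrightarrow> f (A i (r - t)) = A j (q - lam * t))"
proof -
  obtain s where s: "0 < s" "s < 1" "mass i s = r"
    using A_interior[OF assms] by metis
  obtain a j h where a: "0 \<le> a" "runs (fE i) j h a s"
    using left_run[of i s] assms(1) s by auto
  show ?thesis
    using A_left[OF assms(1) a(1) less_imp_le[OF s(2)] a(2)] unfolding s(3) by blast
qed

lemma right_A_p:
  assumes "out i a"
  shows "\<exists>\<epsilon>>0. \<forall>t. 0 \<le> t \<and> t \<le> \<epsilon> \<longrightarrow> f (A i t) = A a (lam * t)"
proof -
  obtain b h where b: "b \<le> 1" "runs (fE i) a h 0 b" and i: "i < n" "a < n"
    using assms by (auto simp: out_def runs_def)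
  have "h 0 = 0"
    using runs_start[OF b(2)] i by (simp add: E_0 f_p)
  then show ?thesis
    using A_right[OF i(1) order_refl zero_less_one b] i by (metis add_0 mass_0)
qed

lemma left_A_p:
  assumes "inn i b"
  shows "\<exists>\<epsilon>>0. \<forall>t. 0 \<le> t \<and> t \<le> \<epsilon> \<longrightarrow> f (A i (len i - t)) = A b (len b - lam * t)"
proof -
  obtain a h where a: "0 \<le> a" "runs (fE i) b h a 1" and i: "i < n" "b < n"
    using assms by (auto simp: inn_def runs_def)
  have "h 1 = 1"
    using runs_end[OF a(2)] i by (simp add: E_1 f_p)
  then show ?thesis
    using A_left[OF i(1) a(1) order_refl a(2)] i by metis
qed

lemma metric_wedge_arc_length: "\<exists>a b. metric_wedge X gdist p n A len f lam a b"
proof -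
  obtain a b where a: "out 0 a" and b: "inn 0 b"
    using out_ex inn_ex n_pos by blast
  have "out i a" "inn i b" if "i < n" for i
    using out_ex[OF that] inn_ex[OF that] out_unique[OF _ a] inn_unique[OF _ b] by blast+
  moreover have "a < n" "b < n"
    using a b by (auto simp: out_def inn_def runs_def)
  ultimately have "metric_wedge X gdist p n A len f lam a b"
    using lam Metric_gdist
    by (intro metric_wedge.intro metric_wedge_axioms.intro len_pos A_in_X A_start A_end A_covers
        f_in right_A left_A right_A_p left_A_p) (simp_all add: gdist_eq A_in_X A_same A_other)
  then show ?thesis by blast
qed

lemma solenoid_smale: "smale_space (solenoid_space X f) (solenoid_dist X f lam \<mu>) (solenoid_map f)"
proof -
  obtain a b where "metric_wedge X gdist p n A len f lam a b"
    using metric_wedge_arc_length by blast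
  then interpret M: metric_wedge X gdist p n A len f lam a b .
  obtain r where "displacement_system X gdist f lam M.disp r"
    using M.displacement by blast
  then interpret S: displacement_system X gdist f lam M.disp r .
  have "S.sdist x y = solenoid_dist X f lam \<mu> x y" for x y
    unfolding S.sdist_def solenoid_dist_def by (simp add: S.Y_in gdist_eq)
  then have "S.sdist = solenoid_dist X f lam \<mu>"
    by (simp add: fun_eq_iff)
  then show ?thesis
    using S.smale_space by simp
qed

end

section \<open>Redirecting the edges\<close>

lemma redirect_image:
  "redirect \<sigma> e i ` {0<..<1} = open_edge e i" "redirect \<sigma> e i ` {0..1} = path_image (e i)"
proof -
  have 1: "(\<lambda>u. 1 - u) ` {0<..<1} = {0<..<(1::real)}"
  proof
    show "{0<..<1} \<subseteq> (\<lambda>u. 1 - u) ` {0<..<(1::real)}"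
      by (rule subsetI, rule_tac x = "1 - x" in image_eqI) auto
  qed auto
  have 2: "(\<lambda>u. 1 - u) ` {0..1} = {0..(1::real)}"
    by simp
  have "reversepath (e i) ` S = e i ` (\<lambda>u. 1 - u) ` S" for S
    by (simp add: reversepath_def image_image)
  then show "redirect \<sigma> e i ` {0<..<1} = open_edge e i" "redirect \<sigma> e i ` {0..1} = path_image (e i)"
    by (simp_all add: redirect_def open_edge_def path_image_def 1 2 del: image_diff_atLeastAtMost)
qed

lemma redirect_interval:
  "redirect \<sigma> e i ` {s..t} = (if \<sigma> i then e i ` {s..t} else e i ` {1-t..1-s})"
proof -
  have "(\<lambda>u. 1 - u) ` {s..t} = {1-t..1-s}"
    by simp
  then show ?thesis
    by (simp add: redirect_def reversepath_def flip: image_image)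
qed

text \<open>Expansion speaks only of images of parameter intervals, and reversing an edge replaces
  \<open>{s..t}\<close> by \<open>{1-t..1-s}\<close> without changing the sets that arise.\<close>

lemma expansion_redirect:
  assumes "expansion X n e f"
  shows "expansion X n (redirect \<sigma> e) f"
proof -
  from assms[unfolded expansion_def]
  obtain d' C lam' where d': "Metric_space X d'" "Metric_space.mtopology X d' = top_of_set X"
    and C: "C > 0" "lam' > 1"
    and ex: "\<forall>m>0. \<forall>i<n. \<forall>j<n. \<forall>s t. 0 < s \<and> s \<le> t \<and> t < 1 \<and>
      (f ^^ m) ` (e i ` {s..t}) \<subseteq> open_edge e j \<longrightarrow>
      diam_wrt d' ((f ^^ m) ` (e i ` {s..t})) \<ge> C * lam' ^ m * diam_wrt d' (e i ` {s..t})"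
    by (elim exE conjE) (rule that)
  have "diam_wrt d' ((f ^^ m) ` (redirect \<sigma> e i ` {s..t})) \<ge> C * lam' ^ m * diam_wrt d' (redirect \<sigma> e i ` {s..t})"
    if "m > 0" "i < n" "j < n" "0 < s \<and> s \<le> t \<and> t < 1 \<and>
      (f ^^ m) ` (redirect \<sigma> e i ` {s..t}) \<subseteq> open_edge (redirect \<sigma> e) j" for m i j s t
  proof -
    have "open_edge (redirect \<sigma> e) j = open_edge e j"
      using redirect_image(1) by (simp add: open_edge_def)
    then show ?thesis
      using ex[rule_format, OF that(1-3), of s t] ex[rule_format, OF that(1-3), of "1 - t" "1 - s"] that(4)
      by (simp add: redirect_interval split: if_splits)
  qed
  then show ?thesis
    unfolding expansion_def using d' C by blast
qed

theorem proposition3p3: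
  fixes X V :: "'a::t2_space set" and n :: nat and e :: "nat \<Rightarrow> real \<Rightarrow> 'a"
    and f :: "'a \<Rightarrow> 'a" and lam :: real and \<mu>\<^sub>0 :: "'a measure"
  assumes "elementary_presentation X V n e f"
    and "orientable n e f"
    and "one_step_flat X f"
    and "lam > 1" and "stretched_measure X f lam \<mu>\<^sub>0"
  shows "smale_space (solenoid_space X f) (solenoid_dist X f lam \<mu>\<^sub>0) (solenoid_map f)"
proof -
  obtain p where V: "V = {p}" "f p = p" and pres: "presentation X V n e f"
    using assms(1) unfolding elementary_presentation_def by blast
  have graph: "finite_digraph X V n e" and f: "continuous_on X f" "f ` X \<subseteq> X"
    and nw: "all_nonwandering X f" and ex: "expansion X n e f"
    using pres unfolding presentation_def by blast+
  obtain \<sigma> where \<sigma>: "\<And>\<gamma>. positively_directed n (redirect \<sigma> e) \<gamma> \<Longrightarrow> positively_directed n (redirect \<sigma> e) (f \<circ> \<gamma>)"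
    using assms(2) unfolding orientable_def by blast
  define E where "E = redirect \<sigma> e"
  have e: "path (e i)" "e i 0 = p" "e i 1 = p" "inj_on (e i) {0<..<1}" "p \<notin> open_edge e i" if "i < n" for i
    using graph that unfolding finite_digraph_def V by (auto simp: pathstart_def pathfinish_def)
  have wedge: "wedge_of_circles X p n E"
  proof
    fix i assume i: "i < n"
    show "continuous_on {0..1} (E i)"
      using e(1)[OF i] by (simp add: E_def redirect_def path_def[symmetric])
    show "E i 0 = p" "E i 1 = p"
      using e(2,3)[OF i] by (simp_all add: E_def redirect_def reversepath_def)
    show "inj_on (E i) {0<..<1}"
    proof (cases "\<sigma> i")
      case False
      have "inj_on (e i \<circ> (\<lambda>u. 1 - u)) {0<..<1}"
        by (rule comp_inj_on[OF _ inj_on_subset[OF e(4)[OF i]]]) (auto simp: inj_on_def)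
      then show ?thesis
        using False by (simp add: E_def redirect_def reversepath_def o_def)
    qed (use e(4)[OF i] in \<open>simp add: E_def redirect_def\<close>)
    show "p \<notin> E i ` {0<..<1}"
      using e(5)[OF i] by (simp add: E_def redirect_image)
    show "E i ` {0<..<1} \<inter> E j ` {0<..<1} = {}" if "j < n" "i \<noteq> j" for j
      using graph i that unfolding finite_digraph_def by (simp add: E_def redirect_image)
  next
    show "X = insert p (\<Union>i<n. E i ` {0..1})"
      using graph unfolding finite_digraph_def V by (simp add: E_def redirect_image)
  qed
  interpret wedge_of_circles X p n E
    by (rule wedge)
  have "\<exists>m t. t 0 = 0 \<and> t m = 1 \<and> (\<forall>k<m. \<exists>j h. runs (\<lambda>u. f (E i u)) j h (t k) (t (Suc k)))"
    if i: "i < n" for i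
  proof -
    \<comment> \<open>An edge is itself a directed path, with one piece and the identity as
      parameter. Applying orientability to it gives the decomposition of its image into
      runs.\<close>
    have "positively_directed n E (E i)"
      unfolding positively_directed_def
    proof
      show "path (E i)"
        using E_path[OF i] by (simp add: path_def)
      show "\<exists>(m::nat) t. t 0 = 0 \<and> t m = 1 \<and> (\<forall>j<m. t j < t (Suc j) \<and>
           (\<exists>i'<n. \<exists>h. continuous_on {t j..t (Suc j)} h \<and> strict_mono_on {t j..t (Suc j)} h \<and>
              h ` {t j..t (Suc j)} \<subseteq> {0..1} \<and> (\<forall>s\<in>{t j..t (Suc j)}. E i s = E i' (h s))))"
        using i
        by (intro exI[of _ 1] exI[of _ "real"] conjI allI impI exI[of _ i] exI[of _ "\<lambda>u. u"])
          (auto simp: strict_mono_on_def)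
    qed
    then have "positively_directed n E (f \<circ> E i)"
      using \<sigma> by (simp add: E_def)
    then obtain m :: nat and t where t: "t 0 = 0" "t m = 1" and k: "\<forall>k<m. t k < t (Suc k) \<and>
        (\<exists>j<n. \<exists>h. continuous_on {t k..t (Suc k)} h \<and> strict_mono_on {t k..t (Suc k)} h \<and>
          h ` {t k..t (Suc k)} \<subseteq> {0..1} \<and> (\<forall>s\<in>{t k..t (Suc k)}. (f \<circ> E i) s = E j (h s)))"
      unfolding positively_directed_def by (elim exE conjE) (rule that)
    have "\<exists>j h. runs (\<lambda>u. f (E i u)) j h (t k) (t (Suc k))" if "k < m" for k
      using k[rule_format, OF that] unfolding runs_def o_def by blast
    then show ?thesis
      using t by blast
  qed
  then have "wedge_system X p n E f lam \<mu>\<^sub>0"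
    using wedge f V(2) assms(3-5) nw expansion_redirect[OF ex, of \<sigma>]
    by (intro wedge_system.intro wedge_system_axioms.intro) (simp_all add: E_def)
  then show ?thesis
    by (rule wedge_system.solenoid_smale)
qed

end
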